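(* Let $G$ be a tree on $n \geq 3$ vertices. Then $$\frac12 \;\leq\; T_{\rm bestmix}(G) \;\leq\; \begin{cases} \frac{1}{12}(n^2+4n-6) & \text{if } n \text{ is even},\\[2pt] \frac{1}{12}(n^2+4n-15) & \text{if } n \text{ is odd}.\end{cases}$$ Among all trees on $n$ vertices, the star $S_n$ is the unique (up to isomorphism) tree minimizing $T_{\rm bestmix}$, attaining the lower bound. For $n$ even, the path $P_n$ is the unique (up to isomorphism) tree maximizing $T_{\rm bestmix}$, attaining the upper bound. For $n$ odd, the wishbone $Y_n$ is the unique (up to isomorphism) tree maximizing $T_{\rm bestmix}$, attaining the upper bound.
   Context: Graphs are finite, simple and undirected. The simple (non-lazy) random walk on a tree $G=(V,E)$ moves at each step from the current vertex to a uniformly random neighbor. Its stationary distribution is $\pi_v=\deg(v)/(2|E|)$. For a vertex $v$, a $(v,\pi)$ stopping rule is a (possibly randomized) stopping rule which halts the walk started at $v$ so that the final state has distribution $\pi$; $H(v,\pi)$ denotes the minimum expected number of steps over all $(v,\pi)$ stopping rules. The best mixing time is $T_{\rm bestmix}(G)=\min_{v\in V}H(v,\pi)$. $S_n=K_{1,n-1}$ is the star on $n$ vertices and $P_n$ is the path on $n$ vertices. For odd $n$, the wishbone $Y_n$ is the tree consisting of a path on $n-1$ vertices together with one additional leaf adjacent to one of the two central vertices of that path. *)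

theory Defs
  imports "HOL-Probability.Probability_Mass_Function"
begin

section \<open>Finite simple graphs and trees\<close>

record 'a sgraph =
  verts :: "'a set"
  edges :: "'a set set"

definition simple_graph :: "'a sgraph \<Rightarrow> bool" where
  "simple_graph G \<longleftrightarrow>
     finite (verts G) \<and> (\<forall>e\<in>edges G. e \<subseteq> verts G \<and> card e = 2)"

definition adj :: "'a sgraph \<Rightarrow> 'a \<Rightarrow> 'a \<Rightarrow> bool" where
  "adj G u v \<longleftrightarrow> {u, v} \<in> edges G"

definition neighbors :: "'a sgraph \<Rightarrow> 'a \<Rightarrow> 'a set" where
  "neighbors G v = {u. adj G v u}"

definition deg :: "'a sgraph \<Rightarrow> 'a \<Rightarrow> nat" where
  "deg G v = card (neighbors G v)"

definition connected_graph :: "'a sgraph \<Rightarrow> bool" where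
  "connected_graph G \<longleftrightarrow>
     verts G \<noteq> {} \<and> (\<forall>u\<in>verts G. \<forall>v\<in>verts G. (adj G)\<^sup>*\<^sup>* u v)"

definition cycle :: "'a sgraph \<Rightarrow> 'a list \<Rightarrow> bool" where
  "cycle G c \<longleftrightarrow>
     3 \<le> length c \<and> distinct c \<and> successively (adj G) c \<and> adj G (last c) (hd c)"

definition tree :: "'a sgraph \<Rightarrow> bool" where
  "tree G \<longleftrightarrow> simple_graph G \<and> connected_graph G \<and> (\<nexists>c. cycle G c)"

definition isomorphic :: "'a sgraph \<Rightarrow> 'b sgraph \<Rightarrow> bool" where
  "isomorphic G H \<longleftrightarrow>
     (\<exists>f. bij_betw f (verts G) (verts H) \<and>
          (\<forall>u\<in>verts G. \<forall>v\<in>verts G. adj G u v \<longleftrightarrow> adj H (f u) (f v)))"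

definition star_graph :: "nat \<Rightarrow> nat sgraph" where
  "star_graph n = \<lparr>verts = {0..<n}, edges = {{0, i} | i. 1 \<le> i \<and> i < n}\<rparr>"

definition path_graph :: "nat \<Rightarrow> nat sgraph" where
  "path_graph n = \<lparr>verts = {0..<n}, edges = {{i, i + 1} | i. i + 1 < n}\<rparr>"

text \<open>Meant for odd \<open>n\<close> with \<open>n \<ge> 3\<close>: the central vertices of the path on \<open>0, \<dots>, n - 2\<close> are
  \<open>n div 2 - 1\<close> and \<open>n div 2\<close>; the extra leaf is \<open>n - 1\<close>.\<close>

definition wishbone :: "nat \<Rightarrow> nat sgraph" where
  "wishbone n =
     \<lparr>verts = insert (n - 1) (verts (path_graph (n - 1))),
      edges = insert {n div 2, n - 1} (edges (path_graph (n - 1)))\<rparr>"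


section \<open>Random walks and stopping rules\<close>

definition stationary :: "'a sgraph \<Rightarrow> 'a \<Rightarrow> real" where
  "stationary G v = real (deg G v) / (2 * real (card (edges G)))"

text \<open>The law of the trajectory \<open>[w\<^sub>0, \<dots>, w\<^sub>t]\<close> of the first \<open>t\<close> steps of simple random walk
  started at \<open>v\<close>. As \<open>pmf_of_set\<close> is unspecified on the empty set, this is only meaningful if
  no vertex reachable from \<open>v\<close> is isolated.\<close>

primrec walk :: "'a sgraph \<Rightarrow> 'a \<Rightarrow> nat \<Rightarrow> 'a list pmf" where
  "walk G v 0 = return_pmf [v]"
| "walk G v (Suc t) =
     bind_pmf (walk G v t)
       (\<lambda>w. map_pmf (\<lambda>u. w @ [u]) (pmf_of_set (neighbors G (last w))))"

text \<open>A randomized stopping rule assigns to every finite trajectory \<open>w\<close> the conditional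
  probability \<open>\<Gamma> w\<close> of stopping at the end of \<open>w\<close>, given that the walk has followed \<open>w\<close> and has not
  been stopped earlier. Thus \<open>halts_at \<Gamma> w\<close> is the probability, given that the walk follows \<open>w\<close>,
  of stopping exactly at the end of \<open>w\<close>.\<close>

definition randomized_rule :: "('a list \<Rightarrow> real) \<Rightarrow> bool" where
  "randomized_rule \<Gamma> \<longleftrightarrow> (\<forall>w. 0 \<le> \<Gamma> w \<and> \<Gamma> w \<le> 1)"

definition halts_at :: "('a list \<Rightarrow> real) \<Rightarrow> 'a list \<Rightarrow> real" where
  "halts_at \<Gamma> w = (\<Prod>k=1..<length w. 1 - \<Gamma> (take k w)) * \<Gamma> w"

definition prob_stop_time :: "'a sgraph \<Rightarrow> 'a \<Rightarrow> ('a list \<Rightarrow> real) \<Rightarrow> nat \<Rightarrow> real" where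
  "prob_stop_time G v \<Gamma> t = measure_pmf.expectation (walk G v t) (halts_at \<Gamma>)"

definition prob_stop_time_state ::
    "'a sgraph \<Rightarrow> 'a \<Rightarrow> ('a list \<Rightarrow> real) \<Rightarrow> nat \<Rightarrow> 'a \<Rightarrow> real" where
  "prob_stop_time_state G v \<Gamma> t u =
     measure_pmf.expectation (walk G v t) (\<lambda>w. if last w = u then halts_at \<Gamma> w else 0)"

text \<open>The final state has law \<open>\<pi>\<close>. Since \<open>\<pi>\<close> has total mass 1, such a rule stops almost surely;
  hence \<open>\<Sum>t. t * P(T = t)\<close> below is the expectation of its stopping time \<open>T\<close>.\<close>

definition pi_stopping_rule :: "'a sgraph \<Rightarrow> 'a \<Rightarrow> ('a list \<Rightarrow> real) \<Rightarrow> bool" where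
  "pi_stopping_rule G v \<Gamma> \<longleftrightarrow>
     randomized_rule \<Gamma> \<and>
     (\<forall>u\<in>verts G. (\<lambda>t. prob_stop_time_state G v \<Gamma> t u) sums stationary G u)"

definition expected_steps :: "'a sgraph \<Rightarrow> 'a \<Rightarrow> ('a list \<Rightarrow> real) \<Rightarrow> ennreal" where
  "expected_steps G v \<Gamma> = (\<Sum>t. ennreal (real t * prob_stop_time G v \<Gamma> t))"

text \<open>The access time \<open>H(v, \<pi>)\<close>. The minimum over all rules is rendered as an infimum in
  \<open>[0, \<infinity>]\<close>, which agrees with it whenever it is attained.\<close>

definition access_time :: "'a sgraph \<Rightarrow> 'a \<Rightarrow> ennreal" where
  "access_time G v = (INF \<Gamma> \<in> {\<Gamma>. pi_stopping_rule G v \<Gamma>}. expected_steps G v \<Gamma>)"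

definition T_bestmix :: "'a sgraph \<Rightarrow> ennreal" where
  "T_bestmix G = (MIN v \<in> verts G. access_time G v)"

end

theory Submission
  imports Defs
begin

text \<open>
Write \<open>m = n - 1\<close> for the number of edges. The argument has three ingredients.

\<^emph>\<open>Access times by duality.\<close> A function \<open>h\<close> with \<open>h x \<le> 1 + avg h\<close>, the average being over the
neighbours of \<open>x\<close>, makes \<open>h (X\<^sub>t) + t\<close> a submartingale, so every \<open>(s, \<pi>)\<close> rule needs at least
\<open>h s - \<Sum>\<pi> h\<close> steps (\<open>weak_duality\<close>). Conversely, if \<open>Y \<ge> 0\<close> solves the Poisson equation that the
rescaled exit frequencies of a rule from \<open>s\<close> to \<open>\<pi>\<close> must satisfy, then stopping at \<open>v\<close> with
probability \<open>1 / (1 + Y v)\<close>, independently of the past, realises \<open>Y\<close> and takes \<open>\<Sum>\<pi> Y\<close> steps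
(\<open>access_time_le_potential\<close>). On a tree the equation has an explicit solution. Deleting an edge \<open>e\<close>
leaves on the side away from \<open>s\<close> a subtree of degree sum \<open>w e = 2 k - 1\<close>, with \<open>k\<close> its number of
vertices; the sum \<open>D\<^sub>s v\<close> of \<open>w\<close> over the edges between \<open>s\<close> and \<open>v\<close> is the expected time to go from
\<open>v\<close> to \<open>s\<close>, and \<open>Y = max D\<^sub>s - D\<^sub>s\<close> yields
\<open>H(s, \<pi>) \<le> max D\<^sub>s - (\<Sum>e. (w e)\<^sup>2) / (2 m)\<close> (\<open>access_time_le_hitting\<close>).

\<^emph>\<open>The upper bound.\<close> Let \<open>s\<close> minimise the right-hand side, let \<open>v\<close> be farthest from \<open>s\<close>, and let
\<open>e\<^sub>0 = s u\<close> be the first edge towards \<open>v\<close>. Moving the root to \<open>u\<close> does not help, and this produces a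
vertex \<open>v'\<close> in another direction with \<open>D\<^sub>s v \<le> w e\<^sub>0 + D\<^sub>s v'\<close> (\<open>exists_balanced_root\<close>). Replacing
\<open>2 m D\<^sub>s v\<close> by \<open>m\<close> times the sum of the two sides turns \<open>2 m\<close> times the bound into the separable expression
\<open>m\<^sup>2 - (w e\<^sub>0 - m)\<^sup>2 + \<Sum> w (m - w) + \<Sum> w (m - w) - \<Sum> w\<^sup>2\<close>, less \<open>m\<close> times the gap in the inequality
(\<open>excess_eq\<close>); the sums run over the rest of the path to \<open>v\<close>, the path to \<open>v'\<close>, and all other
edges. Along a path the weights are distinct odd numbers, so each of the first two sums is at most
the sum of \<open>j (m - j)\<close> over all odd \<open>j < m\<close>. For even \<open>n\<close> this is the bound, and equality leaves no room for edges
off the two paths: the tree is a path. For odd \<open>n\<close> the number \<open>m\<close> is even, hence \<open>w e\<^sub>0 \<noteq> m\<close>, and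
there are too few vertices for both paths to contain the weight \<open>m - 1\<close>; a case distinction
(\<open>profit_deficit_even\<close>) shows for \<open>n \<ge> 5\<close> that at least \<open>2 m\<close> is lost, with equality only if both the
path from \<open>u\<close> to \<open>v\<close> and the path from \<open>s\<close> to \<open>v'\<close> have the weights \<open>1, 3, \<dots>, m - 3\<close> and one leaf
remains, which is the wishbone.

\<^emph>\<open>The lower bounds.\<close> A rule cannot stop at time \<open>0\<close> with probability above \<open>\<pi> s \<le> 1 / 2\<close>; this gives
\<open>1 / 2\<close>, and equality requires a vertex adjacent to all others. On the path and
the wishbone, weak duality with the hitting time of an end of the path as test function shows that no
starting vertex is better than the two central ones.
\<close>

section \<open>Graphs without isolated vertices\<close>

locale simple_graph_no_isolated =
  fixes G :: "'a sgraph"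
  assumes simple: "simple_graph G"
    and no_isolated: "\<And>v. v \<in> verts G \<Longrightarrow> neighbors G v \<noteq> {}"
begin

lemma finite_verts [simp]: "finite (verts G)"
  using simple by (simp add: simple_graph_def)

lemma adj_in_verts: "adj G u v \<Longrightarrow> u \<in> verts G \<and> v \<in> verts G"
  using simple by (auto simp: simple_graph_def adj_def)

lemma adj_neq: "adj G u v \<Longrightarrow> u \<noteq> v"
  using simple by (fastforce simp: simple_graph_def adj_def)

lemma adj_sym: "adj G u v \<longleftrightarrow> adj G v u"
  by (simp add: adj_def insert_commute)

lemma neighbors_subset: "neighbors G v \<subseteq> verts G"
  using adj_in_verts by (auto simp: neighbors_def)

lemma finite_neighbors [simp]: "finite (neighbors G v)"
  using neighbors_subset finite_verts by (rule finite_subset)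

lemma deg_pos: "v \<in> verts G \<Longrightarrow> 0 < deg G v"
  using no_isolated by (simp add: deg_def card_gt_0_iff)

lemma sum_neighbors_swap:
  fixes F :: "'a \<Rightarrow> 'a \<Rightarrow> real"
  shows "(\<Sum>v\<in>verts G. \<Sum>u\<in>neighbors G v. F v u) = (\<Sum>u\<in>verts G. \<Sum>v\<in>neighbors G u. F v u)"
proof -
  have "(\<Sum>v\<in>verts G. \<Sum>u\<in>neighbors G v. F v u)
      = (\<Sum>v\<in>verts G. \<Sum>u\<in>{u\<in>verts G. adj G v u}. F v u)"
    using adj_in_verts by (intro sum.cong refl) (auto simp: neighbors_def)
  also have "\<dots> = (\<Sum>u\<in>verts G. \<Sum>v\<in>{v\<in>verts G. adj G v u}. F v u)"
    by (rule sum.swap_restrict) auto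
  also have "\<dots> = (\<Sum>u\<in>verts G. \<Sum>v\<in>neighbors G u. F v u)"
    using adj_in_verts adj_sym by (intro sum.cong refl) (auto simp: neighbors_def)
  finally show ?thesis .
qed

lemma finite_edges: "finite (edges G)"
proof (rule finite_subset)
  show "edges G \<subseteq> Pow (verts G)" using simple by (auto simp: simple_graph_def)
qed simp

lemma handshake: "(\<Sum>v\<in>verts G. deg G v) = 2 * card (edges G)"
proof -
  have two: "card {v\<in>verts G. v \<in> e} = 2" if "e \<in> edges G" for e
  proof -
    from that simple have "e \<subseteq> verts G" "card e = 2" by (auto simp: simple_graph_def)
    then show ?thesis by (simp add: Int_absorb1 Collect_conj_eq)
  qed
  have "deg G v = card {e\<in>edges G. v \<in> e}" for v
  proof -
    have "bij_betw (\<lambda>u. {v, u}) (neighbors G v) {e\<in>edges G. v \<in> e}"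
    proof (rule bij_betw_imageI)
      show "inj_on (\<lambda>u. {v, u}) (neighbors G v)"
        by (auto simp: inj_on_def doubleton_eq_iff)
      show "(\<lambda>u. {v, u}) ` neighbors G v = {e\<in>edges G. v \<in> e}"
      proof (intro equalityI subsetI)
        fix e assume e: "e \<in> {e\<in>edges G. v \<in> e}"
        with simple have "card e = 2" by (auto simp: simple_graph_def)
        then obtain x y where "e = {x, y}" by (auto simp: card_2_iff)
        with e show "e \<in> (\<lambda>u. {v, u}) ` neighbors G v"
          by (auto simp: neighbors_def adj_def insert_commute)
      qed (auto simp: neighbors_def adj_def)
    qed
    then show ?thesis unfolding deg_def by (rule bij_betw_same_card)
  qed
  then have "(\<Sum>v\<in>verts G. deg G v) = (\<Sum>v\<in>verts G. \<Sum>e\<in>{e\<in>edges G. v \<in> e}. 1)"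
    by simp
  also have "\<dots> = (\<Sum>e\<in>edges G. \<Sum>v\<in>{v\<in>verts G. v \<in> e}. 1)"
    by (rule sum.swap_restrict) (use finite_edges in auto)
  also have "\<dots> = 2 * card (edges G)" using two by simp
  finally show ?thesis .
qed

lemma edges_pos: "verts G \<noteq> {} \<Longrightarrow> 0 < card (edges G)"
proof -
  assume "verts G \<noteq> {}"
  then have "0 < (\<Sum>v\<in>verts G. deg G v)"
    using deg_pos by (intro sum_pos) auto
  then show ?thesis by (simp add: handshake)
qed

lemma sum_stationary: "verts G \<noteq> {} \<Longrightarrow> (\<Sum>v\<in>verts G. stationary G v) = 1"
  using edges_pos handshake unfolding stationary_def
  by (simp flip: sum_divide_distrib of_nat_sum)

lemma stationary_pos:
  assumes "v \<in> verts G"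
  shows "0 < stationary G v"
proof -
  have "verts G \<noteq> {}" using assms by auto
  then show ?thesis using edges_pos deg_pos[OF assms] by (simp add: stationary_def)
qed

section \<open>Trajectories and lower bounds on access times\<close>

text \<open>Every trajectory is non-empty and ends in the graph, and there are only finitely many of each
length; expectations over trajectories are therefore finite sums, without integrability conditions.\<close>

lemma walk_support:
  assumes "s \<in> verts G" "w \<in> set_pmf (walk G s t)"
  shows "w \<noteq> [] \<and> last w \<in> verts G"
  using assms(2)
proof (induction t arbitrary: w)
  case 0
  then show ?case using assms(1) by simp
next
  case (Suc t)
  then obtain w' where w': "w' \<in> set_pmf (walk G s t)"
    and w: "w \<in> set_pmf (map_pmf (\<lambda>u. w' @ [u]) (pmf_of_set (neighbors G (last w'))))"
    by auto
  with Suc.IH have "last w' \<in> verts G" by blast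
  with w no_isolated neighbors_subset[of "last w'"] show ?case by (auto simp: set_pmf_of_set)
qed

lemma finite_walk_support:
  assumes "s \<in> verts G"
  shows "finite (set_pmf (walk G s t))"
proof (induction t)
  case (Suc t)
  then show ?case using walk_support[OF assms] no_isolated
    by (auto simp: set_pmf_of_set)
qed simp

lemma integrable_walk [simp]:
  fixes F :: "'a list \<Rightarrow> real"
  assumes "s \<in> verts G"
  shows "integrable (measure_pmf (walk G s t)) F"
  by (rule integrable_measure_pmf_finite[OF finite_walk_support[OF assms]])

lemma expectation_walk_cong:
  fixes F F' :: "'a list \<Rightarrow> real"
  assumes "s \<in> verts G"
    and "\<And>w. w \<noteq> [] \<Longrightarrow> last w \<in> verts G \<Longrightarrow> F w = F' w"
  shows "measure_pmf.expectation (walk G s t) F = measure_pmf.expectation (walk G s t) F'"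
  using walk_support[OF assms(1)] assms(2)
  by (intro integral_cong_AE) (auto simp: AE_measure_pmf_iff)

lemma expectation_walk_mono:
  fixes F F' :: "'a list \<Rightarrow> real"
  assumes "s \<in> verts G"
    and "\<And>w. w \<noteq> [] \<Longrightarrow> last w \<in> verts G \<Longrightarrow> F w \<le> F' w"
  shows "measure_pmf.expectation (walk G s t) F \<le> measure_pmf.expectation (walk G s t) F'"
  using walk_support[OF assms(1)] assms
  by (intro integral_mono_AE) (auto simp: AE_measure_pmf_iff)

text \<open>The Markov property in the form in which it is used: conditioning on the first \<open>t\<close> steps turns the
last step into an average over neighbours.\<close>

lemma expectation_walk_Suc:
  fixes F :: "'a list \<Rightarrow> real"
  assumes "s \<in> verts G"
  shows "measure_pmf.expectation (walk G s (Suc t)) F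
       = measure_pmf.expectation (walk G s t)
           (\<lambda>w. (\<Sum>u\<in>neighbors G (last w). F (w @ [u])) / real (deg G (last w)))"
proof -
  let ?A = "set_pmf (walk G s t)"
  have *: "measure_pmf.expectation (map_pmf (\<lambda>u. w @ [u]) (pmf_of_set (neighbors G (last w)))) F
      = (\<Sum>u\<in>neighbors G (last w). F (w @ [u])) / real (deg G (last w))" if "w \<in> ?A" for w
    using walk_support[OF assms that] no_isolated
    by (simp add: integral_pmf_of_set deg_def)
  have "measure_pmf.expectation (walk G s (Suc t)) F
      = (\<Sum>w\<in>?A. pmf (walk G s t) w *\<^sub>R
           measure_pmf.expectation (map_pmf (\<lambda>u. w @ [u]) (pmf_of_set (neighbors G (last w)))) F)"
    unfolding walk.simps
    using walk_support[OF assms] no_isolated finite_walk_support[OF assms]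
    by (intro pmf_expectation_bind) (auto simp: set_pmf_of_set)
  also have "\<dots> = (\<Sum>w\<in>?A. pmf (walk G s t) w *\<^sub>R
           ((\<Sum>u\<in>neighbors G (last w). F (w @ [u])) / real (deg G (last w))))"
    using * by (intro sum.cong) auto
  also have "\<dots> = measure_pmf.expectation (walk G s t)
           (\<lambda>w. (\<Sum>u\<in>neighbors G (last w). F (w @ [u])) / real (deg G (last w)))"
    by (rule integral_measure_pmf[symmetric]) (use finite_walk_support[OF assms] in auto)
  finally show ?thesis .
qed

end

text \<open>The probability of not having stopped strictly before the end of \<open>w\<close>, given that the walk follows
\<open>w\<close>: the first factor of \<^const>\<open>halts_at\<close>.\<close>

definition alive :: "('a list \<Rightarrow> real) \<Rightarrow> 'a list \<Rightarrow> real" where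
  "alive \<Gamma> w = (\<Prod>k=1..<length w. 1 - \<Gamma> (take k w))"

lemma alive_singleton [simp]: "alive \<Gamma> [v] = 1"
  by (simp add: alive_def)

lemma alive_snoc: "w \<noteq> [] \<Longrightarrow> alive \<Gamma> (w @ [u]) = alive \<Gamma> w * (1 - \<Gamma> w)"
proof -
  assume "w \<noteq> []"
  then have "{1..<length (w @ [u])} = insert (length w) {1..<length w}"
    by (cases w) auto
  then show ?thesis by (simp add: alive_def)
qed

lemma halts_at_alive: "halts_at \<Gamma> w = alive \<Gamma> w * \<Gamma> w"
  by (simp add: halts_at_def alive_def)

lemma alive_nonneg: "randomized_rule \<Gamma> \<Longrightarrow> 0 \<le> alive \<Gamma> w"
  by (auto simp: alive_def randomized_rule_def intro!: prod_nonneg)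

text \<open>Summation by parts behind \<open>E T = \<Sum>t. P(T > t)\<close>, for \<open>p t = P(T \<ge> t)\<close> and \<open>q t = P(T = t)\<close>. The
finite form with its boundary term is needed as \<open>E T\<close> may be infinite.\<close>

lemma abel_tail_sum:
  fixes p q :: "nat \<Rightarrow> real"
  assumes "\<And>t. p (Suc t) = p t - q t"
  shows "(\<Sum>t\<le>N. real t * q t) = (\<Sum>t<N. p (Suc t)) - real N * p (Suc N)"
  by (induction N) (auto simp: assms algebra_simps)

context simple_graph_no_isolated
begin

definition alive_prob :: "'a \<Rightarrow> ('a list \<Rightarrow> real) \<Rightarrow> nat \<Rightarrow> real" where
  "alive_prob s \<Gamma> t = measure_pmf.expectation (walk G s t) (alive \<Gamma>)"

lemma alive_prob_0 [simp]: "alive_prob s \<Gamma> 0 = 1"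
  by (simp add: alive_prob_def)

lemma alive_prob_Suc:
  assumes "s \<in> verts G"
  shows "alive_prob s \<Gamma> (Suc t) = alive_prob s \<Gamma> t - prob_stop_time G s \<Gamma> t"
proof -
  have "alive_prob s \<Gamma> (Suc t)
      = measure_pmf.expectation (walk G s t) (\<lambda>w. alive \<Gamma> w - halts_at \<Gamma> w)"
    unfolding alive_prob_def expectation_walk_Suc[OF assms]
  proof (intro expectation_walk_cong[OF assms])
    fix w :: "'a list" assume "w \<noteq> []" "last w \<in> verts G"
    then show "(\<Sum>u\<in>neighbors G (last w). alive \<Gamma> (w @ [u])) / real (deg G (last w))
        = alive \<Gamma> w - halts_at \<Gamma> w"
      using deg_pos[of "last w"]
      by (simp add: alive_snoc halts_at_alive diff_divide_distrib right_diff_distrib flip: deg_def)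
  qed
  then show ?thesis
    using assms by (simp add: alive_prob_def prob_stop_time_def)
qed

lemma alive_prob_nonneg: "randomized_rule \<Gamma> \<Longrightarrow> 0 \<le> alive_prob s \<Gamma> t"
  by (simp add: alive_prob_def alive_nonneg)

lemma alive_prob_eq:
  assumes "s \<in> verts G"
  shows "alive_prob s \<Gamma> N = 1 - (\<Sum>t<N. prob_stop_time G s \<Gamma> t)"
  by (induction N) (auto simp: alive_prob_Suc[OF assms])

lemma prob_stop_time_nonneg: "randomized_rule \<Gamma> \<Longrightarrow> 0 \<le> prob_stop_time G s \<Gamma> t"
  by (auto simp: prob_stop_time_def halts_at_alive alive_nonneg randomized_rule_def
      intro!: Bochner_Integration.integral_nonneg mult_nonneg_nonneg)

lemma weighted_stop_time:
  assumes "s \<in> verts G"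
  shows "measure_pmf.expectation (walk G s t) (\<lambda>w. halts_at \<Gamma> w * h (last w))
       = (\<Sum>u\<in>verts G. prob_stop_time_state G s \<Gamma> t u * h u)"
proof -
  have "(\<Sum>u\<in>verts G. prob_stop_time_state G s \<Gamma> t u * h u)
      = measure_pmf.expectation (walk G s t)
          (\<lambda>w. \<Sum>u\<in>verts G. (if last w = u then halts_at \<Gamma> w else 0) * h u)"
    unfolding prob_stop_time_state_def using assms by simp
  also have "\<dots> = measure_pmf.expectation (walk G s t) (\<lambda>w. halts_at \<Gamma> w * h (last w))"
    by (intro expectation_walk_cong[OF assms]) (simp add: if_distrib[of "\<lambda>x. x * _"] cong: if_cong)
  finally show ?thesis by simp
qed

lemma prob_stop_time_sum:
  assumes "s \<in> verts G"
  shows "prob_stop_time G s \<Gamma> t = (\<Sum>u\<in>verts G. prob_stop_time_state G s \<Gamma> t u)"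
  using weighted_stop_time[OF assms, of t \<Gamma> "\<lambda>_. 1"] by (simp add: prob_stop_time_def)

text \<open>The condition on \<open>h\<close> makes \<open>h (X\<^sub>t) + t\<close> a submartingale, and the claim is optional stopping. The
stopping time is unbounded, but \<open>h\<close> is bounded and the surviving mass tends to \<open>0\<close>, so truncation at
time \<open>N\<close> suffices.\<close>

lemma weak_duality:
  assumes s: "s \<in> verts G" and rule: "pi_stopping_rule G s \<Gamma>"
    and sub: "\<And>x. x \<in> verts G \<Longrightarrow> h x \<le> 1 + (\<Sum>y\<in>neighbors G x. h y) / real (deg G x)"
  shows "ennreal (h s - (\<Sum>x\<in>verts G. stationary G x * h x)) \<le> expected_steps G s \<Gamma>"
proof -
  have rr: "randomized_rule \<Gamma>" using rule by (simp add: pi_stopping_rule_def)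
  define q where "q = prob_stop_time G s \<Gamma>"
  define p where "p = alive_prob s \<Gamma>"
  define qh where "qh t = (\<Sum>u\<in>verts G. prob_stop_time_state G s \<Gamma> t u * h u)" for t
  define A where "A t = measure_pmf.expectation (walk G s t) (\<lambda>w. alive \<Gamma> w * h (last w))" for t
  have p_Suc: "p (Suc t) = p t - q t" for t
    using alive_prob_Suc[OF s] by (simp add: p_def q_def)
  have p_nonneg: "0 \<le> p t" and q_nonneg: "0 \<le> q t" for t
    using alive_prob_nonneg[OF rr] prob_stop_time_nonneg[OF rr] by (auto simp: p_def q_def)
  have V: "verts G \<noteq> {}" using s by auto
  have q_sums: "q sums 1"
    unfolding q_def prob_stop_time_sum[OF s, abs_def] sum_stationary[OF V, symmetric]
    using rule by (intro sums_sum) (auto simp: pi_stopping_rule_def)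
  have qh_sums: "qh sums (\<Sum>x\<in>verts G. stationary G x * h x)"
    unfolding qh_def using rule by (intro sums_sum sums_mult2) (auto simp: pi_stopping_rule_def)
  have p_lim: "p \<longlonglongrightarrow> 0"
  proof -
    have "(\<lambda>N. 1 - (\<Sum>t<N. q t)) \<longlonglongrightarrow> 1 - 1"
      using q_sums unfolding sums_def by (intro tendsto_diff tendsto_const)
    then show ?thesis
      unfolding p_def q_def alive_prob_eq[OF s, abs_def] by simp
  qed
  (* any bound for |h| on the vertices will do; it dominates A by b * p *)
  define b where "b = (\<Sum>x\<in>verts G. \<bar>h x\<bar>)"
  have hb: "\<bar>h x\<bar> \<le> b" if "x \<in> verts G" for x
    unfolding b_def using that by (intro member_le_sum) auto
  have A_bound: "\<bar>A t\<bar> \<le> b * p t" for t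
  proof -
    have "\<bar>A t\<bar> \<le> measure_pmf.expectation (walk G s t) (\<lambda>w. \<bar>alive \<Gamma> w * h (last w)\<bar>)"
      unfolding A_def by (rule integral_abs_bound)
    also have "\<dots> \<le> measure_pmf.expectation (walk G s t) (\<lambda>w. b * alive \<Gamma> w)"
      using hb alive_nonneg[OF rr]
      by (intro expectation_walk_mono[OF s])
         (auto simp: abs_mult mult.commute[of b] intro!: mult_left_mono)
    finally show ?thesis by (simp add: p_def alive_prob_def)
  qed
  have A_lim: "A \<longlonglongrightarrow> 0"
  proof (rule Lim_null_comparison)
    show "\<forall>\<^sub>F t in sequentially. norm (A t) \<le> b * p t" using A_bound by simp
    show "(\<lambda>t. b * p t) \<longlonglongrightarrow> 0" using tendsto_mult_right_zero[OF p_lim] by simp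
  qed
  have A_step: "A t - qh t - p (Suc t) \<le> A (Suc t)" for t
  proof -
    have "A (Suc t) = measure_pmf.expectation (walk G s t)
        (\<lambda>w. alive \<Gamma> w * (1 - \<Gamma> w) * ((\<Sum>u\<in>neighbors G (last w). h u) / real (deg G (last w))))"
      unfolding A_def expectation_walk_Suc[OF s]
      by (intro expectation_walk_cong[OF s]) (auto simp: alive_snoc sum_distrib_left)
    also have "\<dots> \<ge> measure_pmf.expectation (walk G s t)
        (\<lambda>w. alive \<Gamma> w * (1 - \<Gamma> w) * (h (last w) - 1))"
    proof (intro expectation_walk_mono[OF s] mult_left_mono)
      fix w :: "'a list" assume "last w \<in> verts G"
      then show "h (last w) - 1 \<le> (\<Sum>u\<in>neighbors G (last w). h u) / real (deg G (last w))"
        using sub[of "last w"] by simp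
      show "0 \<le> alive \<Gamma> w * (1 - \<Gamma> w)"
        using alive_nonneg[OF rr] rr
        by (intro mult_nonneg_nonneg) (auto simp: randomized_rule_def)
    qed
    also have "(\<lambda>w. alive \<Gamma> w * (1 - \<Gamma> w) * (h (last w) - 1))
        = (\<lambda>w. alive \<Gamma> w * h (last w) - halts_at \<Gamma> w * h (last w) - (alive \<Gamma> w - halts_at \<Gamma> w))"
      by (auto simp: halts_at_alive algebra_simps)
    also have "measure_pmf.expectation (walk G s t) \<dots> = A t - qh t - p (Suc t)"
      using s weighted_stop_time[OF s, of t \<Gamma> h] p_Suc[of t]
      unfolding A_def qh_def q_def p_def alive_prob_def[of _ _ t] prob_stop_time_def by simp
    finally show ?thesis .
  qed
  have A_sum: "h s - A N - (\<Sum>t<N. qh t) \<le> (\<Sum>t<N. p (Suc t))" for N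
  proof (induction N)
    case 0
    show ?case using s by (simp add: A_def)
  next
    case (Suc N)
    then show ?case using A_step[of N] by simp
  qed
  show ?thesis
  proof (cases "expected_steps G s \<Gamma> = \<infinity>")
    case False
    then have summable: "summable (\<lambda>t. real t * q t)"
      unfolding expected_steps_def q_def
      using prob_stop_time_nonneg[OF rr] by (intro summable_suminf_not_top) auto
    define R where "R = (\<Sum>t. real t * q t)"
    have R: "expected_steps G s \<Gamma> = ennreal R"
      unfolding expected_steps_def R_def q_def[symmetric] using summable q_nonneg
      by (intro suminf_ennreal2) auto
    have "(\<Sum>t<N. p (Suc t)) \<le> R" for N
    proof -
      have lim: "(\<lambda>K. (\<Sum>t\<le>N. real t * q t) + real N * (p (Suc N) - p K))
          \<longlonglongrightarrow> (\<Sum>t\<le>N. real t * q t) + real N * (p (Suc N) - 0)"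
        by (intro tendsto_intros p_lim)
      have "(\<Sum>t\<le>N. real t * q t) + real N * (p (Suc N) - p K) \<le> R" if "Suc N \<le> K" for K
      proof -
        have "(\<Sum>t\<le>N. real t * q t) + real N * (p (Suc N) - p K) \<le> (\<Sum>t<K. real t * q t)"
          using that
        proof (induction K rule: dec_induct)
          case base
          show ?case by (simp add: lessThan_Suc_atMost)
        next
          case (step k)
          have "real N * q k \<le> real k * q k"
            using step.hyps q_nonneg by (intro mult_right_mono) auto
          with step.IH show ?case by (simp add: p_Suc algebra_simps)
        qed
        also have "\<dots> \<le> R" unfolding R_def
          using summable q_nonneg by (intro sum_le_suminf) auto
        finally show ?thesis .
      qed
      then have "(\<Sum>t\<le>N. real t * q t) + real N * (p (Suc N) - 0) \<le> R"
        by (intro tendsto_upperbound[OF lim]) (auto simp: eventually_at_top_linorder)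
      then show ?thesis by (simp add: abel_tail_sum[where p = p and q = q, OF p_Suc])
    qed
    then have "h s - A N - (\<Sum>t<N. qh t) \<le> R" for N
      using A_sum[of N] by (meson order_trans)
    moreover have "(\<lambda>N. h s - A N - (\<Sum>t<N. qh t))
        \<longlonglongrightarrow> h s - 0 - (\<Sum>x\<in>verts G. stationary G x * h x)"
      using qh_sums by (intro tendsto_diff A_lim tendsto_const) (simp add: sums_def)
    ultimately have "h s - 0 - (\<Sum>x\<in>verts G. stationary G x * h x) \<le> R"
      by (intro tendsto_upperbound[where f = "\<lambda>N. h s - A N - (\<Sum>t<N. qh t)"]) auto
    then show ?thesis unfolding R by (intro ennreal_leI) simp
  qed simp
qed

lemma access_time_ge_subsolution:
  assumes "s \<in> verts G"
    and "\<And>x. x \<in> verts G \<Longrightarrow> h x \<le> 1 + (\<Sum>y\<in>neighbors G x. h y) / real (deg G x)"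
  shows "ennreal (h s - (\<Sum>x\<in>verts G. stationary G x * h x)) \<le> access_time G s"
  unfolding access_time_def using weak_duality[OF assms(1) _ assms(2)] by (intro INF_greatest) auto

section \<open>Upper bounds on access times\<close>

text \<open>For a rule from \<open>s\<close> to \<open>\<pi>\<close> let \<open>x v\<close> be the expected number of exits from \<open>v\<close>. Arrivals balance
exits and stops: \<open>\<pi> v + x v = [v = s] + \<Sum>u. x u / deg u\<close>, the sum being over the neighbours of \<open>v\<close>. The hypothesis is this equation for
\<open>x = \<pi> Y\<close>. The local rule stops at \<open>v\<close> with probability \<open>\<pi> v / (\<pi> v + x v)\<close> whatever happened
before; its numbers of arrivals satisfy the same equation as \<open>\<pi> + x\<close>, and the difference of two
solutions is contracted, because the stopping probabilities are bounded away from \<open>0\<close>.\<close>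

lemma access_time_le_potential:
  fixes Y :: "'a \<Rightarrow> real"
  assumes s: "s \<in> verts G" and Y: "\<And>v. v \<in> verts G \<Longrightarrow> 0 \<le> Y v"
    and poisson: "\<And>v. v \<in> verts G \<Longrightarrow>
      (\<Sum>u\<in>neighbors G v. Y u) + (if v = s then 2 * real (card (edges G)) else 0)
        = real (deg G v) * (1 + Y v)"
  shows "access_time G s \<le> ennreal (\<Sum>v\<in>verts G. stationary G v * Y v)"
proof -
  let ?V = "verts G" and ?M = "2 * real (card (edges G))"
  have V: "?V \<noteq> {}" using s by auto
  have M: "0 < ?M" using edges_pos[OF V] by simp
  (* the absolute value makes r a probability off the vertices of G, too, as randomized_rule asks *)
  define r where "r v = 1 / (1 + \<bar>Y v\<bar>)" for v
  define \<Gamma> where "\<Gamma> w = r (last w)" for w :: "'a list"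
  have r: "0 < r v" "r v \<le> 1" for v by (auto simp: r_def)
  have rr: "randomized_rule \<Gamma>"
    unfolding randomized_rule_def \<Gamma>_def using r less_imp_le by blast
  (* g is the claimed and the sum of N t over t the actual expected number of arrivals at v *)
  define g where "g v = stationary G v * (1 + Y v)" for v
  have g_r: "g v * r v = stationary G v" and g_1r: "g v * (1 - r v) = stationary G v * Y v"
    if "v \<in> ?V" for v
    using Y[OF that] by (simp_all add: g_def r_def field_simps)
  define N where "N t v = measure_pmf.expectation (walk G s t)
      (\<lambda>w. if last w = v then alive \<Gamma> w else 0)" for t v
  have N0: "N 0 v = (if v = s then 1 else 0)" for v by (simp add: N_def)
  have N_nonneg: "0 \<le> N t v" for t v
    unfolding N_def by (intro Bochner_Integration.integral_nonneg) (simp add: alive_nonneg[OF rr])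
  have N_Suc: "N (Suc t) v = (\<Sum>u\<in>neighbors G v. N t u * (1 - r u) / real (deg G u))"
    if v: "v \<in> ?V" for t v
  proof -
    define c where "c u = (1 - r u) / real (deg G u)" for u
    have c: "a * (1 - r u) / real (deg G u) = a * c u" for a u by (simp add: c_def)
    have "N (Suc t) v = measure_pmf.expectation (walk G s t)
        (\<lambda>w. (\<Sum>u\<in>neighbors G (last w). if u = v then alive \<Gamma> w * (1 - \<Gamma> w) else 0)
              / real (deg G (last w)))"
      unfolding N_def expectation_walk_Suc[OF s]
      by (intro expectation_walk_cong[OF s]) (simp add: alive_snoc cong: if_cong)
    also have "\<dots> = measure_pmf.expectation (walk G s t)
        (\<lambda>w. \<Sum>u\<in>neighbors G v. (if last w = u then alive \<Gamma> w else 0) * c u)"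
    proof (intro expectation_walk_cong[OF s])
      fix w :: "'a list" assume "last w \<in> ?V"
      have "v \<in> neighbors G (last w) \<longleftrightarrow> last w \<in> neighbors G v"
        by (simp add: neighbors_def adj_sym)
      then show "(\<Sum>u\<in>neighbors G (last w). if u = v then alive \<Gamma> w * (1 - \<Gamma> w) else 0)
              / real (deg G (last w))
          = (\<Sum>u\<in>neighbors G v. (if last w = u then alive \<Gamma> w else 0) * c u)"
        by (simp add: \<Gamma>_def c if_distrib[of "\<lambda>x. x * _"] cong: if_cong)
    qed
    also have "\<dots> = (\<Sum>u\<in>neighbors G v. N t u * c u)"
      unfolding N_def using s by simp
    finally show ?thesis by (simp add: c_def)
  qed
  have state: "prob_stop_time_state G s \<Gamma> t v = N t v * r v" for t v
  proof -
    have "prob_stop_time_state G s \<Gamma> t v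
        = measure_pmf.expectation (walk G s t) (\<lambda>w. (if last w = v then alive \<Gamma> w else 0) * r v)"
      unfolding prob_stop_time_state_def
      by (intro expectation_walk_cong[OF s]) (auto simp: halts_at_alive \<Gamma>_def)
    then show ?thesis by (simp add: N_def)
  qed
  define \<rho> where "\<rho> K v = g v - (\<Sum>t<K. N t v)" for K v
  have g_fix: "g v = (if v = s then 1 else 0) + (\<Sum>u\<in>neighbors G v. g u * (1 - r u) / real (deg G u))"
    if v: "v \<in> ?V" for v
  proof -
    have "(\<Sum>u\<in>neighbors G v. g u * (1 - r u) / real (deg G u)) = (\<Sum>u\<in>neighbors G v. Y u) / ?M"
      unfolding sum_divide_distrib
    proof (intro sum.cong refl)
      fix u assume "u \<in> neighbors G v"
      then have "u \<in> ?V" using neighbors_subset by blast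
      then show "g u * (1 - r u) / real (deg G u) = Y u / ?M"
        using g_1r[of u] deg_pos[of u] by (simp add: stationary_def)
    qed
    moreover have "g v = ((\<Sum>u\<in>neighbors G v. Y u) + (if v = s then ?M else 0)) / ?M"
      unfolding poisson[OF v] by (simp add: g_def stationary_def)
    ultimately show ?thesis using M by (simp add: add_divide_distrib)
  qed
  have \<rho>_Suc: "\<rho> (Suc K) v = (\<Sum>u\<in>neighbors G v. \<rho> K u * (1 - r u) / real (deg G u))"
    if v: "v \<in> ?V" for K v
  proof -
    have "(\<Sum>t<Suc K. N t v) = N 0 v + (\<Sum>t<K. N (Suc t) v)"
      by (rule sum.lessThan_Suc_shift)
    also have "(\<Sum>t<K. N (Suc t) v)
        = (\<Sum>u\<in>neighbors G v. \<Sum>t<K. N t u * (1 - r u) / real (deg G u))"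
      unfolding N_Suc[OF v] by (rule sum.swap)
    finally have "\<rho> (Suc K) v = (\<Sum>u\<in>neighbors G v. g u * (1 - r u) / real (deg G u)
        - (\<Sum>t<K. N t u * (1 - r u) / real (deg G u)))"
      unfolding \<rho>_def by (subst g_fix[OF v]) (simp add: N0 sum_subtractf)
    then show ?thesis
      by (simp add: \<rho>_def sum_distrib_right left_diff_distrib diff_divide_distrib sum_divide_distrib)
  qed
  have \<rho>_nonneg: "0 \<le> \<rho> K v" if "v \<in> ?V" for K v
    using that
  proof (induction K arbitrary: v)
    case 0
    then show ?case using Y[of v] stationary_pos[of v] by (simp add: \<rho>_def g_def)
  next
    case (Suc K)
    then show ?case unfolding \<rho>_Suc[OF Suc.prems] using r subsetD[OF neighbors_subset]
      by (intro sum_nonneg divide_nonneg_nonneg mult_nonneg_nonneg) auto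
  qed
  (* the walk stops with probability at least \<epsilon> in every step, which contracts the residual \<rho> *)
  define \<epsilon> where "\<epsilon> = Min (r ` ?V)"
  have \<epsilon>: "0 < \<epsilon>" "\<And>v. v \<in> ?V \<Longrightarrow> \<epsilon> \<le> r v"
    using V r by (auto simp: \<epsilon>_def)
  have \<epsilon>1: "\<epsilon> \<le> 1" using \<epsilon>(2)[OF s] r(2)[of s] by linarith
  have sum_\<rho>: "(\<Sum>v\<in>?V. \<rho> K v) \<le> (1 - \<epsilon>) ^ K * (\<Sum>v\<in>?V. g v)" for K
  proof (induction K)
    case 0
    show ?case by (simp add: \<rho>_def)
  next
    case (Suc K)
    have "(\<Sum>v\<in>?V. \<rho> (Suc K) v)
        = (\<Sum>v\<in>?V. \<Sum>u\<in>neighbors G v. \<rho> K u * (1 - r u) / real (deg G u))"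
      using \<rho>_Suc by simp
    also have "\<dots> = (\<Sum>u\<in>?V. \<Sum>v\<in>neighbors G u. \<rho> K u * (1 - r u) / real (deg G u))"
      by (rule sum_neighbors_swap)
    also have "\<dots> = (\<Sum>u\<in>?V. \<rho> K u * (1 - r u))"
      using deg_pos[THEN less_imp_neq] by (intro sum.cong) (auto simp flip: deg_def)
    also have "\<dots> \<le> (\<Sum>u\<in>?V. (1 - \<epsilon>) * \<rho> K u)"
      using \<epsilon> \<rho>_nonneg by (intro sum_mono) (auto simp: mult.commute[of "1 - \<epsilon>"] intro!: mult_left_mono)
    also have "\<dots> = (1 - \<epsilon>) * (\<Sum>u\<in>?V. \<rho> K u)" by (simp add: sum_distrib_left)
    also have "\<dots> \<le> (1 - \<epsilon>) * ((1 - \<epsilon>) ^ K * (\<Sum>v\<in>?V. g v))"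
      using Suc.IH \<epsilon>1 by (intro mult_left_mono) auto
    finally show ?case by simp
  qed
  have N_sums: "(\<lambda>t. N t v) sums g v" if v: "v \<in> ?V" for v
  proof -
    have "(\<lambda>K. \<rho> K v) \<longlonglongrightarrow> 0"
    proof (rule Lim_null_comparison)
      have "norm (\<rho> K v) \<le> (1 - \<epsilon>) ^ K * (\<Sum>v\<in>?V. g v)" for K
      proof -
        have "\<rho> K v \<le> (\<Sum>v\<in>?V. \<rho> K v)"
          using v \<rho>_nonneg by (intro member_le_sum) auto
        with sum_\<rho>[of K] \<rho>_nonneg[OF v] show ?thesis by simp
      qed
      then show "\<forall>\<^sub>F K in sequentially. norm (\<rho> K v) \<le> (1 - \<epsilon>) ^ K * (\<Sum>v\<in>?V. g v)" by simp
      have "(\<lambda>K. (1 - \<epsilon>) ^ K) \<longlonglongrightarrow> 0" using \<epsilon> \<epsilon>1 by (intro LIMSEQ_power_zero) auto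
      then show "(\<lambda>K. (1 - \<epsilon>) ^ K * (\<Sum>v\<in>?V. g v)) \<longlonglongrightarrow> 0" by (rule tendsto_mult_left_zero)
    qed
    then have "(\<lambda>K. g v - \<rho> K v) \<longlonglongrightarrow> g v - 0" by (intro tendsto_diff tendsto_const)
    then show ?thesis by (simp add: \<rho>_def sums_def)
  qed
  have pi_rule: "pi_stopping_rule G s \<Gamma>"
    unfolding pi_stopping_rule_def
  proof (intro conjI ballI rr)
    fix v assume v: "v \<in> ?V"
    show "(\<lambda>t. prob_stop_time_state G s \<Gamma> t v) sums stationary G v"
      unfolding state g_r[OF v, symmetric] by (intro sums_mult2 N_sums v)
  qed
  define p where "p = alive_prob s \<Gamma>"
  define q where "q = prob_stop_time G s \<Gamma>"
  have p_Suc: "p (Suc t) = p t - q t" for t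
    using alive_prob_Suc[OF s] by (simp add: p_def q_def)
  have p_eq: "p t = (\<Sum>v\<in>?V. N t v)" for t
  proof -
    have "(\<Sum>v\<in>?V. N t v) = measure_pmf.expectation (walk G s t)
        (\<lambda>w. \<Sum>v\<in>?V. if last w = v then alive \<Gamma> w else 0)"
      unfolding N_def by (rule Bochner_Integration.integral_sum[symmetric]) (use s in simp)
    also have "\<dots> = p t" unfolding p_def alive_prob_def
      by (intro expectation_walk_cong[OF s]) simp
    finally show ?thesis by simp
  qed
  have q_eq: "q t = (\<Sum>v\<in>?V. N t v * r v)" for t
    unfolding q_def prob_stop_time_sum[OF s] state ..
  have partial: "(\<Sum>t\<le>K. real t * q t) \<le> (\<Sum>v\<in>?V. stationary G v * Y v)" for K
  proof -
    (* E T as a sum of tail probabilities; being alive after step t means having exited *)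
    have "(\<Sum>t\<le>K. real t * q t) \<le> (\<Sum>t<K. p (Suc t))"
      unfolding abel_tail_sum[where p = p and q = q, OF p_Suc] using alive_prob_nonneg[OF rr] by (simp add: p_def)
    also have "\<dots> = (\<Sum>t<K. \<Sum>v\<in>?V. N t v * (1 - r v))"
      unfolding p_Suc unfolding p_eq q_eq by (simp add: sum_subtractf right_diff_distrib)
    also have "\<dots> = (\<Sum>v\<in>?V. (\<Sum>t<K. N t v) * (1 - r v))"
      by (subst sum.swap) (simp add: sum_distrib_right)
    also have "\<dots> \<le> (\<Sum>v\<in>?V. g v * (1 - r v))"
      using \<rho>_nonneg r by (intro sum_mono mult_right_mono) (auto simp: \<rho>_def)
    also have "\<dots> = (\<Sum>v\<in>?V. stationary G v * Y v)" using g_1r by simp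
    finally show ?thesis .
  qed
  have "expected_steps G s \<Gamma> \<le> ennreal (\<Sum>v\<in>?V. stationary G v * Y v)"
    unfolding expected_steps_def
  proof (rule suminf_le_const[OF summableI])
    fix K
    have qn: "0 \<le> real t * q t" for t
      using prob_stop_time_nonneg[OF rr] by (simp add: q_def)
    have "(\<Sum>t<K. ennreal (real t * prob_stop_time G s \<Gamma> t)) = ennreal (\<Sum>t<K. real t * q t)"
      unfolding q_def[symmetric] using qn by (intro sum_ennreal) auto
    also have "\<dots> \<le> ennreal (\<Sum>t\<le>K. real t * q t)"
      using qn by (intro ennreal_leI sum_mono2) auto
    also have "\<dots> \<le> ennreal (\<Sum>v\<in>?V. stationary G v * Y v)"
      by (intro ennreal_leI partial)
    finally show "(\<Sum>t<K. ennreal (real t * prob_stop_time G s \<Gamma> t))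
        \<le> ennreal (\<Sum>v\<in>?V. stationary G v * Y v)" .
  qed
  then show ?thesis
    unfolding access_time_def using pi_rule by (intro INF_lower2) auto
qed

end

section \<open>Edge cuts of a tree\<close>

lemma rtranclp_imp_distinct_path:
  assumes "r\<^sup>*\<^sup>* x y"
  shows "\<exists>p. p \<noteq> [] \<and> hd p = x \<and> last p = y \<and> distinct p \<and> successively r p"
  using assms
proof (induction rule: rtranclp_induct)
  case base
  show ?case by (intro exI[of _ "[x]"]) simp
next
  case (step y z)
  then obtain p where p: "p \<noteq> []" "hd p = x" "last p = y" "distinct p" "successively r p"
    by blast
  show ?case
  proof (cases "z \<in> set p")
    case True
    then obtain as bs where "p = as @ z # bs" by (auto simp: in_set_conv_decomp)
    with p(2,4,5) have "hd (as @ [z]) = x" "distinct (as @ [z])" "successively r (as @ [z])"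
      by (simp_all add: successively_append_iff hd_append split: if_splits)
    then show ?thesis by (intro exI[of _ "as @ [z]"]) simp
  next
    case False
    with p step.hyps show ?thesis
      by (intro exI[of _ "p @ [z]"]) (simp add: successively_append_iff)
  qed
qed

locale nontrivial_tree =
  fixes G :: "'a sgraph"
  assumes tree: "tree G" and nontrivial: "2 \<le> card (verts G)"
begin

lemma connected: "u \<in> verts G \<Longrightarrow> v \<in> verts G \<Longrightarrow> (adj G)\<^sup>*\<^sup>* u v"
  using tree by (auto simp: tree_def connected_graph_def)

end

sublocale nontrivial_tree \<subseteq> simple_graph_no_isolated
proof
  show "simple_graph G" using tree by (simp add: tree_def)
  fix v assume v: "v \<in> verts G"
  have "\<not> verts G \<subseteq> {v}"
  proof
    assume "verts G \<subseteq> {v}"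
    from card_mono[OF _ this] nontrivial show False by simp
  qed
  then obtain u where "u \<in> verts G" "u \<noteq> v" by auto
  with connected[OF v] have "\<exists>w. adj G v w" by (blast elim: converse_rtranclpE)
  then show "neighbors G v \<noteq> {}" by (auto simp: neighbors_def)
qed

context nontrivial_tree
begin

text \<open>The pair \<open>(x, y)\<close> stands for an edge with a direction, and \<open>beyond (x, y)\<close> is the component of \<open>y\<close>
after deleting that edge. In a tree this is the part of the graph that is reached from \<open>x\<close> through
\<open>y\<close>. Using directed edges avoids a choice of root: both sides of an edge are of the same form.\<close>

definition beyond :: "'a \<times> 'a \<Rightarrow> 'a set" where
  "beyond e = {z. (\<lambda>u v. adj G u v \<and> {u, v} \<noteq> {fst e, snd e})\<^sup>*\<^sup>* (snd e) z}"

definition darts :: "('a \<times> 'a) set" where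
  "darts = {(x, y). adj G x y}"

lemma in_darts [simp]: "(x, y) \<in> darts \<longleftrightarrow> adj G x y"
  by (simp add: darts_def)

lemma finite_darts [simp]: "finite darts"
  by (rule finite_subset[of _ "verts G \<times> verts G"]) (use adj_in_verts in \<open>auto simp: darts_def\<close>)

lemma snd_in_beyond [simp]: "y \<in> beyond (x, y)"
  by (simp add: beyond_def)

lemma beyond_step:
  "u \<in> beyond (x, y) \<Longrightarrow> adj G u v \<Longrightarrow> {u, v} \<noteq> {x, y} \<Longrightarrow> v \<in> beyond (x, y)"
  unfolding beyond_def by (auto intro: rtranclp.rtrancl_into_rtrancl)

lemma beyond_induct [consumes 1, case_names head step]:
  assumes "z \<in> beyond (x, y)" and "P y"
    and "\<And>u v. u \<in> beyond (x, y) \<Longrightarrow> v \<in> beyond (x, y) \<Longrightarrow> adj G u v \<Longrightarrow> {u, v} \<noteq> {x, y}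
      \<Longrightarrow> P u \<Longrightarrow> P v"
  shows "P z"
proof -
  have "(\<lambda>u v. adj G u v \<and> {u, v} \<noteq> {x, y})\<^sup>*\<^sup>* y z" using assms(1) by (simp add: beyond_def)
  then show ?thesis
  proof (induction rule: rtranclp_induct)
    case (step u v)
    then have "u \<in> beyond (x, y)" by (simp add: beyond_def)
    with step beyond_step show ?case by (intro assms(3)[of u v]) auto
  qed (rule assms(2))
qed

text \<open>Every edge is a bridge. This is the only use of acyclicity for the structure of the cuts.\<close>

lemma fst_not_in_beyond [simp]:
  assumes "adj G x y"
  shows "x \<notin> beyond (x, y)"
proof
  let ?r = "\<lambda>u v. adj G u v \<and> {u, v} \<noteq> {x, y}"
  assume "x \<in> beyond (x, y)"
  then have "?r\<^sup>*\<^sup>* y x" by (simp add: beyond_def)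
  from rtranclp_imp_distinct_path[OF this] obtain p
    where p: "p \<noteq> []" "hd p = y" "last p = x" "distinct p" "successively ?r p" by blast
  have "3 \<le> length p"
  proof -
    obtain q where q: "p = y # q" using p by (cases p) auto
    then obtain z q' where q': "q = z # q'" using p adj_neq[OF assms] by (cases q) auto
    with q p have "q' \<noteq> []" by (auto simp: insert_commute)
    with q q' show ?thesis by (cases q') auto
  qed
  moreover have "successively (adj G) p"
    using p(5) by (rule successively_mono) simp
  ultimately have "cycle G p" using p assms by (simp add: cycle_def)
  then show False using tree by (simp add: tree_def)
qed

lemma crossing:
  assumes "adj G x y" "u \<in> beyond (x, y)" "v \<notin> beyond (x, y)" "adj G u v"
  shows "u = y \<and> v = x"
proof -
  have "{u, v} = {x, y}" using assms beyond_step by blast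
  then show ?thesis using assms(1,2) assms(3) by (auto simp: doubleton_eq_iff)
qed

text \<open>An edge is crossed only by itself. All changes of root and all moves of a vertex along an edge
reduce to this.\<close>

lemma same_side_adj:
  assumes "e \<in> darts" "adj G u v" "e \<noteq> (u, v)" "e \<noteq> (v, u)"
  shows "u \<in> beyond e \<longleftrightarrow> v \<in> beyond e"
proof -
  obtain x y where "e = (x, y)" by (cases e)
  with assms crossing[of x y u v] crossing[of x y v u] adj_sym[of u v] show ?thesis by auto
qed

lemma only_separator:
  assumes "e \<in> darts" "adj G s u" "s \<notin> beyond e" "u \<in> beyond e"
  shows "e = (s, u)"
proof (rule ccontr)
  assume "e \<noteq> (s, u)"
  moreover have "e \<noteq> (u, s)" using assms(3) by auto
  ultimately show False using same_side_adj[OF assms(1,2)] assms(3,4) by blast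
qed

lemma beyond_subset: "e \<in> darts \<Longrightarrow> beyond e \<subseteq> verts G"
proof
  fix z assume "e \<in> darts" "z \<in> beyond e"
  obtain x y where e: "e = (x, y)" by (cases e)
  from \<open>z \<in> beyond e\<close> show "z \<in> verts G"
    unfolding e
    by (induction rule: beyond_induct) (use \<open>e \<in> darts\<close> e adj_in_verts in auto)
qed

lemma finite_beyond [simp]: "e \<in> darts \<Longrightarrow> finite (beyond e)"
  using beyond_subset finite_subset finite_verts by blast

lemma beyond_flip:
  assumes "adj G x y"
  shows "beyond (y, x) = verts G - beyond (x, y)"
proof (intro equalityI subsetI)
  fix z assume z: "z \<in> beyond (y, x)"
  then have "z \<notin> beyond (x, y)"
  proof (induction rule: beyond_induct)
    case head
    show ?case using assms by simp
  next
    case (step u v)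
    with crossing[OF assms, of v u] adj_sym show ?case by (auto simp: insert_commute)
  qed
  moreover have "z \<in> verts G" using z beyond_subset[of "(y, x)"] assms adj_sym by auto
  ultimately show "z \<in> verts G - beyond (x, y)" by simp
next
  fix z assume z: "z \<in> verts G - beyond (x, y)"
  then have "(adj G)\<^sup>*\<^sup>* y z" using assms adj_in_verts by (intro connected) auto
  then have "z \<in> beyond (x, y) \<or> z \<in> beyond (y, x)"
  proof (induction rule: rtranclp_induct)
    case (step u v)
    show ?case
    proof (cases "{u, v} = {x, y}")
      case True
      then have "v = x \<or> v = y" by auto
      then show ?thesis by auto
    next
      case False
      with step beyond_step[of u x y v] beyond_step[of u y x v] show ?thesis
        by (auto simp: insert_commute)
    qed
  qed simp
  with z show "z \<in> beyond (y, x)" by simp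
qed

lemma beyond_inject:
  assumes "e \<in> darts" "e' \<in> darts" "beyond e = beyond e'"
  shows "e = e'"
proof -
  obtain x y x' y' where e: "e = (x, y)" "e' = (x', y')" by (cases e; cases e')
  have "y' \<in> beyond (x, y)" "x' \<notin> beyond (x, y)" using assms e by auto
  with crossing[of x y y' x'] assms e adj_sym show ?thesis by auto
qed

lemma beyond_disjoint:
  assumes "adj G y w" "adj G y w'" "w \<noteq> w'"
  shows "beyond (y, w) \<inter> beyond (y, w') = {}"
proof -
  have w: "w \<notin> beyond (y, w')"
    using crossing[OF assms(2), of w y] assms adj_sym by auto
  have "z \<notin> beyond (y, w')" if "z \<in> beyond (y, w)" for z
    using that
  proof (induction rule: beyond_induct)
    case (step u v)
    show ?case
    proof
      assume "v \<in> beyond (y, w')"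
      with step crossing[OF assms(2), of v u] adj_sym have "u = y" by auto
      with step assms show False by simp
    qed
  qed (rule w)
  then show ?thesis by auto
qed

lemma beyond_cover:
  assumes "y \<in> verts G" "v \<in> verts G" "v \<noteq> y"
  shows "\<exists>w\<in>neighbors G y. v \<in> beyond (y, w)"
proof -
  have "(adj G)\<^sup>*\<^sup>* y v" using assms by (intro connected)
  then have "v = y \<or> (\<exists>w\<in>neighbors G y. v \<in> beyond (y, w))"
  proof (induction rule: rtranclp_induct)
    case (step u v)
    show ?case
    proof (cases "u = y")
      case True
      with step show ?thesis by (auto simp: neighbors_def)
    next
      case False
      with step obtain w where w: "adj G y w" "u \<in> beyond (y, w)" by (auto simp: neighbors_def)
      with crossing[of y w u v] step show ?thesis by (auto simp: neighbors_def)
    qed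
  qed simp
  with assms show ?thesis by simp
qed

lemma verts_decomp:
  assumes "y \<in> verts G"
  shows "verts G = insert y (\<Union>w\<in>neighbors G y. beyond (y, w))"
  using beyond_cover[OF assms] beyond_subset assms by (fastforce simp: neighbors_def)

lemma beyond_decomp:
  assumes "adj G x y"
  shows "beyond (x, y) = insert y (\<Union>w\<in>neighbors G y - {x}. beyond (y, w))"
proof -
  have yx: "adj G y x" using assms adj_sym by simp
  have eq: "beyond (x, y) = verts G - beyond (y, x)" by (rule beyond_flip[OF yx])
  have "v \<in> insert y (\<Union>w\<in>neighbors G y - {x}. beyond (y, w))" if "v \<in> beyond (x, y)" for v
    using that beyond_cover[of y v] adj_in_verts[OF assms] unfolding eq by auto
  moreover have "beyond (y, w) \<subseteq> beyond (x, y)" if "w \<in> neighbors G y - {x}" for w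
    using that beyond_disjoint[OF yx, of w] beyond_subset[of "(y, w)"]
    unfolding eq by (auto simp: neighbors_def)
  ultimately show ?thesis by auto
qed

text \<open>The subtrees hanging at \<open>y\<close> are disjoint and do not contain \<open>y\<close>.\<close>

lemma card_beyond_union:
  assumes "W \<subseteq> neighbors G y"
  shows "card (insert y (\<Union>w\<in>W. beyond (y, w))) = 1 + (\<Sum>w\<in>W. card (beyond (y, w)))"
    and "(\<Sum>z\<in>insert y (\<Union>w\<in>W. beyond (y, w)). F z)
           = F y + (\<Sum>w\<in>W. \<Sum>z\<in>beyond (y, w). (F z :: int))"
proof -
  have fin: "finite W" using assms finite_neighbors by (rule finite_subset)
  have adj: "adj G y w" if "w \<in> W" for w using that assms by (auto simp: neighbors_def)
  have y: "y \<notin> (\<Union>w\<in>W. beyond (y, w))" using adj by auto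
  have fu: "finite (\<Union>w\<in>W. beyond (y, w))" using fin adj by auto
  show "card (insert y (\<Union>w\<in>W. beyond (y, w))) = 1 + (\<Sum>w\<in>W. card (beyond (y, w)))"
    using fin adj beyond_disjoint y fu by (simp add: card_UN_disjoint)
  show "(\<Sum>z\<in>insert y (\<Union>w\<in>W. beyond (y, w)). F z)
           = F y + (\<Sum>w\<in>W. \<Sum>z\<in>beyond (y, w). F z)"
    using fin adj beyond_disjoint y fu by (simp add: sum.UNION_disjoint)
qed

text \<open>The sum of the degrees over \<open>beyond e\<close>, see \<open>sum_deg_beyond\<close>: a tree on \<open>k\<close> vertices has \<open>k - 1\<close>
edges, and the deleted edge contributes one more endpoint.\<close>

definition weight :: "'a \<times> 'a \<Rightarrow> int" where
  "weight e = 2 * int (card (beyond e)) - 1"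

lemma card_beyond_pos: "e \<in> darts \<Longrightarrow> 0 < card (beyond e)"
  using snd_in_beyond[of "snd e" "fst e"] by (auto simp: card_gt_0_iff simp del: snd_in_beyond)

lemma weight_pos: "e \<in> darts \<Longrightarrow> 1 \<le> weight e"
  using card_beyond_pos[of e] by (simp add: weight_def)

lemma sum_deg_beyond:
  assumes "adj G x y"
  shows "(\<Sum>z\<in>beyond (x, y). int (deg G z)) = weight (x, y)"
  using assms
proof (induction "card (beyond (x, y))" arbitrary: x y rule: less_induct)
  case less
  let ?W = "neighbors G y - {x}"
  have "x \<in> neighbors G y" using less.prems adj_sym by (simp add: neighbors_def)
  then have card_W: "int (card ?W) = int (deg G y) - 1"
    using card_gt_0_iff[of "neighbors G y"] by (auto simp: deg_def of_nat_diff)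
  have IH: "(\<Sum>z\<in>beyond (y, w). int (deg G z)) = weight (y, w)" if "w \<in> ?W" for w
  proof (rule less.hyps)
    show adj: "adj G y w" using that by (simp add: neighbors_def)
    have "beyond (y, w) \<subset> beyond (x, y)"
    proof
      show "beyond (y, w) \<subseteq> beyond (x, y)" using beyond_decomp[OF less.prems] that by auto
      show "beyond (y, w) \<noteq> beyond (x, y)"
        using fst_not_in_beyond[OF adj] snd_in_beyond[of y x] by metis
    qed
    then show "card (beyond (y, w)) < card (beyond (x, y))"
      using less.prems by (intro psubset_card_mono) auto
  qed
  have "(\<Sum>z\<in>beyond (x, y). int (deg G z)) = int (deg G y) + (\<Sum>w\<in>?W. weight (y, w))"
    using IH unfolding beyond_decomp[OF less.prems] by (subst card_beyond_union(2)) auto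
  also have "(\<Sum>w\<in>?W. weight (y, w)) = 2 * (\<Sum>w\<in>?W. int (card (beyond (y, w)))) - int (card ?W)"
    by (simp add: weight_def sum_subtractf sum_distrib_left)
  also have "(\<Sum>w\<in>?W. int (card (beyond (y, w)))) = int (card (beyond (x, y))) - 1"
    unfolding beyond_decomp[OF less.prems] by (subst card_beyond_union(1)) auto
  finally show ?case using card_W by (simp add: weight_def)
qed

lemma sum_weight_neighbors:
  assumes "y \<in> verts G"
  shows "(\<Sum>w\<in>neighbors G y. weight (y, w)) = 2 * (int (card (verts G)) - 1) - int (deg G y)"
proof -
  have "int (card (verts G)) - 1 = (\<Sum>w\<in>neighbors G y. int (card (beyond (y, w))))"
    by (subst verts_decomp[OF assms], subst card_beyond_union(1)) auto
  then show ?thesis by (simp add: weight_def sum_subtractf sum_distrib_left deg_def)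
qed

lemma sum_weight_children:
  assumes "adj G x y"
  shows "(\<Sum>w\<in>neighbors G y - {x}. weight (y, w)) = weight (x, y) - int (deg G y)"
proof -
  have "weight (x, y) = int (deg G y) + (\<Sum>w\<in>neighbors G y - {x}. \<Sum>z\<in>beyond (y, w). int (deg G z))"
    unfolding sum_deg_beyond[OF assms, symmetric] beyond_decomp[OF assms]
    by (subst card_beyond_union(2)) auto
  then show ?thesis using sum_deg_beyond by (simp add: neighbors_def)
qed

lemma sum_deg: "(\<Sum>z\<in>verts G. deg G z) = 2 * (card (verts G) - 1)"
proof -
  obtain y where y: "y \<in> verts G" using nontrivial by fastforce
  have "(\<Sum>z\<in>verts G. int (deg G z))
      = int (deg G y) + (\<Sum>w\<in>neighbors G y. \<Sum>z\<in>beyond (y, w). int (deg G z))"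
    by (subst verts_decomp[OF y], subst card_beyond_union(2)) auto
  also have "\<dots> = 2 * (int (card (verts G)) - 1)"
    using sum_deg_beyond sum_weight_neighbors[OF y] by (simp add: neighbors_def)
  finally have "int (\<Sum>z\<in>verts G. deg G z) = int (2 * (card (verts G) - 1))"
    using nontrivial by simp
  then show ?thesis by linarith
qed

lemma card_edges: "card (edges G) = card (verts G) - 1"
  using handshake sum_deg by simp

abbreviation m :: int where "m \<equiv> int (card (verts G)) - 1"

lemma card_beyond_flip:
  assumes "adj G x y"
  shows "int (card (beyond (y, x))) = int (card (verts G)) - int (card (beyond (x, y)))"
proof -
  have "beyond (x, y) \<subseteq> verts G" using beyond_subset assms by simp
  then show ?thesis unfolding beyond_flip[OF assms]
    by (simp add: card_Diff_subset finite_subset card_mono of_nat_diff)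
qed

lemma weight_flip:
  assumes "adj G x y"
  shows "weight (y, x) = 2 * m - weight (x, y)"
  using card_beyond_flip[OF assms] by (simp add: weight_def)

section \<open>Hitting times and access times in a tree\<close>

text \<open>One direction is selected for each edge: away from \<open>s\<close>.\<close>

definition outward :: "'a \<Rightarrow> ('a \<times> 'a) set" where
  "outward s = {e \<in> darts. s \<notin> beyond e}"

definition between :: "'a \<Rightarrow> 'a \<Rightarrow> ('a \<times> 'a) set" where
  "between s v = {e \<in> darts. s \<notin> beyond e \<and> v \<in> beyond e}"

lemma finite_outward [simp]: "finite (outward s)" and finite_between [simp]: "finite (between s v)"
  by (simp_all add: outward_def between_def)

lemma between_subset_outward: "between s v \<subseteq> outward s"
  by (auto simp: outward_def between_def)

lemma between_self [simp]: "between s s = {}"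
  by (auto simp: between_def)

text \<open>The expected time that the walk started at \<open>v\<close> takes to reach \<open>s\<close>: crossing an edge \<open>e\<close> towards \<open>s\<close>
takes \<open>weight e\<close> steps on average. Only the resulting Poisson equation \<open>sum_hitting_neighbors\<close> is
needed.\<close>

definition hitting :: "'a \<Rightarrow> 'a \<Rightarrow> int" where
  "hitting s v = (\<Sum>e\<in>between s v. weight e)"

text \<open>By \<open>sum_deg_hitting\<close> this is \<open>2 m\<close> times the stationary mean of \<open>hitting s\<close>.\<close>

definition spread :: "'a \<Rightarrow> int" where
  "spread s = (\<Sum>e\<in>outward s. (weight e)\<^sup>2)"

lemma between_step:
  assumes s: "s \<in> verts G" and adj: "adj G v u" and away: "s \<notin> beyond (v, u)"
  shows "between s u = insert (v, u) (between s v)" "(v, u) \<notin> between s v"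
proof -
  have behind: "s \<in> beyond (u, v)" using assms beyond_flip by auto
  show "between s u = insert (v, u) (between s v)"
  proof (rule set_eqI)
    fix e
    consider "e = (v, u)" | "e = (u, v)" "e \<noteq> (v, u)" | "e \<noteq> (u, v)" "e \<noteq> (v, u)" by blast
    then show "e \<in> between s u \<longleftrightarrow> e \<in> insert (v, u) (between s v)"
    proof cases
      case 1
      then show ?thesis using adj away by (simp add: between_def)
    next
      case 2
      then show ?thesis using behind by (simp add: between_def)
    next
      case 3
      then show ?thesis using same_side_adj[of e v u] adj by (auto simp: between_def)
    qed
  qed
  show "(v, u) \<notin> between s v" using adj by (simp add: between_def)
qed

lemma hitting_step:
  assumes "s \<in> verts G" "adj G v u" "s \<notin> beyond (v, u)"
  shows "hitting s u = hitting s v + weight (v, u)"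
  unfolding hitting_def between_step(1)[OF assms] using between_step(2)[OF assms] by simp

lemma hitting_self [simp]: "hitting s s = 0"
  by (simp add: hitting_def)

text \<open>From \<open>v\<close> the function grows by \<open>weight (v, u)\<close> towards each child \<open>u\<close> and drops by \<open>weight (x, v)\<close>
towards the parent \<open>x\<close>; by \<open>sum_weight_children\<close> the balance of these is the degree of \<open>v\<close>.\<close>

lemma sum_hitting_neighbors:
  assumes s: "s \<in> verts G" and v: "v \<in> verts G"
  shows "(\<Sum>u\<in>neighbors G v. hitting s u)
       = int (deg G v) * hitting s v - int (deg G v) + (if v = s then 2 * m else 0)"
proof (cases "v = s")
  case True
  have "hitting s u = weight (s, u)" if "u \<in> neighbors G s" for u
    using that hitting_step[OF s, of s u] by (simp add: neighbors_def)
  then show ?thesis using True sum_weight_neighbors[OF s] by simp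
next
  case False
  then obtain x where x: "x \<in> neighbors G v" "s \<in> beyond (v, x)"
    using beyond_cover[OF v s] by auto
  have vx: "adj G v x" and xv: "adj G x v" using x adj_sym by (auto simp: neighbors_def)
  have up: "hitting s v = hitting s x + weight (x, v)"
    using x beyond_flip[OF vx] by (intro hitting_step s xv) auto
  have down: "hitting s u = hitting s v + weight (v, u)" if u: "u \<in> neighbors G v - {x}" for u
    using u x(2) beyond_disjoint[OF vx, of u] by (intro hitting_step s) (auto simp: neighbors_def)
  have "int (card (neighbors G v - {x})) = int (deg G v) - 1"
    using x(1) deg_pos[OF v] unfolding deg_def by (subst card_Diff_singleton) auto
  then have "(\<Sum>u\<in>neighbors G v - {x}. hitting s v) = (int (deg G v) - 1) * hitting s v"
    by (simp only: sum_constant)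
  moreover have "(\<Sum>u\<in>neighbors G v. hitting s u)
      = hitting s x + (\<Sum>u\<in>neighbors G v - {x}. hitting s v + weight (v, u))"
    using down by (subst sum.remove[OF _ x(1)]) auto
  ultimately have "(\<Sum>u\<in>neighbors G v. hitting s u)
      = hitting s x + ((int (deg G v) - 1) * hitting s v + (weight (x, v) - int (deg G v)))"
    by (simp only: sum.distrib sum_weight_children[OF xv])
  also have "\<dots> = int (deg G v) * hitting s v - int (deg G v)"
    using up by (simp add: left_diff_distrib)
  finally show ?thesis using False by simp
qed

text \<open>Exchange the summations: the edge \<open>e\<close> is counted with its weight for every \<open>v\<close> beyond it, and the
degrees of these \<open>v\<close> add up to \<open>weight e\<close> once more.\<close>

lemma sum_deg_hitting: "(\<Sum>v\<in>verts G. int (deg G v) * hitting s v) = spread s"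
proof -
  have "(\<Sum>v\<in>verts G. int (deg G v) * hitting s v)
      = (\<Sum>v\<in>verts G. \<Sum>e\<in>{e\<in>outward s. v \<in> beyond e}. int (deg G v) * weight e)"
    unfolding hitting_def sum_distrib_left
    by (intro sum.cong refl) (auto simp: between_def outward_def)
  also have "\<dots> = (\<Sum>e\<in>outward s. \<Sum>v\<in>{v\<in>verts G. v \<in> beyond e}. int (deg G v) * weight e)"
    by (rule sum.swap_restrict) auto
  also have "\<dots> = (\<Sum>e\<in>outward s. (weight e)\<^sup>2)"
  proof (intro sum.cong refl)
    fix e assume "e \<in> outward s"
    then have e: "e \<in> darts" by (simp add: outward_def)
    obtain x y where xy: "e = (x, y)" by (cases e)
    have "{v\<in>verts G. v \<in> beyond e} = beyond e" using beyond_subset[OF e] by auto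
    then show "(\<Sum>v\<in>{v\<in>verts G. v \<in> beyond e}. int (deg G v) * weight e) = (weight e)\<^sup>2"
      using sum_deg_beyond[of x y] e xy by (simp add: power2_eq_square flip: sum_distrib_right)
  qed
  finally show ?thesis by (simp add: spread_def)
qed

text \<open>The potential is \<open>Y = M - hitting s\<close>; it is non-negative exactly if \<open>M\<close> bounds \<open>hitting s\<close>.\<close>

lemma access_time_le_hitting:
  assumes s: "s \<in> verts G" and M: "\<And>v. v \<in> verts G \<Longrightarrow> hitting s v \<le> M"
  shows "access_time G s \<le> ennreal (real_of_int M - real_of_int (spread s) / (2 * real_of_int m))"
proof -
  define Y where "Y v = real_of_int (M - hitting s v)" for v
  have edges: "real (card (edges G)) = real_of_int m"
    using card_edges nontrivial by simp
  have mpos: "0 < real_of_int m" using nontrivial by simp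
  have "access_time G s \<le> ennreal (\<Sum>v\<in>verts G. stationary G v * Y v)"
  proof (rule access_time_le_potential[OF s])
    fix v assume v: "v \<in> verts G"
    show "0 \<le> Y v" using M[OF v] by (simp add: Y_def)
    have "(\<Sum>u\<in>neighbors G v. Y u) = real_of_int (int (deg G v) * M - (\<Sum>u\<in>neighbors G v. hitting s u))"
      by (simp add: Y_def sum_subtractf deg_def)
    also have "\<dots> = real (deg G v) * (1 + Y v) - (if v = s then 2 * real_of_int m else 0)"
      unfolding sum_hitting_neighbors[OF s v] by (simp add: Y_def algebra_simps)
    finally show "(\<Sum>u\<in>neighbors G v. Y u) + (if v = s then 2 * real (card (edges G)) else 0)
        = real (deg G v) * (1 + Y v)"
      unfolding edges by simp
  qed
  also have "(\<Sum>v\<in>verts G. stationary G v * Y v)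
      = (\<Sum>v\<in>verts G. stationary G v) * real_of_int M
        - real_of_int (\<Sum>v\<in>verts G. int (deg G v) * hitting s v) / (2 * real_of_int m)"
    by (simp add: Y_def stationary_def edges sum_subtractf sum_distrib_right
        right_diff_distrib sum_divide_distrib)
  also have "\<dots> = real_of_int M - real_of_int (spread s) / (2 * real_of_int m)"
    using s sum_stationary by (subst sum_deg_hitting) auto
  finally show ?thesis .
qed

text \<open>Moving the root across one edge reverses the direction of that edge and of no other.\<close>

lemma reroot_outward:
  assumes "s \<in> verts G" "adj G s u"
  shows "outward u = insert (u, s) (outward s - {(s, u)})"
proof (rule set_eqI)
  fix e
  have su: "s \<in> beyond (u, s)" "u \<in> beyond (s, u)" "adj G u s" using assms adj_sym by auto
  consider "e = (s, u)" | "e = (u, s)" | "e \<noteq> (s, u)" "e \<noteq> (u, s)" by blast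
  then show "e \<in> outward u \<longleftrightarrow> e \<in> insert (u, s) (outward s - {(s, u)})"
  proof cases
    case 1
    then show ?thesis using su adj_neq[OF assms(2)] by (auto simp: outward_def)
  next
    case 2
    then show ?thesis using su by (auto simp: outward_def)
  next
    case 3
    then show ?thesis using same_side_adj[of e s u] assms(2) by (auto simp: outward_def)
  qed
qed

lemma reroot_spread:
  assumes "s \<in> verts G" "adj G s u"
  shows "spread u = spread s + 4 * m * (m - weight (s, u))"
proof -
  have "(s, u) \<in> outward s" "(u, s) \<notin> outward s"
    using assms adj_sym by (auto simp: outward_def)
  then have "spread u = (weight (u, s))\<^sup>2 + (spread s - (weight (s, u))\<^sup>2)"
    unfolding spread_def reroot_outward[OF assms] by (subst sum.insert) (auto simp: sum_diff1)
  then show ?thesis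
    unfolding weight_flip[OF assms(2)] by (simp add: power2_eq_square algebra_simps)
qed

lemma reroot_between:
  assumes s: "s \<in> verts G" and adj: "adj G s u" and v: "v \<in> verts G"
  shows "between u v = (if v \<in> beyond (s, u) then between s v - {(s, u)}
                        else insert (u, s) (between s v))"
proof (rule set_eqI)
  fix e
  have flip: "v \<in> beyond (u, s) \<longleftrightarrow> v \<notin> beyond (s, u)" using beyond_flip[OF adj] v by simp
  have us: "adj G u s" "(u, s) \<noteq> (s, u)" using adj adj_sym adj_neq by auto
  consider "e = (s, u)" | "e = (u, s)" | "e \<noteq> (s, u)" "e \<noteq> (u, s)" by blast
  then show "e \<in> between u v \<longleftrightarrow> e \<in> (if v \<in> beyond (s, u) then between s v - {(s, u)}
                        else insert (u, s) (between s v))"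
  proof cases
    case 1
    then show ?thesis using us by (auto simp: between_def)
  next
    case 2
    then show ?thesis using us flip by (auto simp: between_def)
  next
    case 3
    then show ?thesis using same_side_adj[of e s u] adj by (auto simp: between_def)
  qed
qed

lemma reroot_hitting:
  assumes "s \<in> verts G" "adj G s u" "v \<in> verts G"
  shows "hitting u v = (if v \<in> beyond (s, u) then hitting s v - weight (s, u)
                        else hitting s v + 2 * m - weight (s, u))"
proof -
  have "(s, u) \<in> between s v \<longleftrightarrow> v \<in> beyond (s, u)" "(u, s) \<notin> between s v"
    using assms adj_sym by (auto simp: between_def)
  then show ?thesis
    unfolding hitting_def reroot_between[OF assms] using weight_flip[OF assms(2)]
    by (auto simp: sum_diff1)
qed

section \<open>Edges between two vertices form a chain\<close>

text \<open>\<open>beyond (x, y)\<close> is connected within itself, so an edge without both endpoints inside it cannot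
separate two of its vertices.\<close>

lemma beyond_one_sided:
  assumes "adj G x y" "adj G x' y'" "x' \<notin> beyond (x, y) \<or> y' \<notin> beyond (x, y)"
    and "z \<in> beyond (x, y)"
  shows "z \<in> beyond (x', y') \<longleftrightarrow> y \<in> beyond (x', y')"
  using assms(4)
proof (induction rule: beyond_induct)
  case (step u v)
  with assms(2,3) same_side_adj[of "(x', y')" u v] show ?case by auto
qed simp

text \<open>If \<open>e'\<close> is not inside \<open>beyond e\<close>, then \<open>beyond e\<close> lies on one side of \<open>e'\<close>, and \<open>v\<close> decides which.
Otherwise the complement of \<open>beyond e\<close> lies on one side of \<open>e'\<close>, and \<open>s\<close> decides.\<close>

lemma between_chain:
  assumes s: "s \<in> verts G" and "e \<in> between s v" "e' \<in> between s v"
  shows "beyond e \<subseteq> beyond e' \<or> beyond e' \<subseteq> beyond e"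
proof -
  obtain x y x' y' where e: "e = (x, y)" "e' = (x', y')" by (cases e; cases e')
  have adj: "adj G x y" "adj G x' y'" "adj G y x" and v: "v \<in> beyond e" "v \<in> beyond e'"
    and s': "s \<notin> beyond e" "s \<notin> beyond e'"
    using assms e adj_sym by (auto simp: between_def)
  show ?thesis
  proof (cases "x' \<notin> beyond (x, y) \<or> y' \<notin> beyond (x, y)")
    case True
    with beyond_one_sided[OF adj(1,2)] v have "beyond e \<subseteq> beyond e'" unfolding e by blast
    then show ?thesis ..
  next
    case False
    then have "y' \<notin> beyond (y, x)" using beyond_flip[OF adj(1)] by simp
    then have same: "z \<in> beyond (x', y') \<longleftrightarrow> x \<in> beyond (x', y')" if "z \<in> beyond (y, x)" for z
      using beyond_one_sided[OF adj(3,2) _ that] by simp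
    have "s \<in> beyond (y, x)" using s s' beyond_flip[OF adj(1)] e by simp
    with same s' have "z \<notin> beyond e'" if "z \<in> beyond (y, x)" for z using that unfolding e by blast
    moreover have "beyond e' \<subseteq> verts G" using beyond_subset adj e by simp
    ultimately have "beyond e' \<subseteq> beyond e" using beyond_flip[OF adj(1)] e by auto
    then show ?thesis ..
  qed
qed

lemma inj_on_card_beyond:
  assumes "s \<in> verts G"
  shows "inj_on (\<lambda>e. card (beyond e)) (between s v)"
proof (rule inj_onI)
  fix e e' assume e: "e \<in> between s v" "e' \<in> between s v" "card (beyond e) = card (beyond e')"
  then have d: "e \<in> darts" "e' \<in> darts" by (auto simp: between_def)
  from between_chain[OF assms e(1,2)] have "beyond e = beyond e'"
    using card_subset_eq[OF finite_beyond[OF d(1)], of "beyond e'"]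
      card_subset_eq[OF finite_beyond[OF d(2)], of "beyond e"] e(3) by auto
  with beyond_inject d show "e = e'" by blast
qed

text \<open>Each vertex other than \<open>s\<close> is the head of exactly one edge directed away from \<open>s\<close>.\<close>

lemma card_outward:
  assumes s: "s \<in> verts G"
  shows "card (outward s) = card (verts G) - 1"
proof -
  have "\<exists>w. adj G w v \<and> s \<notin> beyond (w, v)" if v: "v \<in> verts G" "v \<noteq> s" for v
  proof -
    obtain w where "w \<in> neighbors G v" "s \<in> beyond (v, w)"
      using beyond_cover[OF v(1) s] v by auto
    then show ?thesis using beyond_flip[of v w] adj_sym by (auto simp: neighbors_def)
  qed
  then have img: "snd ` outward s = verts G - {s}"
    using adj_in_verts by (force simp: outward_def darts_def image_iff)
  have "inj_on snd (outward s)"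
  proof (rule inj_onI)
    fix e e' assume "e \<in> outward s" "e' \<in> outward s" "snd e = snd e'"
    then obtain w w' v where e: "e = (w, v)" "e' = (w', v)"
      and a: "adj G w v" "adj G w' v" "s \<notin> beyond (w, v)" "s \<notin> beyond (w', v)"
      by (cases e; cases e') (auto simp: outward_def)
    then have "s \<in> beyond (v, w) \<inter> beyond (v, w')" using s beyond_flip by auto
    with beyond_disjoint[of v w w'] a adj_sym show "e = e'" unfolding e by auto
  qed
  then have "card (outward s) = card (verts G - {s})"
    using img card_image by metis
  then show ?thesis using s by simp
qed

end

section \<open>Sums of distinct odd numbers\<close>

text \<open>The contribution \<open>m w - w\<^sup>2\<close> of an edge of weight \<open>w = 2 k - 1\<close> to the separable form of the bound,
see \<open>excess_eq\<close>. It is positive for \<open>w < m\<close> and negative for \<open>w > m\<close>.\<close>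

definition profit :: "int \<Rightarrow> nat \<Rightarrow> int" where
  "profit m k = (2 * int k - 1) * (m - (2 * int k - 1))"

text \<open>For \<open>t = m div 2\<close> the set \<open>{1..t}\<close> consists of the \<open>k\<close> with positive profit (for odd \<open>m\<close>, the profit
of \<open>t + 1\<close> is \<open>0\<close>). Any other \<open>K\<close> loses what it misses there and what it adds outside.\<close>

lemma sum_profit_split:
  assumes "finite K"
  shows "(\<Sum>k\<in>K. profit m k)
       = (\<Sum>k\<in>{1..t}. profit m k) - (\<Sum>k\<in>{1..t} - K. profit m k) + (\<Sum>k\<in>K - {1..t}. profit m k)"
proof -
  have "(\<Sum>k\<in>K. profit m k) = (\<Sum>k\<in>K \<inter> {1..t}. profit m k) + (\<Sum>k\<in>K - {1..t}. profit m k)"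
    using assms by (rule sum.Int_Diff)
  moreover have "(\<Sum>k\<in>{1..t}. profit m k)
      = (\<Sum>k\<in>{1..t} \<inter> K. profit m k) + (\<Sum>k\<in>{1..t} - K. profit m k)"
    by (rule sum.Int_Diff) simp
  ultimately show ?thesis by (simp add: Int_commute)
qed

lemma sum_profit_outside:
  assumes "m \<le> 2 * int t + 1" "\<forall>k\<in>K. 1 \<le> k"
  shows "(\<Sum>k\<in>K - {1..t}. profit m k) \<le> 0"
  using assms by (intro sum_nonpos) (auto simp: profit_def mult_le_0_iff)

lemma sum_profit_inside:
  assumes "2 * int t \<le> m"
  shows "0 \<le> (\<Sum>k\<in>{1..t} - K. profit m k)"
  using assms by (intro sum_nonneg) (auto simp: profit_def)

lemma sum_profit_le:
  assumes "finite K" "\<forall>k\<in>K. 1 \<le> k" "2 * int t \<le> m" "m \<le> 2 * int t + 1"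
  shows "(\<Sum>k\<in>K. profit m k) \<le> (\<Sum>k\<in>{1..t}. profit m k)"
  using sum_profit_split[OF assms(1), of m t] sum_profit_outside[OF assms(4,2)]
    sum_profit_inside[OF assms(3), of K] by linarith

lemma sum_odds: "(\<Sum>k\<in>{1..t}. 2 * int k - 1) = (int t)\<^sup>2"
  by (induction t) (auto simp: power2_eq_square algebra_simps)

lemma sum_profit_closed: "3 * (\<Sum>k\<in>{1..t}. profit m k) = 3 * m * (int t)\<^sup>2 - int t * (4 * (int t)\<^sup>2 - 1)"
  by (induction t) (auto simp: profit_def power2_eq_square algebra_simps)

text \<open>If \<open>t\<close> itself is present, then every missing \<open>k\<close> is below \<open>t\<close>, so that the factor \<open>m - (2 k - 1)\<close> is at
least \<open>3\<close>. A chain of small total weight that contains \<open>t\<close> thus loses a lot.\<close>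

lemma missing_profit:
  assumes "finite K" "t \<in> K" "\<forall>k\<in>K. 1 \<le> k"
  shows "3 * ((int t)\<^sup>2 - (\<Sum>k\<in>K. 2 * int k - 1)) \<le> (\<Sum>k\<in>{1..t} - K. profit (2 * int t) k)"
proof -
  have "(int t)\<^sup>2 = (\<Sum>k\<in>{1..t} \<inter> K. 2 * int k - 1) + (\<Sum>k\<in>{1..t} - K. 2 * int k - 1)"
    unfolding sum_odds[symmetric] by (rule sum.Int_Diff) simp
  also have "(\<Sum>k\<in>{1..t} \<inter> K. 2 * int k - 1) \<le> (\<Sum>k\<in>K. 2 * int k - 1)"
  proof (rule sum_mono2)
    fix k assume "k \<in> K - {1..t} \<inter> K"
    with assms(3) have "1 \<le> k" by blast
    then show "0 \<le> 2 * int k - 1" by simp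
  qed (use assms in auto)
  finally have "3 * ((int t)\<^sup>2 - (\<Sum>k\<in>K. 2 * int k - 1)) \<le> (\<Sum>k\<in>{1..t} - K. 3 * (2 * int k - 1))"
    unfolding sum_distrib_left[symmetric] by simp
  also have "\<dots> \<le> (\<Sum>k\<in>{1..t} - K. profit (2 * int t) k)"
  proof (rule sum_mono)
    fix k assume k: "k \<in> {1..t} - K"
    then have "k \<noteq> t" using assms by auto
    with k have "(2 * int k - 1) * 3 \<le> (2 * int k - 1) * (2 * int t - (2 * int k - 1))"
      by (intro mult_left_mono) auto
    then show "3 * (2 * int k - 1) \<le> profit (2 * int t) k" by (simp add: profit_def)
  qed
  finally show ?thesis .
qed

lemma sum_odds_le:
  assumes "K \<subseteq> {1..t}"
  shows "(\<Sum>k\<in>K. 2 * int k - 1) \<le> (int t)\<^sup>2"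
  unfolding sum_odds[symmetric] using assms by (intro sum_mono2) auto

text \<open>Here \<open>k\<close> is the number of vertices beyond the first edge \<open>e\<^sub>0\<close>, the sets \<open>KA\<close> and \<open>KB\<close> are the numbers of
vertices beyond the edges of the rest of the path to \<open>v\<close> and of the path to \<open>v'\<close>, and \<open>r\<close> edges of total squared
weight \<open>q\<close> lie elsewhere. The square loses at least \<open>1\<close>, as \<open>m\<close> is even.
A set without \<open>t\<close> loses \<open>m - 1\<close>, the profit of \<open>t\<close>.

The number of vertices does not allow \<open>t\<close> in both sets. If \<open>t\<close> is in one of them, the other set is
contained in \<open>{1..t - 1}\<close> and is thus too light for the balance condition \<open>C \<le> B\<close> unless the first
set misses much (if it is \<open>KA\<close>) or the gap \<open>B - C\<close> is paid for (if it is \<open>KB\<close>); in both cases more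
than \<open>2 m\<close> is lost. If \<open>t\<close> is in neither set, then \<open>1 + 2 (m - 1)\<close> is lost already. The remaining \<open>1\<close> comes from
an edge elsewhere, because two subsets of \<open>{1..t - 1}\<close> do not have \<open>2 t - 1\<close> elements together, or
else from an element above \<open>t\<close>, which costs at least \<open>2\<close>.\<close>

lemma profit_deficit_even:
  fixes KA KB :: "nat set" and t k r :: nat and q :: int
  defines "m \<equiv> 2 * int t"
  defines "C \<equiv> \<Sum>k\<in>KA. 2 * int k - 1" and "B \<equiv> \<Sum>k\<in>KB. 2 * int k - 1"
  defines "F \<equiv> m\<^sup>2 - (2 * int k - 1 - m)\<^sup>2 + (\<Sum>k\<in>KA. profit m k) + (\<Sum>k\<in>KB. profit m k)
      - m * (B - C) - q"
  assumes t: "2 \<le> t"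
    and KA: "finite KA" "\<forall>j\<in>KA. 1 \<le> j \<and> j < k"
    and KB: "finite KB" "\<forall>j\<in>KB. 1 \<le> j \<and> j + k \<le> 2 * t"
    and CB: "C \<le> B" and count: "card KA + card KB + r = 2 * t - 1" and q: "int r \<le> q"
  shows "F \<le> m\<^sup>2 + 2 * (\<Sum>k\<in>{1..t}. profit m k) - 2 * m"
    and "F = m\<^sup>2 + 2 * (\<Sum>k\<in>{1..t}. profit m k) - 2 * m
           \<Longrightarrow> KA = {1..t - 1} \<and> KB = {1..t - 1} \<and> q = 1"
proof -
  define S where "S = (\<Sum>k\<in>{1..t}. profit m k)"
  define inA where "inA = (\<Sum>k\<in>{1..t} - KA. profit m k)"
  define inB where "inB = (\<Sum>k\<in>{1..t} - KB. profit m k)"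
  define outA where "outA = (\<Sum>k\<in>KA - {1..t}. profit m k)"
  define outB where "outB = (\<Sum>k\<in>KB - {1..t}. profit m k)"
  have A: "(\<Sum>k\<in>KA. profit m k) = S - inA + outA"
    unfolding S_def inA_def outA_def by (rule sum_profit_split[OF KA(1)])
  have B: "(\<Sum>k\<in>KB. profit m k) = S - inB + outB"
    unfolding S_def inB_def outB_def by (rule sum_profit_split[OF KB(1)])
  have out: "outA \<le> 0" "outB \<le> 0"
    unfolding outA_def outB_def using KA KB
    by (intro sum_profit_outside; simp add: m_def)+
  have inn: "0 \<le> inA" "0 \<le> inB"
    unfolding inA_def inB_def by (intro sum_profit_inside; simp add: m_def)+
  have sq: "1 \<le> (2 * int k - 1 - m)\<^sup>2"
  proof -
    have "2 * int k - 1 - m \<noteq> 0" unfolding m_def by presburger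
    then have "0 < (2 * int k - 1 - m)\<^sup>2" by simp
    then show ?thesis by linarith
  qed
  have pt: "profit m t = m - 1" by (simp add: profit_def m_def)
  have pos: "0 < profit m j" if "j \<in> {1..t}" for j
    using that unfolding profit_def m_def by (intro mult_pos_pos) auto
  have neg: "profit m j < 0" if "1 \<le> j" "j \<notin> {1..t}" for j
    using that unfolding profit_def m_def by (intro mult_pos_neg) auto
  have miss: "m - 1 \<le> (\<Sum>k\<in>{1..t} - K. profit m k)" if "t \<notin> K" for K
    unfolding pt[symmetric] using that t pos by (intro member_le_sum) (auto intro: less_imp_le)
  have dm: "0 \<le> m * (B - C)" using CB by (simp add: m_def)
  have m4: "4 \<le> m" using t by (simp add: m_def)
  have q0: "0 \<le> q" using q by linarith
  have sqt: "(int t)\<^sup>2 - (int (t - 1))\<^sup>2 = m - 1"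
    using t by (simp add: m_def of_nat_diff power2_eq_square algebra_simps)
  define D where "D = (2 * int k - 1 - m)\<^sup>2"
  define E where "E = m * (B - C)"
  define m2 where "m2 = m\<^sup>2"
  have F: "F = m2 - D + (S - inA + outA) + (S - inB + outB) - E - q"
    unfolding F_def A B D_def E_def m2_def ..
  note sq = sq[folded D_def] and dm = dm[folded E_def]
  have "(F \<le> m\<^sup>2 + 2 * S - 2 * m) \<and>
    (F = m\<^sup>2 + 2 * S - 2 * m \<longrightarrow> KA = {1..t - 1} \<and> KB = {1..t - 1} \<and> q = 1)"
  proof -
    consider "t \<in> KA" | "t \<in> KB" | "t \<notin> KA" "t \<notin> KB" by blast
    then show ?thesis
    proof cases
      case 1
      then have k: "t < k" using KA by auto
      then have KB': "KB \<subseteq> {1..t - 1}" using KB by fastforce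
      then have "t \<notin> KB" using t by auto
      then have b: "m - 1 \<le> inB" unfolding inB_def by (rule miss)
      have "C \<le> (int (t - 1))\<^sup>2" using CB sum_odds_le[OF KB'] by (simp add: B_def)
      with sqt missing_profit[OF KA(1) 1] KA have a: "3 * (m - 1) \<le> inA"
        unfolding inA_def C_def m_def by fastforce
      then have "F < m\<^sup>2 + 2 * S - 2 * m"
        unfolding F m2_def[symmetric] using a b sq dm q0 out m4 by simp
      then show ?thesis by simp
    next
      case 2
      then have k: "k \<le> t" using KB by auto
      then have KA': "KA \<subseteq> {1..t - 1}" using KA by fastforce
      then have "t \<notin> KA" using t by auto
      then have a: "m - 1 \<le> inA" unfolding inA_def by (rule miss)
      have "C \<le> (int (t - 1))\<^sup>2" using sum_odds_le[OF KA'] by (simp add: C_def)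
      with sqt missing_profit[OF KB(1) 2] KB have b: "3 * (m - 1 - (B - C)) \<le> inB"
        unfolding inB_def B_def m_def by fastforce
      have "3 * (B - C) \<le> E" unfolding E_def using m4 CB by (intro mult_right_mono) auto
      then have "F < m\<^sup>2 + 2 * S - 2 * m"
        unfolding F m2_def[symmetric] using a b sq q0 out m4 by simp
      then show ?thesis by simp
    next
      case 3
      have a: "m - 1 \<le> inA" and b: "m - 1 \<le> inB"
        unfolding inA_def inB_def using 3 miss by auto
      show ?thesis
      proof (cases "KA \<subseteq> {1..t} \<and> KB \<subseteq> {1..t}")
        case True
        then have sub: "KA \<subseteq> {1..t - 1}" "KB \<subseteq> {1..t - 1}"
          using 3 by (auto simp: subset_iff le_less)
        then have "card KA \<le> t - 1" "card KB \<le> t - 1"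
          using card_mono[of "{1..t - 1}"] by fastforce+
        then have q1: "1 \<le> q" using count q t by linarith
        have le: "F \<le> m\<^sup>2 + 2 * S - 2 * m"
          unfolding F m2_def[symmetric] using a b sq dm q1 out by linarith
        moreover have "KA = {1..t - 1} \<and> KB = {1..t - 1} \<and> q = 1"
          if eq: "F = m\<^sup>2 + 2 * S - 2 * m"
        proof -
          have "inA = m - 1" "inB = m - 1" "q = 1"
            using eq[unfolded F m2_def[symmetric]] using a b sq dm q1 out by linarith+
          moreover have "{1..t - 1} \<subseteq> K"
            if K: "t \<notin> K" "(\<Sum>k\<in>{1..t} - K. profit m k) = m - 1" for K
          proof
            fix j assume j: "j \<in> {1..t - 1}"
            show "j \<in> K"
            proof (rule ccontr)
              assume "j \<notin> K"
              then have "(\<Sum>k\<in>{t, j}. profit m k) \<le> (\<Sum>k\<in>{1..t} - K. profit m k)"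
                using j K t pos by (intro sum_mono2) (auto intro: less_imp_le)
              moreover have "t \<noteq> j" "0 < profit m j" using j pos[of j] t by auto
              ultimately show False using K pt by simp
            qed
          qed
          ultimately show ?thesis using sub 3 unfolding inA_def inB_def by blast
        qed
        ultimately show ?thesis by blast
      next
        case False
        have loss: "(\<Sum>k\<in>K - {1..t}. profit m k) \<le> - 2"
          if K: "finite K" "\<forall>j\<in>K. 1 \<le> j" "\<not> K \<subseteq> {1..t}" for K
        proof -
          from K(3) obtain j where j: "j \<in> K - {1..t}" by blast
          have "- profit m j \<le> (\<Sum>k\<in>K - {1..t}. - profit m k)"
            using j K neg by (intro member_le_sum) (auto intro: less_imp_le)
          moreover have "profit m j \<le> - 2"
          proof -
            have "t < j" using j K by auto
            then have "(2 * int j - 1) * (m - (2 * int j - 1)) \<le> (2 * int j - 1) * (- 1)"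
              by (intro mult_left_mono) (auto simp: m_def)
            then show ?thesis using \<open>t < j\<close> t by (simp add: profit_def)
          qed
          ultimately show ?thesis unfolding sum_negf by linarith
        qed
        from False have "outA \<le> - 2 \<or> outB \<le> - 2"
          unfolding outA_def outB_def using loss KA KB by auto
        then have "F < m\<^sup>2 + 2 * S - 2 * m"
          unfolding F m2_def[symmetric] using a b sq dm q0 out by linarith
        then show ?thesis by simp
      qed
    qed
  qed
  then show "F \<le> m\<^sup>2 + 2 * (\<Sum>k\<in>{1..t}. profit m k) - 2 * m"
    and "F = m\<^sup>2 + 2 * (\<Sum>k\<in>{1..t}. profit m k) - 2 * m
           \<Longrightarrow> KA = {1..t - 1} \<and> KB = {1..t - 1} \<and> q = 1"
    unfolding S_def by auto
qed

context nontrivial_tree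
begin

section \<open>A balanced starting vertex\<close>

lemma weight_less: "e \<in> darts \<Longrightarrow> weight e < 2 * m"
proof -
  assume e: "e \<in> darts"
  obtain x y where xy: "e = (x, y)" by (cases e)
  then have "weight (y, x) \<ge> 1" using e adj_sym by (intro weight_pos) simp
  then show ?thesis using weight_flip[of x y] e xy by simp
qed

text \<open>Choose \<open>s\<close> minimising the bound of \<open>access_time_le_hitting\<close>, and compare with the neighbour \<open>u\<close> of \<open>s\<close>
towards the farthest vertex \<open>v\<close>. Were the vertex \<open>v'\<close> farthest from \<open>u\<close> still beyond the edge from \<open>s\<close> to
\<open>u\<close>, then the bound would be smaller at \<open>u\<close>. So \<open>v'\<close> lies in another direction, and minimality of \<open>s\<close>
becomes the last inequality.\<close>

lemma exists_balanced_root: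
  obtains s u v v' where "s \<in> verts G" "adj G s u" "v \<in> beyond (s, u)"
    "v' \<in> verts G" "v' \<notin> beyond (s, u)"
    "\<And>x. x \<in> verts G \<Longrightarrow> hitting s x \<le> hitting s v"
    "hitting s v \<le> weight (s, u) + hitting s v'"
proof -
  have V: "verts G \<noteq> {}" using nontrivial by auto
  define M where "M s = Max (hitting s ` verts G)" for s
  define F where "F s = 2 * m * M s - spread s" for s
  have M_ge: "hitting s x \<le> M s" if "x \<in> verts G" for s x
    unfolding M_def using that by (intro Max_ge) auto
  have M_att: "\<exists>x\<in>verts G. hitting s x = M s" for s
  proof -
    have "M s \<in> hitting s ` verts G" unfolding M_def using V by (intro Max_in) auto
    then show ?thesis by auto
  qed
  obtain s where s: "s \<in> verts G" and min: "\<And>x. x \<in> verts G \<Longrightarrow> F s \<le> F x"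
    using ex_min_if_finite[of "F ` verts G"] V by (fastforce simp: not_less)
  obtain v where v: "v \<in> verts G" "hitting s v = M s" using M_att by blast
  obtain w where w: "adj G s w" using no_isolated[OF s] by (auto simp: neighbors_def)
  have "0 < hitting s w"
    using hitting_step[OF s w] w weight_pos[of "(s, w)"] by simp
  also have "hitting s w \<le> hitting s v" using M_ge v adj_in_verts[OF w] by simp
  finally have "v \<noteq> s" by auto
  then obtain u where u: "adj G s u" "v \<in> beyond (s, u)"
    using beyond_cover[OF s v(1)] by (auto simp: neighbors_def)
  obtain v' where v': "v' \<in> verts G" "hitting u v' = M u" using M_att by blast
  have mpos: "0 < m" using nontrivial by simp
  have "F s \<le> F u" using u adj_in_verts by (intro min) auto
  then have "2 * m * (M s + 2 * (m - weight (s, u))) \<le> 2 * m * M u"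
    unfolding F_def reroot_spread[OF s u(1)] by (simp add: algebra_simps)
  then have Mu: "M s + 2 * (m - weight (s, u)) \<le> M u"
    using mpos by (subst (asm) mult_le_cancel_left_pos) auto
  have out: "v' \<notin> beyond (s, u)"
  proof
    assume "v' \<in> beyond (s, u)"
    then have "M u \<le> M s - weight (s, u)"
      using reroot_hitting[OF s u(1) v'(1)] v' M_ge[OF v'(1), of s] by simp
    with Mu weight_less[of "(s, u)"] u show False by simp
  qed
  then have "M u = hitting s v' + 2 * m - weight (s, u)"
    using reroot_hitting[OF s u(1) v'(1)] v' by simp
  with Mu v(2) have "hitting s v \<le> weight (s, u) + hitting s v'" by (simp add: algebra_simps)
  with s u v' v out M_ge show ?thesis by (intro that) auto
qed

end

text \<open>The outcome of \<open>exists_balanced_root\<close>. The edges are divided into the edge from \<open>s\<close> to \<open>u\<close>, the rest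
of the path to \<open>v\<close>, the path to \<open>v'\<close>, and the offshoots.\<close>

locale balanced_root = nontrivial_tree +
  fixes s u v v' :: 'a
  assumes s: "s \<in> verts G" and su: "adj G s u" and v: "v \<in> beyond (s, u)"
    and v': "v' \<in> verts G" "v' \<notin> beyond (s, u)"
    and farthest: "\<And>x. x \<in> verts G \<Longrightarrow> hitting s x \<le> hitting s v"
    and balanced: "hitting s v \<le> weight (s, u) + hitting s v'"
begin

definition lower_arm :: "('a \<times> 'a) set" where "lower_arm = between s v - {(s, u)}"
definition opposite_arm :: "('a \<times> 'a) set" where "opposite_arm = between s v'"
definition offshoots :: "('a \<times> 'a) set" where
  "offshoots = outward s - between s v - between s v'"

abbreviation size_beyond :: "'a \<times> 'a \<Rightarrow> nat" where "size_beyond e \<equiv> card (beyond e)"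

text \<open>The bound of \<open>access_time_le_hitting\<close>, multiplied by \<open>2 m\<close> to make it an integer.\<close>

definition excess :: int where "excess = 2 * m * hitting s v - spread s"

lemma top_in_between: "(s, u) \<in> between s v"
  using su v by (simp add: between_def)

lemma v_in: "v \<in> verts G"
  using beyond_subset[of "(s, u)"] su v by auto

lemma finite_arms [simp]: "finite lower_arm" "finite opposite_arm" "finite offshoots"
  by (simp_all add: lower_arm_def opposite_arm_def offshoots_def)

lemma between_v: "between s v = insert (s, u) lower_arm" "(s, u) \<notin> lower_arm"
  using top_in_between by (auto simp: lower_arm_def)

lemma arms_darts: "lower_arm \<subseteq> darts" "opposite_arm \<subseteq> darts" "offshoots \<subseteq> darts"
  by (auto simp: lower_arm_def opposite_arm_def offshoots_def between_def outward_def)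

lemma arms_disjoint: "between s v \<inter> between s v' = {}"
proof -
  have False if e: "e \<in> between s v" "e \<in> between s v'" for e
  proof -
    have d: "e \<in> darts" "s \<notin> beyond e" "v' \<in> beyond e" using e by (auto simp: between_def)
    have "beyond (s, u) \<subseteq> beyond e"
      using between_chain[OF s e(1) top_in_between] d v' by auto
    then have "u \<in> beyond e" by auto
    then have "e = (s, u)" using only_separator[OF d(1) su] d by simp
    with d v' show False by simp
  qed
  then show ?thesis by auto
qed

lemma outward_split: "outward s = insert (s, u) (lower_arm \<union> opposite_arm \<union> offshoots)"
  and outward_split_disjoint: "(s, u) \<notin> lower_arm \<union> opposite_arm \<union> offshoots" "lower_arm \<inter> opposite_arm = {}"
    "(lower_arm \<union> opposite_arm) \<inter> offshoots = {}"
  using between_v arms_disjoint between_subset_outward[of s v] between_subset_outward[of s v'] top_in_between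
  by (auto simp: lower_arm_def opposite_arm_def offshoots_def)

lemma inj_arms: "inj_on size_beyond lower_arm" "inj_on size_beyond opposite_arm"
  using inj_on_card_beyond[OF s] by (auto simp: lower_arm_def opposite_arm_def intro: inj_on_subset)

lemma sum_arms:
  "(\<Sum>k\<in>size_beyond ` lower_arm. f k) = (\<Sum>e\<in>lower_arm. f (size_beyond e))"
  "(\<Sum>k\<in>size_beyond ` opposite_arm. f k) = (\<Sum>e\<in>opposite_arm. f (size_beyond e))"
  for f :: "nat \<Rightarrow> int"
  using inj_arms by (simp_all add: sum.reindex)

lemma hitting_arms:
  "hitting s v = weight (s, u) + (\<Sum>k\<in>size_beyond ` lower_arm. 2 * int k - 1)"
  "hitting s v' = (\<Sum>k\<in>size_beyond ` opposite_arm. 2 * int k - 1)"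
  unfolding sum_arms hitting_def between_v(1)
  using between_v(2) by (simp_all add: weight_def opposite_arm_def)

text \<open>In \<open>2 m D\<^sub>s v\<close> write one of the two terms \<open>m D\<^sub>s v\<close> as \<open>m\<close> times \<open>w e\<^sub>0 + D\<^sub>s v'\<close> minus the gap between the
two. Then every edge enters through a function of its own weight only: \<open>2 m w - w\<^sup>2\<close> for \<open>e\<^sub>0\<close>, which
is \<open>m\<^sup>2 - (w - m)\<^sup>2\<close>, and \<open>m w - w\<^sup>2\<close> on the arms.\<close>

lemma excess_eq:
  "excess = m\<^sup>2 - (weight (s, u) - m)\<^sup>2
     + (\<Sum>k\<in>size_beyond ` lower_arm. profit m k) + (\<Sum>k\<in>size_beyond ` opposite_arm. profit m k)
     - m * ((\<Sum>k\<in>size_beyond ` opposite_arm. 2 * int k - 1) - (\<Sum>k\<in>size_beyond ` lower_arm. 2 * int k - 1))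
     - (\<Sum>e\<in>offshoots. (weight e)\<^sup>2)"
proof -
  have sp: "spread s = (weight (s, u))\<^sup>2 + (\<Sum>e\<in>lower_arm. (weight e)\<^sup>2) + (\<Sum>e\<in>opposite_arm. (weight e)\<^sup>2)
      + (\<Sum>e\<in>offshoots. (weight e)\<^sup>2)"
    unfolding spread_def outward_split using outward_split_disjoint
    by (subst sum.insert) (auto simp: sum.union_disjoint)
  have pr: "(\<Sum>e\<in>X. profit m (size_beyond e)) = m * (\<Sum>e\<in>X. weight e) - (\<Sum>e\<in>X. (weight e)\<^sup>2)" for X
    by (simp add: profit_def weight_def sum_distrib_left power2_eq_square algebra_simps
        flip: sum_subtractf)
  have w: "(\<Sum>e\<in>X. 2 * int (size_beyond e) - 1) = (\<Sum>e\<in>X. weight e)" for X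
    by (simp add: weight_def)
  show ?thesis
    unfolding excess_def hitting_arms(1) sp sum_arms pr w
    by (simp add: power2_eq_square algebra_simps)
qed

lemma size_beyond_lower_arm:
  assumes "e \<in> lower_arm"
  shows "1 \<le> size_beyond e" "size_beyond e < size_beyond (s, u)"
proof -
  have e: "e \<in> between s v" "e \<in> darts" "e \<noteq> (s, u)" "s \<notin> beyond e"
    using assms by (auto simp: lower_arm_def between_def)
  show "1 \<le> size_beyond e" using card_beyond_pos[OF e(2)] by simp
  have "\<not> beyond (s, u) \<subseteq> beyond e"
  proof
    assume "beyond (s, u) \<subseteq> beyond e"
    then have "u \<in> beyond e" by auto
    with only_separator[OF e(2) su] e show False by simp
  qed
  then have "beyond e \<subset> beyond (s, u)" using between_chain[OF s e(1) top_in_between] by auto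
  then show "size_beyond e < size_beyond (s, u)" using su by (intro psubset_card_mono) auto
qed

text \<open>The subtrees beyond \<open>e\<close> and beyond the edge from \<open>s\<close> to \<open>u\<close> are disjoint and both miss \<open>s\<close>.\<close>

lemma size_beyond_opposite_arm:
  assumes "e \<in> opposite_arm"
  shows "1 \<le> size_beyond e" "int (size_beyond e) + int (size_beyond (s, u)) \<le> m"
proof -
  have e: "e \<in> darts" "s \<notin> beyond e" "v' \<in> beyond e" "e \<in> between s v'"
    using assms by (auto simp: opposite_arm_def between_def)
  show "1 \<le> size_beyond e" using card_beyond_pos[OF e(1)] by simp
  obtain x y where xy: "e = (x, y)" by (cases e)
  have "beyond e \<inter> beyond (s, u) = {}"
  proof (rule ccontr)
    assume "beyond e \<inter> beyond (s, u) \<noteq> {}"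
    then obtain w where w: "w \<in> beyond e" "w \<in> beyond (s, u)" by auto
    then have "e \<in> between s w" "(s, u) \<in> between s w" using e su by (auto simp: between_def)
    from between_chain[OF s this] e(3) v'(2) have "beyond (s, u) \<subseteq> beyond e" by auto
    then have "u \<in> beyond e" by auto
    then have "e = (s, u)" using only_separator[OF e(1) su] e by simp
    with e v' show False by simp
  qed
  then have "size_beyond e + size_beyond (s, u) = card (beyond e \<union> beyond (s, u))"
    using e su by (simp add: card_Un_disjoint)
  also have "\<dots> \<le> card (verts G - {s})"
    using beyond_subset[OF e(1)] beyond_subset[of "(s, u)"] e su
    by (intro card_mono) auto
  also have "\<dots> = card (verts G) - 1" using s by simp
  finally show "int (size_beyond e) + int (size_beyond (s, u)) \<le> m"
    using nontrivial by linarith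
qed

lemma card_arms:
  "1 + card (size_beyond ` lower_arm) + card (size_beyond ` opposite_arm) + card offshoots = card (verts G) - 1"
proof -
  have "card (outward s) = 1 + (card lower_arm + card opposite_arm + card offshoots)"
    unfolding outward_split using outward_split_disjoint
    by (subst card_insert_disjoint) (auto simp: card_Un_disjoint)
  then show ?thesis using card_outward[OF s] inj_arms by (simp add: card_image)
qed

lemma card_offshoots_le: "int (card offshoots) \<le> (\<Sum>e\<in>offshoots. (weight e)\<^sup>2)"
proof -
  have "(\<Sum>e\<in>offshoots. 1) \<le> (\<Sum>e\<in>offshoots. (weight e)\<^sup>2)"
  proof (rule sum_mono)
    fix e assume "e \<in> offshoots"
    then have "1 \<le> weight e" using arms_darts weight_pos by blast
    then show "1 \<le> (weight e)\<^sup>2" by (simp add: power2_eq_square) (metis mult_mono' mult_1 zero_le_one)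
  qed
  then show ?thesis by simp
qed

lemma access_time_le_excess:
  "access_time G s \<le> ennreal (real_of_int excess / (2 * real_of_int m))"
proof -
  have "0 < real_of_int m" using nontrivial by simp
  then have "real_of_int excess / (2 * real_of_int m)
      = real_of_int (hitting s v) - real_of_int (spread s) / (2 * real_of_int m)"
    by (simp add: excess_def diff_divide_distrib)
  then show ?thesis using access_time_le_hitting[OF s farthest] by simp
qed

lemma arms_balanced:
  "(\<Sum>k\<in>size_beyond ` lower_arm. 2 * int k - 1) \<le> (\<Sum>k\<in>size_beyond ` opposite_arm. 2 * int k - 1)"
  using balanced unfolding hitting_arms by simp

lemma excess_le_odd_edges:
  assumes m: "m = 2 * int t + 1"
  shows "excess + int (card offshoots) \<le> m\<^sup>2 + 2 * (\<Sum>k\<in>{1..t}. profit m k)"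
proof -
  have "(\<Sum>k\<in>size_beyond ` lower_arm. profit m k) \<le> (\<Sum>k\<in>{1..t}. profit m k)"
    "(\<Sum>k\<in>size_beyond ` opposite_arm. profit m k) \<le> (\<Sum>k\<in>{1..t}. profit m k)"
    using size_beyond_lower_arm(1) size_beyond_opposite_arm(1) m by (intro sum_profit_le; auto)+
  moreover have "0 \<le> m * ((\<Sum>k\<in>size_beyond ` opposite_arm. 2 * int k - 1) - (\<Sum>k\<in>size_beyond ` lower_arm. 2 * int k - 1))"
    using arms_balanced nontrivial by simp
  moreover have "0 \<le> (weight (s, u) - m)\<^sup>2" by simp
  ultimately show ?thesis
    using card_offshoots_le unfolding excess_eq by linarith
qed

lemma excess_le_even_edges:
  assumes m: "m = 2 * int t" and t: "2 \<le> t"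
  shows "excess \<le> m\<^sup>2 + 2 * (\<Sum>k\<in>{1..t}. profit m k) - 2 * m"
    and "excess = m\<^sup>2 + 2 * (\<Sum>k\<in>{1..t}. profit m k) - 2 * m \<Longrightarrow>
      size_beyond ` lower_arm = {1..t - 1} \<and> size_beyond ` opposite_arm = {1..t - 1}
        \<and> (\<Sum>e\<in>offshoots. (weight e)\<^sup>2) = 1"
proof -
  have A: "\<forall>j\<in>size_beyond ` lower_arm. 1 \<le> j \<and> j < size_beyond (s, u)"
    using size_beyond_lower_arm by auto
  have B: "\<forall>j\<in>size_beyond ` opposite_arm. 1 \<le> j \<and> j + size_beyond (s, u) \<le> 2 * t"
    using size_beyond_opposite_arm m by fastforce
  have count: "card (size_beyond ` lower_arm) + card (size_beyond ` opposite_arm) + card offshoots = 2 * t - 1"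
    using card_arms m nontrivial by linarith
  note * = profit_deficit_even[OF t _ A _ B arms_balanced count card_offshoots_le]
  show "excess \<le> m\<^sup>2 + 2 * (\<Sum>k\<in>{1..t}. profit m k) - 2 * m"
    using *(1) unfolding excess_eq weight_def m by simp
  show "excess = m\<^sup>2 + 2 * (\<Sum>k\<in>{1..t}. profit m k) - 2 * m \<Longrightarrow>
      size_beyond ` lower_arm = {1..t - 1} \<and> size_beyond ` opposite_arm = {1..t - 1}
        \<and> (\<Sum>e\<in>offshoots. (weight e)\<^sup>2) = 1"
    using *(2) unfolding excess_eq weight_def m by simp
qed

end

lemma (in nontrivial_tree) exists_balanced: "\<exists>s u v v'. balanced_root G s u v v'"
proof -
  from exists_balanced_root obtain s u v v' where "s \<in> verts G" "adj G s u" "v \<in> beyond (s, u)"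
    "v' \<in> verts G" "v' \<notin> beyond (s, u)"
    "\<And>x. x \<in> verts G \<Longrightarrow> hitting s x \<le> hitting s v"
    "hitting s v \<le> weight (s, u) + hitting s v'" by metis
  then have "balanced_root G s u v v'" by unfold_locales auto
  then show ?thesis by blast
qed

section \<open>Recognising an isomorphism\<close>

text \<open>A bijection of the vertices that preserves adjacency is injective on edges, hence bijective on
them when the numbers of edges agree; so it reflects adjacency as well.\<close>

lemma isomorphic_if_card_edges:
  assumes G: "simple_graph G" and H: "simple_graph H"
    and edges: "card (edges G) = card (edges H)"
    and bij: "bij_betw \<phi> (verts G) (verts H)"
    and hom: "\<And>x y. adj G x y \<Longrightarrow> adj H (\<phi> x) (\<phi> y)"
  shows "isomorphic G H"
proof -
  have inj: "inj_on \<phi> (verts G)" using bij by (rule bij_betw_imp_inj_on)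
  have sub: "e \<subseteq> verts G" if "e \<in> edges G" for e
    using that G by (auto simp: simple_graph_def)
  have "finite (edges H)"
    by (rule finite_subset[of _ "Pow (verts H)"]) (use H in \<open>auto simp: simple_graph_def\<close>)
  moreover have "(`) \<phi> ` edges G \<subseteq> edges H"
  proof
    fix e' assume "e' \<in> (`) \<phi> ` edges G"
    then obtain e where e: "e \<in> edges G" "e' = \<phi> ` e" by auto
    then have "card e = 2" using G by (auto simp: simple_graph_def)
    then obtain x y where "e = {x, y}" by (auto simp: card_2_iff)
    with e hom[of x y] show "e' \<in> edges H" by (simp add: adj_def)
  qed
  moreover have "card ((`) \<phi> ` edges G) = card (edges H)"
    using inj_on_image_eq_iff[OF inj] sub edges by (subst card_image) (auto simp: inj_on_def)
  ultimately have img: "(`) \<phi> ` edges G = edges H" by (rule card_subset_eq)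
  have "adj G x y" if xy: "x \<in> verts G" "y \<in> verts G" and "adj H (\<phi> x) (\<phi> y)" for x y
  proof -
    from that img obtain e where e: "e \<in> edges G" "\<phi> ` {x, y} = \<phi> ` e"
      by (auto simp: adj_def)
    then have "{x, y} = e" using inj_on_image_eq_iff[OF inj, of "{x, y}" e] sub xy by auto
    with e show ?thesis by (simp add: adj_def)
  qed
  with hom bij show ?thesis by (auto simp: isomorphic_def)
qed

text \<open>A discrete intermediate value theorem. It replaces the explicit listing of the vertices of a path.\<close>

lemma rtranclp_discrete_ivt:
  fixes f :: "'b \<Rightarrow> nat"
  assumes "r\<^sup>*\<^sup>* x y" and "\<And>a b. r a b \<Longrightarrow> f b \<le> Suc (f a)" and "f x \<le> k" "k \<le> f y"
  shows "\<exists>w. r\<^sup>*\<^sup>* x w \<and> f w = k"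
  using assms(1,4)
proof (induction rule: rtranclp_induct)
  case base
  then show ?case using assms(3) by auto
next
  case (step y z)
  show ?case
  proof (cases "k \<le> f y")
    case True
    then show ?thesis by (rule step.IH)
  next
    case False
    then have "f z = k" using assms(2)[OF step.hyps(2)] step.prems by linarith
    then show ?thesis using step.hyps by (intro exI[of _ z]) (auto intro: rtranclp.rtrancl_into_rtrancl)
  qed
qed

lemma isomorphic_refl: "isomorphic G G"
  unfolding isomorphic_def by (intro exI[of _ id]) auto

context nontrivial_tree
begin

text \<open>The distance in the tree, as the number of separating edges.\<close>

abbreviation depth :: "'a \<Rightarrow> 'a \<Rightarrow> nat" where "depth z x \<equiv> card (between z x)"

lemma depth_adj:
  assumes "z \<in> verts G" "adj G x y"
  shows "depth z y = Suc (depth z x) \<or> depth z x = Suc (depth z y)"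
proof (cases "z \<in> beyond (x, y)")
  case True
  then have "z \<notin> beyond (y, x)" using beyond_flip[OF assms(2)] by simp
  with between_step[of z y x] assms adj_sym show ?thesis by simp
next
  case False
  with between_step[of z x y] assms show ?thesis by simp
qed

lemma depth_le: "z \<in> verts G \<Longrightarrow> depth z x \<le> card (verts G) - 1"
  using card_mono[OF finite_outward between_subset_outward] card_outward by metis

lemma depth_attained:
  assumes z: "z \<in> verts G" and r: "\<And>a b. r a b \<Longrightarrow> adj G a b" and "r\<^sup>*\<^sup>* z v" "k \<le> depth z v"
  shows "\<exists>w. r\<^sup>*\<^sup>* z w \<and> depth z w = k"
  using assms(3) by (rule rtranclp_discrete_ivt) (use depth_adj[OF z r] assms(4) in force)+

text \<open>An edge separates \<open>a\<close> from \<open>b\<close> exactly if it separates one, but not both, of them from \<open>c\<close>. Seen from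
\<open>a\<close>, the edges on the way to \<open>c\<close> are reversed.\<close>

lemma between_via:
  assumes a: "a \<in> verts G" and b: "b \<in> verts G" and c: "c \<in> verts G"
  shows "between a b = prod.swap ` (between c a - between c b) \<union> (between c b - between c a)"
proof (rule set_eqI)
  fix e :: "'a \<times> 'a"
  obtain x y where e: "e = (x, y)" by (cases e)
  have "(x, y) \<in> prod.swap ` (between c a - between c b) \<longleftrightarrow> (y, x) \<in> between c a - between c b"
    by force
  also have "\<dots> \<longleftrightarrow> adj G x y \<and> c \<in> beyond (x, y) \<and> a \<notin> beyond (x, y) \<and> b \<in> beyond (x, y)"
    using a b c beyond_flip[of x y] adj_sym[of x y] by (auto simp: between_def)
  finally show "e \<in> between a b \<longleftrightarrow>
      e \<in> prod.swap ` (between c a - between c b) \<union> (between c b - between c a)"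
    by (auto simp: e between_def)
qed

lemma depth_via:
  assumes a: "a \<in> verts G" and b: "b \<in> verts G" and c: "c \<in> verts G"
  shows "depth a b = card (between c a - between c b) + card (between c b - between c a)"
proof -
  have "c \<in> beyond e" if "e \<in> prod.swap ` (between c a - between c b)" for e
    using that c beyond_flip by (fastforce simp: between_def)
  moreover have "c \<notin> beyond e" if "e \<in> between c b" for e using that by (simp add: between_def)
  ultimately have "prod.swap ` (between c a - between c b) \<inter> (between c b - between c a) = {}"
    by blast
  then show ?thesis
    unfolding between_via[OF assms] by (simp add: card_Un_disjoint card_image)
qed

end

section \<open>The star, the path and the wishbone are trees\<close>

text \<open>The largest vertex of a cycle would have two different smaller neighbours.\<close>

lemma no_cycle_nat:
  fixes G :: "nat sgraph"
  assumes "\<And>x y z. adj G x y \<Longrightarrow> adj G x z \<Longrightarrow> y < x \<Longrightarrow> z < x \<Longrightarrow> y = z"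
  shows "\<not> cycle G c"
proof
  assume c: "cycle G c"
  let ?L = "length c"
  have L: "3 \<le> ?L" and d: "distinct c" using c by (simp_all add: cycle_def)
  then have "c \<noteq> []" by auto
  then have last: "adj G (c ! (?L - 1)) (c ! 0)"
    using c by (simp add: cycle_def last_conv_nth hd_conv_nth)
  have sym: "adj G x y \<Longrightarrow> adj G y x" for x y by (simp add: adj_def insert_commute)
  have succ: "adj G (c ! i) (c ! Suc i)" if "Suc i < ?L" for i
    using c that by (auto simp: cycle_def successively_conv_nth)
  have "Max (set c) \<in> set c" using L by (intro Max_in) auto
  then obtain i where i: "i < ?L" "c ! i = Max (set c)" by (auto simp: in_set_conv_nth)
  define j where "j = (if Suc i = ?L then 0 else Suc i)"
  define k where "k = (if i = 0 then ?L - 1 else i - 1)"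
  have jk: "j < ?L" "k < ?L" "j \<noteq> i" "k \<noteq> i" "j \<noteq> k"
    using L i unfolding j_def k_def by (auto split: if_splits)
  have "adj G (c ! i) (c ! j)"
  proof (cases "Suc i = ?L")
    case True
    then have "i = ?L - 1" by simp
    with True last show ?thesis by (simp add: j_def)
  next
    case False
    then show ?thesis using succ[of i] i by (simp add: j_def)
  qed
  moreover have "adj G (c ! i) (c ! k)"
  proof (cases "i = 0")
    case True
    then show ?thesis using sym[OF last] by (simp add: k_def)
  next
    case False
    then show ?thesis using sym[OF succ[of "i - 1"]] i by (simp add: k_def)
  qed
  moreover have "c ! a < c ! i" if "a < ?L" "a \<noteq> i" for a
  proof -
    have "c ! a \<le> c ! i" using that i by (auto intro: Max_ge)
    moreover have "c ! a \<noteq> c ! i" using that i(1) d by (simp add: nth_eq_iff_index_eq)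
    ultimately show ?thesis by simp
  qed
  ultimately have "c ! j = c ! k" using assms jk by blast
  then show False using d jk by (simp add: nth_eq_iff_index_eq)
qed

lemma tree_natI:
  fixes G :: "nat sgraph"
  assumes G: "simple_graph G" and V: "verts G = {0..<n}" "0 < n"
    and parent: "\<And>x. 0 < x \<Longrightarrow> x < n \<Longrightarrow> \<exists>!y. y < x \<and> adj G x y"
  shows "tree G"
proof -
  have sym: "symp (adj G)" by (auto simp: symp_def adj_def insert_commute)
  have root: "x < n \<Longrightarrow> (adj G)\<^sup>*\<^sup>* x 0" for x
  proof (induction x rule: less_induct)
    case (less x)
    show ?case
    proof (cases "x = 0")
      case False
      with parent less.prems obtain y where "y < x" "adj G x y" by blast
      with less show ?thesis by (meson converse_rtranclp_into_rtranclp less_trans)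
    qed simp
  qed
  have "connected_graph G"
    unfolding connected_graph_def V
  proof (intro conjI ballI)
    fix x y assume "x \<in> {0..<n}" "y \<in> {0..<n}"
    then have "(adj G)\<^sup>*\<^sup>* x 0" "(adj G)\<^sup>*\<^sup>* 0 y"
      using root sympD[OF symp_rtranclp[OF sym]] by auto
    then show "(adj G)\<^sup>*\<^sup>* x y" by (rule rtranclp_trans)
  qed (use V in auto)
  moreover have "x < n" if "adj G x y" for x y
    using that G V by (auto simp: simple_graph_def adj_def)
  then have "\<not> cycle G c" for c
    using parent by (intro no_cycle_nat) (metis gr_zeroI not_less_zero)
  ultimately show ?thesis using G by (simp add: tree_def)
qed

lemma verts_star [simp]: "verts (star_graph n) = {0..<n}"
  and verts_path [simp]: "verts (path_graph n) = {0..<n}"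
  by (simp_all add: star_graph_def path_graph_def)

lemma verts_wishbone: "0 < n \<Longrightarrow> verts (wishbone n) = {0..<n}"
  by (auto simp: wishbone_def)

lemma adj_star: "adj (star_graph n) x y \<longleftrightarrow> (x = 0 \<and> 0 < y \<and> y < n) \<or> (y = 0 \<and> 0 < x \<and> x < n)"
  by (auto simp: star_graph_def adj_def doubleton_eq_iff)

lemma adj_path: "adj (path_graph n) x y \<longleftrightarrow> (y = Suc x \<and> y < n) \<or> (x = Suc y \<and> x < n)"
  by (auto simp: path_graph_def adj_def doubleton_eq_iff)

lemma adj_wishbone:
  "adj (wishbone n) x y \<longleftrightarrow> adj (path_graph (n - 1)) x y \<or> {x, y} = {n div 2, n - 1}"
  by (auto simp: wishbone_def adj_def)

lemma simple_star: "simple_graph (star_graph n)"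
  by (auto simp: simple_graph_def star_graph_def)

lemma simple_path: "simple_graph (path_graph n)"
  by (auto simp: simple_graph_def path_graph_def)

lemma simple_wishbone: "3 \<le> n \<Longrightarrow> simple_graph (wishbone n)"
  by (auto simp: simple_graph_def wishbone_def path_graph_def)

lemma tree_star: "0 < n \<Longrightarrow> tree (star_graph n)"
  by (rule tree_natI[OF simple_star]) (auto simp: adj_star)

lemma tree_path: "0 < n \<Longrightarrow> tree (path_graph n)"
proof (rule tree_natI[OF simple_path])
  fix x assume "0 < x" "x < n"
  then show "\<exists>!y. y < x \<and> adj (path_graph n) x y"
    by (intro ex1I[of _ "x - 1"]) (auto simp: adj_path)
qed auto

lemma tree_wishbone:
  assumes "3 \<le> n"
  shows "tree (wishbone n)"
proof (rule tree_natI[OF simple_wishbone[OF assms] verts_wishbone])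
  fix x assume x: "0 < x" "x < n"
  show "\<exists>!y. y < x \<and> adj (wishbone n) x y"
  proof (cases "x = n - 1")
    case True
    with assms show ?thesis
      by (intro ex1I[of _ "n div 2"]) (auto simp: adj_wishbone adj_path doubleton_eq_iff)
  next
    case False
    with x assms show ?thesis
      by (intro ex1I[of _ "x - 1"]) (auto simp: adj_wishbone adj_path doubleton_eq_iff)
  qed
qed (use assms in auto)

section \<open>Trees whose edges lie on one path, up to a leaf\<close>

context nontrivial_tree
begin

lemma isomorphic_if_edge_preserving:
  fixes H :: "'b sgraph"
  assumes "tree H" "bij_betw \<phi> (verts G) (verts H)"
    and "\<And>x y. adj G x y \<Longrightarrow> adj H (\<phi> x) (\<phi> y)"
  shows "isomorphic G H"
proof -
  have "card (verts H) = card (verts G)" using assms(2) by (simp add: bij_betw_same_card)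
  then interpret H: nontrivial_tree H using assms(1) nontrivial by unfold_locales auto
  show ?thesis
    using assms card_edges H.card_edges \<open>card (verts H) = card (verts G)\<close>
    by (intro isomorphic_if_card_edges[OF simple H.simple]) auto
qed

text \<open>If all edges lie between \<open>z\<close> and \<open>v\<close>, the distance from \<open>z\<close> takes every value below \<open>n\<close> on the way
from \<open>z\<close> to \<open>v\<close>, and there are only \<open>n\<close> vertices; so it numbers them, neighbours consecutively.\<close>

lemma isomorphic_path:
  assumes z: "z \<in> verts G" and v: "v \<in> verts G" and full: "between z v = outward z"
  shows "isomorphic G (path_graph (card (verts G)))"
proof (rule isomorphic_if_edge_preserving)
  let ?n = "card (verts G)"
  show "tree (path_graph ?n)" using nontrivial by (intro tree_path) simp
  have dv: "depth z v = ?n - 1" using full card_outward[OF z] by simp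
  have "depth z ` verts G = {0..<?n}"
  proof
    show "depth z ` verts G \<subseteq> {0..<?n}"
    proof
      fix k assume "k \<in> depth z ` verts G"
      then obtain x where "k = depth z x" by auto
      then show "k \<in> {0..<?n}" using depth_le[OF z, of x] nontrivial by simp
    qed
    show "{0..<?n} \<subseteq> depth z ` verts G"
    proof
      fix k assume "k \<in> {0..<?n}"
      then have "k \<le> depth z v" using dv by auto
      from depth_attained[OF z _ connected[OF z v] this] obtain w
        where w: "(adj G)\<^sup>*\<^sup>* z w" "depth z w = k" by auto
      from w(1) z adj_in_verts have "w \<in> verts G" by (induction rule: rtranclp_induct) auto
      with w show "k \<in> depth z ` verts G" by auto
    qed
  qed
  then show "bij_betw (depth z) (verts G) (verts (path_graph ?n))"
    by (simp add: bij_betw_def eq_card_imp_inj_on)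
  fix x y assume xy: "adj G x y"
  then show "adj (path_graph ?n) (depth z x) (depth z y)"
    using depth_adj[OF z xy] depth_le[OF z, of x] depth_le[OF z, of y] nontrivial
    by (auto simp: adj_path)
qed

text \<open>Off the leaf \<open>l\<close> the distance from \<open>z\<close> numbers the vertices as in \<open>isomorphic_path\<close>. If the leaf is attached at
distance \<open>t - 1\<close> instead of \<open>t\<close>, the numbering is reversed.\<close>

lemma isomorphic_wishbone:
  assumes n: "card (verts G) = 2 * t + 1" "0 < t"
    and z: "z \<in> verts G" and v: "v \<in> verts G" and pl: "adj G p l"
    and full: "outward z = insert (p, l) (between z v)" "(p, l) \<notin> between z v"
    and leaf: "beyond (p, l) = {l}" and p: "depth z p = t \<or> depth z p = t - 1"
  shows "isomorphic G (wishbone (2 * t + 1))"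
proof (rule isomorphic_if_edge_preserving)
  define W where "W = verts G - {l}"
  define \<phi> where "\<phi> x = (if x = l then 2 * t else if depth z p = t then depth z x
      else 2 * t - 1 - depth z x)" for x
  show "tree (wishbone (2 * t + 1))" using n by (intro tree_wishbone) simp
  have l: "l \<in> verts G" "p \<noteq> l" using pl adj_in_verts adj_neq by auto
  have "(p, l) \<in> outward z" using full by simp
  then have zl: "z \<noteq> l" by (auto simp: outward_def leaf)
  have vl: "v \<noteq> l" using full(2) zl pl by (simp add: between_def leaf)
  have dv: "depth z v = 2 * t - 1"
  proof -
    have "Suc (depth z v) = card (outward z)" using full by simp
    then show ?thesis using card_outward[OF z] n by simp
  qed
  have depth_W: "depth z x \<le> 2 * t - 1" if "x \<noteq> l" for x
  proof -
    have "(p, l) \<notin> between z x" using that by (simp add: between_def leaf)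
    then have "between z x \<subseteq> between z v" using between_subset_outward[of z x] full by auto
    then show ?thesis using dv card_mono[OF finite_between] by metis
  qed
  have W_beyond: "W = beyond (l, p)" using beyond_flip[OF pl] by (simp add: W_def leaf)
  have img: "depth z ` W = {0..<2 * t}"
  proof
    show "depth z ` W \<subseteq> {0..<2 * t}"
    proof
      fix k assume "k \<in> depth z ` W"
      then obtain x where "k = depth z x" "x \<noteq> l" by (auto simp: W_def)
      then show "k \<in> {0..<2 * t}" using depth_W[of x] n(2) by simp
    qed
    show "{0..<2 * t} \<subseteq> depth z ` W"
    proof
      fix k assume k: "k \<in> {0..<2 * t}"
      let ?r = "\<lambda>a b. adj G a b \<and> {a, b} \<noteq> {l, p}"
      have "symp ?r" using adj_sym by (auto simp: symp_def insert_commute)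
      then have sym: "?r\<^sup>*\<^sup>* a b \<Longrightarrow> ?r\<^sup>*\<^sup>* b a" for a b
        by (rule sympD[OF symp_rtranclp])
      have "z \<in> beyond (l, p)" "v \<in> beyond (l, p)"
        unfolding W_beyond[symmetric] using z v zl vl by (simp_all add: W_def)
      then have "?r\<^sup>*\<^sup>* p z" "?r\<^sup>*\<^sup>* p v" by (simp_all add: beyond_def)
      then have zv: "?r\<^sup>*\<^sup>* z v" using sym[of p z] by (rule_tac rtranclp_trans)
      have "k \<le> depth z v" using k dv by auto
      from depth_attained[OF z _ zv this] obtain w where w: "?r\<^sup>*\<^sup>* z w" "depth z w = k" by auto
      then have "?r\<^sup>*\<^sup>* p w" using \<open>?r\<^sup>*\<^sup>* p z\<close> by simp
      then have "w \<in> W" unfolding W_beyond by (simp add: beyond_def)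
      with w show "k \<in> depth z ` W" by auto
    qed
  qed
  have "card W = 2 * t" using l n by (simp add: W_def)
  then have inj: "inj_on (depth z) W" using img by (intro eq_card_imp_inj_on) (auto simp: W_def)
  have "\<phi> ` W = {0..<2 * t}"
  proof (cases "depth z p = t")
    case True
    then have "\<phi> ` W = depth z ` W" by (intro image_cong) (auto simp: \<phi>_def W_def)
    then show ?thesis using img by simp
  next
    case False
    then have "\<phi> ` W = (\<lambda>k. 2 * t - 1 - k) ` depth z ` W"
      unfolding image_image by (intro image_cong) (auto simp: \<phi>_def W_def)
    also have "\<dots> = {0..<2 * t}"
    proof (unfold img, intro equalityI subsetI)
      fix k assume "k \<in> {0..<2 * t}"
      then have "k = 2 * t - 1 - (2 * t - 1 - k)" "2 * t - 1 - k \<in> {0..<2 * t}" by auto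
      then show "k \<in> (\<lambda>k. 2 * t - 1 - k) ` {0..<2 * t}" by (rule image_eqI)
    qed auto
    finally show ?thesis .
  qed
  then have img\<phi>: "\<phi> ` verts G = {0..<2 * t + 1}"
  proof -
    have "verts G = insert l W" using l by (auto simp: W_def)
    moreover have "\<phi> l = 2 * t" by (simp add: \<phi>_def)
    ultimately have "\<phi> ` verts G = insert (2 * t) (\<phi> ` W)" by (simp only: image_insert)
    then show ?thesis using \<open>\<phi> ` W = {0..<2 * t}\<close> by auto
  qed
  then show "bij_betw \<phi> (verts G) (verts (wishbone (2 * t + 1)))"
    using n by (simp add: bij_betw_def verts_wishbone eq_card_imp_inj_on)
  have only_p: "x = p" if "adj G l x" for x
    using crossing[OF pl snd_in_beyond _ that] adj_neq[OF that] unfolding leaf by blast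
  have \<phi>p: "\<phi> p = t" "\<phi> l = 2 * t" using p n l by (auto simp: \<phi>_def)
  fix x y assume xy: "adj G x y"
  consider "x = l" | "y = l" | "x \<noteq> l" "y \<noteq> l" by blast
  then show "adj (wishbone (2 * t + 1)) (\<phi> x) (\<phi> y)"
  proof cases
    case 1
    then have "y = p" using xy by (intro only_p) simp
    with 1 show ?thesis by (simp add: \<phi>p adj_wishbone insert_commute)
  next
    case 2
    then have "x = p" using xy adj_sym[of x y] by (intro only_p) simp
    with 2 show ?thesis by (simp add: \<phi>p adj_wishbone)
  next
    case 3
    have "\<phi> y = Suc (\<phi> x) \<or> \<phi> x = Suc (\<phi> y)" "\<phi> x < 2 * t" "\<phi> y < 2 * t"
      using depth_adj[OF z xy] depth_W[OF 3(1)] depth_W[OF 3(2)] n(2) 3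
      by (auto simp: \<phi>_def)
    then have "adj (path_graph (2 * t)) (\<phi> x) (\<phi> y)" unfolding adj_path by auto
    then show ?thesis by (simp add: adj_wishbone)
  qed
qed

text \<open>A chain whose sizes leave no gap gains one vertex at each step. But \<open>p\<close> and its neighbour \<open>l\<close> are not
separated by \<open>X\<close>, so both would enter the chain in the same step.\<close>

lemma full_chain_avoids:
  assumes s: "s \<in> verts G" and X: "X \<subseteq> between s x" and sizes: "(\<lambda>e. card (beyond e)) ` X = {1..j}"
    and pl: "adj G p l" "(p, l) \<notin> X" "(l, p) \<notin> X" and e: "e \<in> X"
  shows "p \<notin> beyond e"
proof
  assume "p \<in> beyond e"
  with e have "\<exists>e. e \<in> X \<and> p \<in> beyond e" by blast
  then obtain e where e: "e \<in> X" "p \<in> beyond e"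
    and min: "\<And>e'. e' \<in> X \<Longrightarrow> p \<in> beyond e' \<Longrightarrow> card (beyond e) \<le> card (beyond e')"
    using ex_has_least_nat[of "\<lambda>e. e \<in> X \<and> p \<in> beyond e" _ "\<lambda>e. card (beyond e)"] by metis
  have d: "X \<subseteq> darts" using X by (auto simp: between_def)
  have both: "p \<in> beyond e' \<longleftrightarrow> l \<in> beyond e'" if "e' \<in> X" for e'
    using that pl d by (intro same_side_adj) auto
  have fin: "finite (beyond e)" using e d by auto
  have "{p, l} \<subseteq> beyond e" using e both by auto
  then have two: "card {p, l} \<le> card (beyond e)" using fin by (rule card_mono[rotated])
  have "card (beyond e) \<in> {1..j}" unfolding sizes[symmetric] using e by (intro imageI)
  with two have "card (beyond e) - 1 \<in> (\<lambda>e. card (beyond e)) ` X"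
    unfolding sizes using adj_neq[OF pl(1)] by auto
  then obtain e' where e': "e' \<in> X" "card (beyond e') = card (beyond e) - 1" by auto
  with min two adj_neq[OF pl(1)] have "p \<notin> beyond e'" by fastforce
  with both e' have out: "l \<notin> beyond e'" "p \<notin> beyond e'" by auto
  have "\<not> beyond e \<subseteq> beyond e'" using e out by auto
  then have "beyond e' \<subseteq> beyond e - {p, l}" using between_chain[OF s, of e x e'] X e e' out by auto
  then have "card (beyond e') \<le> card (beyond e - {p, l})" using fin by (intro card_mono) auto
  also have "\<dots> = card (beyond e) - card {p, l}"
    using \<open>{p, l} \<subseteq> beyond e\<close> by (intro card_Diff_subset) auto
  finally show False using e' two adj_neq[OF pl(1)] by simp
qed

end

context balanced_root
begin

lemma depth_arms: "depth v' v = card opposite_arm + card (between s v)"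
  using arms_disjoint unfolding depth_via[OF v'(1) v_in s]
  by (simp add: opposite_arm_def Diff_triv Int_commute)

lemma card_outward_split: "card (outward x) = card opposite_arm + card (between s v) + card offshoots"
  if "x \<in> verts G"
proof -
  have "card (between s v) = 1 + card lower_arm" unfolding between_v(1) using between_v(2) by simp
  then show ?thesis using card_arms inj_arms card_outward[OF that] by (simp add: card_image)
qed

lemma isomorphic_path_if_no_offshoots:
  assumes "offshoots = {}"
  shows "isomorphic G (path_graph (card (verts G)))"
proof (rule isomorphic_path[OF v'(1) v_in])
  show "between v' v = outward v'"
    using depth_arms card_outward_split[OF v'(1)] assms
    by (intro card_subset_eq finite_outward between_subset_outward) simp
qed

text \<open>The single offshoot has weight \<open>1\<close>, so it ends in a leaf \<open>l\<close>. Both arms are without gaps; its other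
endpoint \<open>p\<close> is therefore not beyond any of their edges. Only the edge from \<open>s\<close> to \<open>u\<close> can still separate \<open>p\<close>
from \<open>s\<close>, so \<open>p\<close> has distance \<open>t - 1\<close> or \<open>t\<close> from \<open>v'\<close>.\<close>

lemma isomorphic_wishbone_if_tight:
  assumes n: "card (verts G) = 2 * t + 1" "0 < t"
    and A: "size_beyond ` lower_arm = {1..t - 1}" and B: "size_beyond ` opposite_arm = {1..t - 1}"
    and off: "(\<Sum>e\<in>offshoots. (weight e)\<^sup>2) = 1"
  shows "isomorphic G (wishbone (2 * t + 1))"
proof -
  have cards: "card lower_arm = t - 1" "card opposite_arm = t - 1"
    using card_image[OF inj_arms(1)] card_image[OF inj_arms(2)] unfolding A B by simp_all
  have "card offshoots = 1" using card_arms A B n by simp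
  then obtain e where "offshoots = {e}" by (rule card_1_singletonE)
  then obtain p l where R: "offshoots = {(p, l)}" by (cases e) simp
  then have "(p, l) \<in> offshoots" by simp
  then have pl: "(p, l) \<in> outward s" "v \<notin> beyond (p, l)" "v' \<notin> beyond (p, l)" "adj G p l"
    by (auto simp: offshoots_def between_def outward_def)
  have w: "weight (p, l) = 1" using off weight_pos[of "(p, l)"] pl R
    by (simp add: power2_eq_1_iff)
  have leaf: "beyond (p, l) = {l}"
  proof -
    have "card (beyond (p, l)) = 1" using w by (simp add: weight_def)
    then obtain a where "beyond (p, l) = {a}" by (rule card_1_singletonE)
    then show ?thesis using snd_in_beyond[of l p] by simp
  qed
  have full: "(p, l) \<notin> between v' v" "outward v' = insert (p, l) (between v' v)"
  proof -
    show *: "(p, l) \<notin> between v' v" using pl by (simp add: between_def)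
    have "insert (p, l) (between v' v) = outward v'"
    proof (rule card_subset_eq)
      show "insert (p, l) (between v' v) \<subseteq> outward v'"
        using between_subset_outward pl by (auto simp: outward_def)
      show "card (insert (p, l) (between v' v)) = card (outward v')"
        using * depth_arms card_outward_split[OF v'(1)] \<open>card offshoots = 1\<close> by simp
    qed simp
    then show "outward v' = insert (p, l) (between v' v)" by simp
  qed
  have p_in: "p \<in> verts G" using pl adj_in_verts by blast
  have lp: "(l, p) \<notin> outward s"
    using pl s beyond_flip[OF pl(4)] by (simp add: outward_def)
  have lp': "(p, l) \<notin> lower_arm" "(p, l) \<notin> opposite_arm"
    using outward_split_disjoint(3) R by auto
  have arms_outward: "lower_arm \<subseteq> outward s" "opposite_arm \<subseteq> outward s" using outward_split by auto
  have "p \<notin> beyond e" if "e \<in> lower_arm" for e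
    by (rule full_chain_avoids[OF s _ A pl(4) _ _ that]) (use lp lp' arms_outward lower_arm_def in blast)+
  moreover have "p \<notin> beyond e" if "e \<in> opposite_arm" for e
    by (rule full_chain_avoids[OF s _ B pl(4) _ _ that]) (use lp lp' arms_outward opposite_arm_def in blast)+
  moreover have "p \<notin> beyond (p, l)" using pl by simp
  ultimately have sp: "between s p \<subseteq> {(s, u)}"
    using between_subset_outward[of s p] unfolding outward_split R by (auto simp: between_def)
  have "(s, u) \<notin> opposite_arm" using outward_split_disjoint by auto
  with sp have "between s v' - between s p = opposite_arm" "between s p - between s v' = between s p"
    by (auto simp: opposite_arm_def)
  then have "depth v' p = t - 1 + card (between s p)"
    unfolding depth_via[OF v'(1) p_in s] using cards by simp
  moreover have "card (between s p) \<le> 1" using card_mono[OF _ sp] by simp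
  ultimately have "depth v' p = t \<or> depth v' p = t - 1" using n(2) by linarith
  then show ?thesis using isomorphic_wishbone[OF n v'(1) v_in pl(4) full(2,1) leaf] by blast
qed

end

section \<open>The star minimises\<close>

context nontrivial_tree
begin

lemma card_edges_real: "real (card (edges G)) = real_of_int m"
  using card_edges nontrivial by simp

lemma edge_number_pos: "0 < real_of_int m"
  using nontrivial by simp

lemma stationary_eq: "stationary G x = real (deg G x) / (2 * real_of_int m)"
  by (simp add: stationary_def card_edges_real)

lemma T_bestmix_le: "s \<in> verts G \<Longrightarrow> T_bestmix G \<le> access_time G s"
  unfolding T_bestmix_def by (intro Min_le) auto

lemma T_bestmix_attained: "\<exists>s\<in>verts G. T_bestmix G = access_time G s"
proof -
  have "access_time G ` verts G \<noteq> {}" using nontrivial by auto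
  then have "T_bestmix G \<in> access_time G ` verts G" unfolding T_bestmix_def by (intro Min_in) auto
  then show ?thesis by auto
qed

lemma T_bestmix_ge: "(\<And>s. s \<in> verts G \<Longrightarrow> b \<le> access_time G s) \<Longrightarrow> b \<le> T_bestmix G"
  using T_bestmix_attained by auto

lemma neighbors_subset_others: "neighbors G s \<subseteq> verts G - {s}"
  using neighbors_subset adj_neq by (auto simp: neighbors_def)

lemma deg_le: "s \<in> verts G \<Longrightarrow> int (deg G s) \<le> m"
proof -
  assume "s \<in> verts G"
  then have "deg G s \<le> card (verts G) - 1"
    unfolding deg_def using card_mono[OF _ neighbors_subset_others[of s]] by simp
  then show ?thesis using nontrivial by linarith
qed

text \<open>Weak duality for the indicator of \<open>s\<close>: at time \<open>0\<close> the rule stops with probability at most \<open>\<pi> s\<close>.\<close>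

lemma access_time_ge_stationary:
  assumes s: "s \<in> verts G"
  shows "ennreal (1 - stationary G s) \<le> access_time G s"
proof -
  define h where "h x = (if x = s then 1 else 0 :: real)" for x
  have "ennreal (h s - (\<Sum>x\<in>verts G. stationary G x * h x)) \<le> access_time G s"
  proof (rule access_time_ge_subsolution[OF s])
    fix x
    have "0 \<le> (\<Sum>y\<in>neighbors G x. h y) / real (deg G x)"
      by (intro divide_nonneg_nonneg sum_nonneg) (auto simp: h_def)
    moreover have "h x \<le> 1" by (simp add: h_def)
    ultimately show "h x \<le> 1 + (\<Sum>y\<in>neighbors G x. h y) / real (deg G x)" by linarith
  qed
  also have "(\<Sum>x\<in>verts G. stationary G x * h x) = stationary G s"
    using s by (simp add: h_def if_distrib[of "\<lambda>x. _ * x"] cong: if_cong)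
  finally show ?thesis by (simp add: h_def)
qed

lemma half_le_access_time:
  assumes s: "s \<in> verts G"
  shows "ennreal (1 / 2) \<le> access_time G s"
    and "access_time G s = ennreal (1 / 2) \<Longrightarrow> int (deg G s) = m"
proof -
  have d: "real (deg G s) \<le> real_of_int m" using deg_le[OF s] by linarith
  then have st: "stationary G s \<le> 1 / 2"
    unfolding stationary_eq using edge_number_pos by (simp add: divide_le_eq)
  then show "ennreal (1 / 2) \<le> access_time G s"
    by (intro order_trans[OF _ access_time_ge_stationary[OF s]] ennreal_leI) simp
  assume "access_time G s = ennreal (1 / 2)"
  with access_time_ge_stationary[OF s] have "ennreal (1 - stationary G s) \<le> ennreal (1 / 2)" by (simp only:)
  then have "1 - stationary G s \<le> 1 / 2" by (subst (asm) ennreal_le_iff) simp_all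
  then have "real_of_int m \<le> real (deg G s)"
    unfolding stationary_eq using edge_number_pos by (simp add: le_divide_eq)
  with d show "int (deg G s) = m" by linarith
qed

lemma full_degree_neighbors:
  assumes c: "c \<in> verts G" and d: "int (deg G c) = m"
  shows "neighbors G c = verts G - {c}" and "\<And>x y. adj G x y \<Longrightarrow> x = c \<or> y = c"
proof -
  show n: "neighbors G c = verts G - {c}"
  proof (rule card_subset_eq[OF _ neighbors_subset_others])
    have "int (card (verts G - {c})) = m" using c nontrivial by simp
    with d show "card (neighbors G c) = card (verts G - {c})" by (simp add: deg_def)
  qed simp
  fix x y assume xy: "adj G x y"
  show "x = c \<or> y = c"
  proof (rule ccontr)
    (* an edge avoiding c would close a triangle *)
    assume "\<not> (x = c \<or> y = c)"
    then have "x \<in> neighbors G c" "y \<in> neighbors G c" using n adj_in_verts[OF xy] by auto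
    then have "cycle G [c, x, y]"
      using xy adj_neq adj_sym[of y c] by (auto simp: cycle_def neighbors_def)
    then show False using tree by (simp add: tree_def)
  qed
qed

text \<open>From the centre of a star, stopping at once with probability \<open>1 / 2\<close> and after one step otherwise is
optimal; the potential is the indicator of the centre.\<close>

lemma access_time_full_degree:
  assumes c: "c \<in> verts G" and d: "int (deg G c) = m"
  shows "access_time G c \<le> ennreal (1 / 2)"
proof -
  note star = full_degree_neighbors[OF assms]
  define Y where "Y v = (if v = c then 1 else 0 :: real)" for v
  have dc: "real (deg G c) = real_of_int m" using d by linarith
  have "access_time G c \<le> ennreal (\<Sum>v\<in>verts G. stationary G v * Y v)"
  proof (rule access_time_le_potential[OF c])
    fix v assume v: "v \<in> verts G"
    show "0 \<le> Y v" by (simp add: Y_def)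
    show "(\<Sum>u\<in>neighbors G v. Y u) + (if v = c then 2 * real (card (edges G)) else 0)
        = real (deg G v) * (1 + Y v)"
    proof (cases "v = c")
      case True
      have "(\<Sum>u\<in>neighbors G c. Y u) = 0" unfolding star(1) by (simp add: Y_def)
      then show ?thesis using True dc card_edges_real by (simp add: Y_def)
    next
      case False
      have "v \<in> neighbors G c" unfolding star(1) using v False by simp
      then have "adj G v c" using adj_sym[of v c] by (simp add: neighbors_def)
      moreover have "u = c" if "adj G v u" for u using star(2)[OF that] False by simp
      ultimately have "neighbors G v = {c}" unfolding neighbors_def by blast
      then show ?thesis using False by (simp add: Y_def deg_def)
    qed
  qed
  also have "(\<Sum>v\<in>verts G. stationary G v * Y v) = 1 / 2"
  proof -
    have "(\<Sum>v\<in>verts G. stationary G v * Y v) = (\<Sum>v\<in>verts G. if v = c then stationary G v else 0)"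
      by (intro sum.cong) (auto simp: Y_def)
    also have "\<dots> = stationary G c" using c by simp
    finally show ?thesis unfolding stationary_eq dc using edge_number_pos by simp
  qed
  finally show ?thesis .
qed

lemma T_bestmix_eq_half_iff:
  "T_bestmix G = ennreal (1 / 2) \<longleftrightarrow> (\<exists>c\<in>verts G. int (deg G c) = m)"
proof
  assume "T_bestmix G = ennreal (1 / 2)"
  with T_bestmix_attained show "\<exists>c\<in>verts G. int (deg G c) = m"
    using half_le_access_time(2) by metis
next
  assume "\<exists>c\<in>verts G. int (deg G c) = m"
  then obtain c where c: "c \<in> verts G" "int (deg G c) = m" by blast
  have "T_bestmix G \<le> ennreal (1 / 2)"
    using T_bestmix_le[OF c(1)] access_time_full_degree[OF c] by (rule order_trans)
  with T_bestmix_ge[OF half_le_access_time(1)] show "T_bestmix G = ennreal (1 / 2)"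
    by (intro antisym)
qed

lemma isomorphic_star_iff:
  "isomorphic G (star_graph (card (verts G))) \<longleftrightarrow> (\<exists>c\<in>verts G. int (deg G c) = m)"
proof
  let ?n = "card (verts G)"
  assume "isomorphic G (star_graph ?n)"
  then obtain f where f: "bij_betw f (verts G) {0..<?n}"
    "\<And>u v. u \<in> verts G \<Longrightarrow> v \<in> verts G \<Longrightarrow> adj G u v \<longleftrightarrow> adj (star_graph ?n) (f u) (f v)"
    by (auto simp: isomorphic_def)
  have "0 \<in> f ` verts G" using f(1) nontrivial by (simp add: bij_betw_def)
  then obtain c where c: "c \<in> verts G" "f c = 0" by auto
  have "adj G c v" if "v \<in> verts G - {c}" for v
  proof -
    have "f v \<noteq> 0"
      using that c inj_onD[OF bij_betw_imp_inj_on[OF f(1)], of v c] by auto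
    moreover have "f v < ?n" using that bij_betwE[OF f(1)] by auto
    ultimately show ?thesis using that c f(2)[of c v] by (simp add: adj_star)
  qed
  then have "neighbors G c = verts G - {c}" using neighbors_subset_others by (auto simp: neighbors_def)
  then have "int (deg G c) = m" using c nontrivial by (simp add: deg_def)
  with c show "\<exists>c\<in>verts G. int (deg G c) = m" by blast
next
  let ?n = "card (verts G)"
  assume "\<exists>c\<in>verts G. int (deg G c) = m"
  then obtain c where c: "c \<in> verts G" "int (deg G c) = m" by blast
  have "card (verts G - {c}) = card {1..<?n}" using c by simp
  then obtain g where g: "bij_betw g (verts G - {c}) {1..<?n}"
    using finite_same_card_bij[of "verts G - {c}" "{1..<?n}"] by auto
  define f where "f v = (if v = c then 0 else g v)" for v
  have "bij_betw f (verts G - {c}) {1..<?n}"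
  proof -
    have "bij_betw f (verts G - {c}) {1..<?n} \<longleftrightarrow> bij_betw g (verts G - {c}) {1..<?n}"
      by (rule bij_betw_cong) (simp add: f_def)
    with g show ?thesis by simp
  qed
  moreover have "bij_betw f {c} {0}" by (simp add: f_def)
  ultimately have "bij_betw f ((verts G - {c}) \<union> {c}) ({1..<?n} \<union> {0})"
    by (rule bij_betw_combine) simp
  moreover have "(verts G - {c}) \<union> {c} = verts G" using c by auto
  moreover have "{1..<?n} \<union> {0} = {0..<?n}" using nontrivial by auto
  ultimately have f: "bij_betw f (verts G) {0..<?n}" by simp
  show "isomorphic G (star_graph ?n)"
  proof (rule isomorphic_if_edge_preserving)
    show "tree (star_graph ?n)" using nontrivial by (intro tree_star) simp
    show "bij_betw f (verts G) (verts (star_graph ?n))" using f by simp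
    fix x y assume xy: "adj G x y"
    have r: "f z < ?n" if "z \<in> verts G" for z using bij_betwE[OF f] that by auto
    have p: "0 < f z" if "z \<in> verts G" "z \<noteq> c" for z
    proof -
      have "g z \<in> {1..<?n}" using bij_betwE[OF g] that by blast
      then show ?thesis using that by (simp add: f_def)
    qed
    have "f c = 0" by (simp add: f_def)
    then show "adj (star_graph ?n) (f x) (f y)"
      using full_degree_neighbors(2)[OF c xy] adj_in_verts[OF xy] adj_neq[OF xy]
        r[of x] r[of y] p[of x] p[of y]
      unfolding adj_star by auto
  qed
qed

section \<open>Lower bounds for the path and the wishbone\<close>

text \<open>Weak duality with the test function pulled back along a numbering of the vertices. The graph enters
only through the neighbour sets \<open>nb\<close> of the numbers. This also allows numberings that are not
isomorphisms to the graphs of the theorem, such as a wishbone read from its other end.\<close>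

lemma access_time_ge_relabel:
  fixes \<phi> :: "'a \<Rightarrow> nat" and h :: "nat \<Rightarrow> real"
  assumes bij: "bij_betw \<phi> (verts G) N"
    and nb: "\<And>x. x \<in> verts G \<Longrightarrow> \<phi> ` neighbors G x = nb (\<phi> x)"
    and sub: "\<And>i. i \<in> N \<Longrightarrow> real (card (nb i)) * h i \<le> real (card (nb i)) + (\<Sum>j\<in>nb i. h j)"
    and s: "s \<in> verts G"
  shows "ennreal (h (\<phi> s) - (\<Sum>i\<in>N. real (card (nb i)) * h i) / (2 * real_of_int m)) \<le> access_time G s"
proof -
  have inj: "inj_on \<phi> (verts G)" using bij by (rule bij_betw_imp_inj_on)
  have inj': "inj_on \<phi> (neighbors G x)" for x
    using inj neighbors_subset by (rule inj_on_subset)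
  have deg: "deg G x = card (nb (\<phi> x))" if "x \<in> verts G" for x
    unfolding nb[OF that, symmetric] deg_def using inj' by (simp add: card_image)
  have sum: "(\<Sum>y\<in>neighbors G x. h (\<phi> y)) = (\<Sum>j\<in>nb (\<phi> x). h j)" if "x \<in> verts G" for x
    unfolding nb[OF that, symmetric] using inj' by (simp add: sum.reindex)
  have "ennreal (h (\<phi> s) - (\<Sum>x\<in>verts G. stationary G x * h (\<phi> x))) \<le> access_time G s"
  proof (rule access_time_ge_subsolution[OF s, of "\<lambda>x. h (\<phi> x)"])
    fix x assume x: "x \<in> verts G"
    then have "\<phi> x \<in> N" using bij by (auto simp: bij_betw_def)
    from sub[OF this] deg_pos[OF x]
    show "h (\<phi> x) \<le> 1 + (\<Sum>y\<in>neighbors G x. h (\<phi> y)) / real (deg G x)"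
      unfolding sum[OF x] deg[OF x] by (simp add: field_simps)
  qed
  also have "(\<Sum>x\<in>verts G. stationary G x * h (\<phi> x))
      = (\<Sum>x\<in>verts G. real (card (nb (\<phi> x))) * h (\<phi> x)) / (2 * real_of_int m)"
    unfolding sum_divide_distrib using deg by (intro sum.cong) (auto simp: stationary_eq)
  also have "(\<Sum>x\<in>verts G. real (card (nb (\<phi> x))) * h (\<phi> x)) = (\<Sum>i\<in>N. real (card (nb i)) * h i)"
    using sum.reindex_bij_betw[OF bij, of "\<lambda>i. real (card (nb i)) * h i"] by simp
  finally show ?thesis .
qed

end

lemma isomorphic_neighbors:
  assumes G: "simple_graph G" and H: "simple_graph H" and bij: "bij_betw f (verts G) (verts H)"
    and iff: "\<And>u v. u \<in> verts G \<Longrightarrow> v \<in> verts G \<Longrightarrow> adj G u v \<longleftrightarrow> adj H (f u) (f v)"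
    and x: "x \<in> verts G"
  shows "f ` neighbors G x = neighbors H (f x)"
proof -
  have "neighbors G x = {y \<in> verts G. adj G x y}" "neighbors H (f x) = {y \<in> verts H. adj H (f x) y}"
    using G H by (auto simp: neighbors_def adj_def simple_graph_def)
  moreover have "f ` {y \<in> verts G. adj G x y} = {y \<in> f ` verts G. adj H (f x) y}"
    using iff[OF x] by auto
  moreover have "f ` verts G = verts H" using bij by (simp add: bij_betw_def)
  ultimately show ?thesis by simp
qed

definition path_nb :: "nat \<Rightarrow> nat \<Rightarrow> nat set" where
  "path_nb k i = (if i = 0 then {1} else if i = k then {k - 1} else {i - 1, i + 1})"

lemma neighbors_path: "i \<le> k \<Longrightarrow> 0 < k \<Longrightarrow> neighbors (path_graph (k + 1)) i = path_nb k i"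
  by (auto simp: neighbors_def adj_path path_nb_def)

lemma reflect_path_nb: "i \<le> k \<Longrightarrow> 0 < k \<Longrightarrow> (\<lambda>x. k - x) ` path_nb k i = path_nb k (k - i)"
  by (auto simp: path_nb_def)

lemma sum_hitting_path: "6 * (\<Sum>i<k. real i * (c - real i))
    = 3 * c * real k * (real k - 1) - (real k - 1) * real k * (2 * real k - 1)"
  by (induction k) (auto simp: algebra_simps)

lemma sum_path_nb:
  assumes "0 < k"
  shows "(\<Sum>i\<in>{0..<k + 1}. real (card (path_nb k i)) * h i) = 2 * (\<Sum>i<k. h i) - h 0 + h k"
proof -
  have "(\<Sum>i\<in>{0..<k + 1}. real (card (path_nb k i)) * h i)
      = (\<Sum>i<k. real (card (path_nb k i)) * h i) + h k"
    using assms by (simp add: path_nb_def atLeast0LessThan)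
  also have "(\<Sum>i<k. real (card (path_nb k i)) * h i) = (\<Sum>i<k. 2 * h i - (if i = 0 then h 0 else 0))"
    by (intro sum.cong refl) (auto simp: path_nb_def card_insert_if)
  also have "\<dots> = 2 * (\<Sum>i<k. h i) - h 0" using assms by (simp add: sum_subtractf sum_distrib_left)
  finally show ?thesis by simp
qed

context nontrivial_tree
begin

text \<open>The test function is the hitting time of the end \<open>0\<close>. It increases along the path, so the bound is
weakest at \<open>t + 1\<close>, the central vertex that is farther from \<open>0\<close>.\<close>

lemma access_time_ge_path:
  assumes n: "card (verts G) = 2 * t + 2" and bij: "bij_betw \<phi> (verts G) {0..<2 * t + 2}"
    and nb: "\<And>x. x \<in> verts G \<Longrightarrow> \<phi> ` neighbors G x = path_nb (2 * t + 1) (\<phi> x)"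
    and s: "s \<in> verts G" "t + 1 \<le> \<phi> s"
  shows "ennreal ((2 * (real t)\<^sup>2 + 8 * real t + 3) / 6) \<le> access_time G s"
proof -
  let ?k = "2 * t + 1"
  define h where "h i = real i * (2 * real ?k - real i)" for i :: nat
  have m: "real_of_int m = real ?k" using n by simp
  have "\<phi> s < 2 * t + 2" using bij s by (auto simp: bij_betw_def)
  then have "0 \<le> (real (\<phi> s) - (real t + 1)) * (2 * real ?k - real (\<phi> s) - (real t + 1))"
    using s(2) by (intro mult_nonneg_nonneg) auto
  then have hs: "(real t + 1) * (3 * real t + 1) \<le> h (\<phi> s)" by (simp add: h_def algebra_simps)
  have "ennreal (h (\<phi> s) - (\<Sum>i\<in>{0..<2 * t + 2}. real (card (path_nb ?k i)) * h i) / (2 * real_of_int m))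
      \<le> access_time G s"
  proof (rule access_time_ge_relabel[OF bij nb _ s(1)])
    fix i assume i: "i \<in> {0..<2 * t + 2}"
    consider "i = 0" | "i = ?k" | "0 < i" "i < ?k" using i by fastforce
    then show "real (card (path_nb ?k i)) * h i \<le> real (card (path_nb ?k i)) + (\<Sum>j\<in>path_nb ?k i. h j)"
    proof cases
      case 3
      then obtain i' where "i = Suc i'" by (cases i) auto
      with 3 show ?thesis by (simp add: path_nb_def h_def algebra_simps)
    qed (auto simp: path_nb_def h_def algebra_simps)
  qed
  moreover have "(2 * (real t)\<^sup>2 + 8 * real t + 3) / 6
      \<le> h (\<phi> s) - (\<Sum>i\<in>{0..<2 * t + 2}. real (card (path_nb ?k i)) * h i) / (2 * real_of_int m)"
  proof -
    have "(\<Sum>i\<in>{0..<2 * t + 2}. real (card (path_nb ?k i)) * h i) = 2 * (\<Sum>i<?k. h i) - h 0 + h ?k"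
      using sum_path_nb[of ?k h] by simp
    also have "\<dots> = 2 * real ?k * ((4 * (real ?k)\<^sup>2 - 1) / 6)"
      using sum_hitting_path[of "2 * real ?k" ?k]
      by (simp add: h_def power2_eq_square algebra_simps)
    finally have "(\<Sum>i\<in>{0..<2 * t + 2}. real (card (path_nb ?k i)) * h i) / (2 * real_of_int m)
        = (4 * (real ?k)\<^sup>2 - 1) / 6"
      unfolding m by simp
    note stationary_mean = this
    show ?thesis unfolding stationary_mean using hs by (simp add: power2_eq_square field_simps)
  qed
  ultimately show ?thesis by (meson ennreal_leI order_trans)
qed

text \<open>By reflection, the starting vertex may be assumed to lie in the half away from \<open>0\<close>.\<close>

lemma T_bestmix_ge_path:
  assumes n: "card (verts G) = 2 * t + 2" and iso: "isomorphic G (path_graph (2 * t + 2))"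
  shows "ennreal ((2 * (real t)\<^sup>2 + 8 * real t + 3) / 6) \<le> T_bestmix G"
proof (rule T_bestmix_ge)
  let ?k = "2 * t + 1"
  fix s assume s: "s \<in> verts G"
  from iso obtain f where f: "bij_betw f (verts G) (verts (path_graph (2 * t + 2)))"
    "\<And>u v. u \<in> verts G \<Longrightarrow> v \<in> verts G \<Longrightarrow> adj G u v \<longleftrightarrow> adj (path_graph (2 * t + 2)) (f u) (f v)"
    unfolding isomorphic_def by blast
  have range: "f x \<le> ?k" if "x \<in> verts G" for x
    using bij_betwE[OF f(1)] that by fastforce
  have nb: "f ` neighbors G x = path_nb ?k (f x)" if "x \<in> verts G" for x
    using isomorphic_neighbors[OF simple simple_path f that] neighbors_path[OF range[OF that]] by simp
  show "ennreal ((2 * (real t)\<^sup>2 + 8 * real t + 3) / 6) \<le> access_time G s"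
  proof (cases "t + 1 \<le> f s")
    case True
    show ?thesis by (rule access_time_ge_path[OF n _ nb s True]) (use f in auto)
  next
    case False
    define g where "g x = ?k - f x" for x
    have "bij_betw (\<lambda>x. ?k - x) {0..<2 * t + 2} {0..<2 * t + 2}"
      by (rule bij_betw_byWitness[of _ "\<lambda>x. ?k - x"]) auto
    from bij_betw_trans[OF f(1)[unfolded verts_path] this]
    have g: "bij_betw g (verts G) {0..<2 * t + 2}"
      by (simp add: g_def[abs_def] comp_def)
    have "g ` neighbors G x = path_nb ?k (g x)" if "x \<in> verts G" for x
    proof -
      have "g ` neighbors G x = (\<lambda>x. ?k - x) ` f ` neighbors G x" by (simp add: g_def image_image)
      then show ?thesis unfolding nb[OF that] using reflect_path_nb[OF range[OF that]] by (simp add: g_def)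
    qed
    moreover have "t + 1 \<le> g s" using False by (simp add: g_def)
    ultimately show ?thesis by (intro access_time_ge_path[OF n g _ s]) auto
  qed
qed

end

text \<open>Neighbour sets in the path on \<open>0, \<dots>, 2 t - 1\<close> with a leaf \<open>2 t\<close> attached at \<open>j\<close>. For \<open>j = t\<close> this is
the wishbone, for \<open>j = t - 1\<close> its reflection.\<close>

definition spider_nb :: "nat \<Rightarrow> nat \<Rightarrow> nat \<Rightarrow> nat set" where
  "spider_nb t j i = (if i = 2 * t then {j}
     else path_nb (2 * t - 1) i \<union> (if i = j then {2 * t} else {}))"

lemma neighbors_wishbone:
  assumes "2 \<le> t" "i \<le> 2 * t"
  shows "neighbors (wishbone (2 * t + 1)) i = spider_nb t t i"
proof -
  have eq: "neighbors (wishbone (2 * t + 1)) i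
      = neighbors (path_graph (2 * t)) i \<union> {y. {i, y} = {t, 2 * t}}"
    by (auto simp: neighbors_def adj_wishbone)
  show ?thesis
  proof (cases "i = 2 * t")
    case True
    then have "neighbors (path_graph (2 * t)) i = {}" by (auto simp: neighbors_def adj_path)
    moreover have "{y. {i, y} = {t, 2 * t}} = {t}" using True assms by (auto simp: doubleton_eq_iff)
    ultimately show ?thesis using True eq by (simp add: spider_nb_def)
  next
    case False
    then have "neighbors (path_graph (2 * t)) i = path_nb (2 * t - 1) i"
      using neighbors_path[of i "2 * t - 1"] assms by simp
    moreover have "{y. {i, y} = {t, 2 * t}} = (if i = t then {2 * t} else {})"
      using False by (auto simp: doubleton_eq_iff)
    ultimately show ?thesis using False eq by (simp add: spider_nb_def)
  qed
qed

definition spider_flip :: "nat \<Rightarrow> nat \<Rightarrow> nat" where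
  "spider_flip t i = (if i = 2 * t then 2 * t else 2 * t - 1 - i)"

lemma path_nb_range: "i \<le> k \<Longrightarrow> 0 < k \<Longrightarrow> path_nb k i \<subseteq> {0..k}"
  by (auto simp: path_nb_def)

lemma flip_spider_nb:
  assumes "2 \<le> t" "i \<le> 2 * t"
  shows "spider_flip t ` spider_nb t t i = spider_nb t (t - 1) (spider_flip t i)"
proof (cases "i = 2 * t")
  case True
  then show ?thesis using assms by (simp add: spider_nb_def spider_flip_def)
next
  case False
  have "path_nb (2 * t - 1) i \<subseteq> {0..2 * t - 1}"
    using False assms by (intro path_nb_range) auto
  moreover have "2 * t \<notin> {0..2 * t - 1}" using assms by auto
  ultimately have "2 * t \<notin> path_nb (2 * t - 1) i" by blast
  then have "spider_flip t ` path_nb (2 * t - 1) i = (\<lambda>x. 2 * t - 1 - x) ` path_nb (2 * t - 1) i"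
    by (intro image_cong) (auto simp: spider_flip_def)
  also have "\<dots> = path_nb (2 * t - 1) (2 * t - 1 - i)"
    using False assms by (intro reflect_path_nb) auto
  finally have "spider_flip t ` path_nb (2 * t - 1) i = path_nb (2 * t - 1) (2 * t - 1 - i)" .
  moreover have "i = t \<longleftrightarrow> 2 * t - 1 - i = t - 1" using False assms by auto
  moreover have "2 * t - 1 - i \<noteq> 2 * t" using assms by auto
  ultimately show ?thesis
    using False assms by (simp add: spider_nb_def image_Un spider_flip_def[of t i] spider_flip_def[of t "2 * t"])
qed

lemma sum_ramp: "j \<le> k \<Longrightarrow> 2 * (\<Sum>i<k. real (i - j)) = (real k - real j) * (real k - real j - 1)"
proof (induction k rule: dec_induct)
  case base
  have "(\<Sum>i<j. real (i - j)) = 0" by (intro sum.neutral) auto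
  then show ?case by simp
next
  case (step k)
  then show ?case by (simp add: of_nat_diff algebra_simps)
qed

lemma sum_spider_nb:
  assumes "2 \<le> t" "j < 2 * t"
  shows "(\<Sum>i\<in>{0..<2 * t + 1}. real (card (spider_nb t j i)) * h i)
       = 2 * (\<Sum>i<2 * t - 1. h i) - h 0 + h (2 * t - 1) + h j + h (2 * t)"
proof -
  have "(\<Sum>i\<in>{0..<2 * t + 1}. real (card (spider_nb t j i)) * h i)
      = (\<Sum>i\<in>{0..<2 * t}. real (card (spider_nb t j i)) * h i) + h (2 * t)"
    by (simp add: spider_nb_def)
  also have "(\<Sum>i\<in>{0..<2 * t}. real (card (spider_nb t j i)) * h i)
      = (\<Sum>i\<in>{0..<2 * t}. real (card (path_nb (2 * t - 1) i)) * h i + (if i = j then h j else 0))"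
  proof (intro sum.cong refl)
    fix i assume i: "i \<in> {0..<2 * t}"
    then have "2 * t \<notin> path_nb (2 * t - 1) i" "finite (path_nb (2 * t - 1) i)"
      using path_nb_range[of i "2 * t - 1"] assms by (auto simp: path_nb_def)
    then show "real (card (spider_nb t j i)) * h i
        = real (card (path_nb (2 * t - 1) i)) * h i + (if i = j then h j else 0)"
      using i by (auto simp: spider_nb_def algebra_simps)
  qed
  also have "\<dots> = (\<Sum>i\<in>{0..<2 * t}. real (card (path_nb (2 * t - 1) i)) * h i) + h j"
    using assms by (simp add: sum.distrib)
  also have "(\<Sum>i\<in>{0..<2 * t}. real (card (path_nb (2 * t - 1) i)) * h i)
      = 2 * (\<Sum>i<2 * t - 1. h i) - h 0 + h (2 * t - 1)"
    using sum_path_nb[of "2 * t - 1" h] assms by simp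
  finally show ?thesis by simp
qed

context nontrivial_tree
begin

text \<open>The test function is the hitting time of the end \<open>0\<close>: as on a path with \<open>2 t + 1\<close> vertices up to \<open>j\<close>,
and smaller by \<open>2\<close> for each further step, because the leaf is no longer ahead. On the leaf it is one
more than at \<open>j\<close>. For \<open>j = t - 1\<close> the leaf is too close to \<open>0\<close> for the bound, which is why it is
excluded as a starting vertex.\<close>

lemma access_time_ge_spider:
  assumes n: "card (verts G) = 2 * t + 1" and t: "2 \<le> t" and j: "j = t \<or> j = t - 1"
    and bij: "bij_betw \<phi> (verts G) {0..<2 * t + 1}"
    and nb: "\<And>x. x \<in> verts G \<Longrightarrow> \<phi> ` neighbors G x = spider_nb t j (\<phi> x)"
    and s: "s \<in> verts G" "t \<le> \<phi> s" "\<phi> s = 2 * t \<Longrightarrow> j = t"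
  shows "ennreal ((2 * (real t)\<^sup>2 + 6 * real t - 5) / 6) \<le> access_time G s"
proof -
  define T where "T = real t"
  define J where "J = real j"
  have J: "J = T \<or> J = T - 1" using j t by (auto simp: J_def T_def of_nat_diff)
  have T: "2 \<le> T" using t by (simp add: T_def)
  have j': "1 \<le> j" "j < 2 * t - 1" using j t by auto
  define h where "h i = (if i = 2 * t then J * (4 * T - J) + 1
      else real i * (4 * T - real i) - 2 * real (i - j))" for i :: nat
  have h_path: "h i = real i * (4 * T - real i) - 2 * real (i - j)" if "i < 2 * t" for i
    using that by (simp add: h_def)
  have m: "real_of_int m = 2 * T" using n by (simp add: T_def)
  have hs: "3 * T\<^sup>2 - 2 * (T - J) \<le> h (\<phi> s)"
  proof (cases "\<phi> s = 2 * t")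
    case True
    then have "J = T" using s(3) by (simp add: J_def T_def)
    then show ?thesis using True by (simp add: h_def power2_eq_square)
  next
    case False
    have r: "\<phi> s < 2 * t" using False bij_betwE[OF bij] s(1) by fastforce
    then have "0 \<le> (real (\<phi> s) - T) * (3 * T - real (\<phi> s) - 2)"
      using s(2) T by (intro mult_nonneg_nonneg) (auto simp: T_def)
    moreover have "real (\<phi> s - j) = real (\<phi> s) - J" using j s(2) by (auto simp: J_def of_nat_diff)
    ultimately show ?thesis using False by (simp add: h_def power2_eq_square algebra_simps)
  qed
  have "ennreal (h (\<phi> s) - (\<Sum>i\<in>{0..<2 * t + 1}. real (card (spider_nb t j i)) * h i) / (2 * real_of_int m))
      \<le> access_time G s"
  proof (rule access_time_ge_relabel[OF bij nb _ s(1)])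
    fix i assume i: "i \<in> {0..<2 * t + 1}"
    consider "i = 2 * t" | "i = 0" | "i = 2 * t - 1" | "0 < i" "i < 2 * t - 1" "i \<noteq> j" | "i = j"
      using i by fastforce
    then show "real (card (spider_nb t j i)) * h i \<le> real (card (spider_nb t j i)) + (\<Sum>j\<in>spider_nb t j i. h j)"
    proof cases
      case 1
      then show ?thesis using j' by (simp add: spider_nb_def h_def J_def)
    next
      case 2
      then have "spider_nb t j i = {1}" using j' t by (simp add: spider_nb_def path_nb_def)
      moreover have "h 0 = 0" "0 \<le> h 1" using t T j' by (simp_all add: h_def)
      ultimately show ?thesis using 2 by simp
    next
      case 3
      then have "spider_nb t j i = {2 * t - 2}"
        using j' t unfolding spider_nb_def path_nb_def by auto
      moreover have "h (2 * t - 1) \<le> 1 + h (2 * t - 2)"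
      proof -
        have "real (2 * t - 1) = 2 * T - 1" "real (2 * t - 2) = 2 * T - 2"
          "real (2 * t - 1 - j) = 2 * T - 1 - J" "real (2 * t - 2 - j) = 2 * T - 2 - J"
          using j' t by (simp_all add: T_def J_def of_nat_diff)
        then show ?thesis
          using h_path[of "2 * t - 1"] h_path[of "2 * t - 2"] t by (simp add: algebra_simps)
      qed
      ultimately show ?thesis using 3 by simp
    next
      case 4
      then have "spider_nb t j i = {i - 1, i + 1}" by (simp add: spider_nb_def path_nb_def)
      moreover have "2 * h i \<le> 2 + (h (i - 1) + h (i + 1))"
      proof -
        obtain i' where i': "i = Suc i'" using 4 by (cases i) auto
        have "i - 1 < 2 * t" "i < 2 * t" "i + 1 < 2 * t" using 4 by auto
        note hp = this[THEN h_path]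
        show ?thesis
        proof (cases "i < j")
          case True
          then show ?thesis unfolding hp unfolding i' by (simp add: algebra_simps)
        next
          case False
          then have "j \<le> i'" using 4 i' by simp
          then show ?thesis unfolding hp unfolding i' by (simp add: of_nat_diff algebra_simps)
        qed
      qed
      ultimately show ?thesis by simp
    next
      case 5
      then have "spider_nb t j i = {j - 1, j + 1, 2 * t}"
        using j' by (auto simp: spider_nb_def path_nb_def)
      moreover have "3 * h j \<le> 3 + (h (j - 1) + (h (j + 1) + h (2 * t)))"
      proof -
        obtain i' where i': "j = Suc i'" using j' by (cases j) auto
        have "j - 1 < 2 * t" "j < 2 * t" "j + 1 < 2 * t" using j' by auto
        note hp = this[THEN h_path]
        have "h (2 * t) = J * (4 * T - J) + 1" by (simp add: h_def)
        then show ?thesis unfolding hp J_def unfolding i' by (simp add: algebra_simps)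
      qed
      moreover have "j - 1 \<noteq> j + 1" "j - 1 \<noteq> 2 * t" "j + 1 \<noteq> 2 * t" using j' by auto
      then have "card {j - 1, j + 1, 2 * t} = 3"
        "(\<Sum>i\<in>{j - 1, j + 1, 2 * t}. h i) = h (j - 1) + (h (j + 1) + h (2 * t))"
        by simp_all
      ultimately show ?thesis using 5 by (simp only: of_nat_numeral)
    qed
  qed
  moreover have "(2 * (real t)\<^sup>2 + 6 * real t - 5) / 6
      \<le> h (\<phi> s) - (\<Sum>i\<in>{0..<2 * t + 1}. real (card (spider_nb t j i)) * h i) / (2 * real_of_int m)"
  proof -
    (* the linear combination of the following eight equations that eliminates the sums *)
    have collect: "6 * q = 2 * a - 12 * b + 6 * x + 6 * y + 6 * z"
      if "\<sigma> = p - 2 * r" "6 * p = a" "2 * r = b" "h0 = 0" "hx = x" "hy = y" "hz = z"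
        "q = 2 * \<sigma> - h0 + hx + hy + hz"
      for q a b x y z \<sigma> p r h0 hx hy hz :: real
      using that by simp
    have k: "real (2 * t - 1) = 2 * T - 1" using t by (simp add: T_def of_nat_diff)
    have "(\<Sum>i<2 * t - 1. h i)
        = (\<Sum>i<2 * t - 1. real i * (4 * T - real i)) - 2 * (\<Sum>i<2 * t - 1. real (i - j))"
      unfolding sum_distrib_left sum_subtractf[symmetric] by (intro sum.cong) (auto simp: h_def)
    moreover have "6 * (\<Sum>i<2 * t - 1. real i * (4 * T - real i))
        = 3 * (4 * T) * (2 * T - 1) * (2 * T - 1 - 1) - (2 * T - 1 - 1) * (2 * T - 1) * (2 * (2 * T - 1) - 1)"
      using sum_hitting_path[of "4 * T" "2 * t - 1"] unfolding k .
    moreover have "2 * (\<Sum>i<2 * t - 1. real (i - j)) = (2 * T - 1 - J) * (2 * T - 1 - J - 1)"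
      using sum_ramp[of j "2 * t - 1"] j' unfolding k J_def by simp
    moreover have "h 0 = 0" using t by (simp add: h_def)
    moreover have "h (2 * t - 1) = (2 * T - 1) * (2 * T + 1) - 2 * (2 * T - 1 - J)"
    proof -
      have "real (2 * t - 1 - j) = 2 * T - 1 - J"
        using j' t by (simp add: T_def J_def of_nat_diff)
      then show ?thesis using h_path[of "2 * t - 1"] t unfolding k by simp
    qed
    moreover have "h j = J * (4 * T - J)" using j' by (simp add: h_def J_def)
    moreover have "h (2 * t) = J * (4 * T - J) + 1" by (simp add: h_def)
    moreover have "(\<Sum>i\<in>{0..<2 * t + 1}. real (card (spider_nb t j i)) * h i)
        = 2 * (\<Sum>i<2 * t - 1. h i) - h 0 + h (2 * t - 1) + h j + h (2 * t)"
      using j' by (intro sum_spider_nb[OF t]) simp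
    ultimately have "6 * (\<Sum>i\<in>{0..<2 * t + 1}. real (card (spider_nb t j i)) * h i)
        = 2 * (3 * (4 * T) * (2 * T - 1) * (2 * T - 1 - 1) - (2 * T - 1 - 1) * (2 * T - 1) * (2 * (2 * T - 1) - 1))
          - 12 * ((2 * T - 1 - J) * (2 * T - 1 - J - 1))
          + 6 * ((2 * T - 1) * (2 * T + 1) - 2 * (2 * T - 1 - J)) + 6 * (J * (4 * T - J))
          + 6 * (J * (4 * T - J) + 1)"
      by (rule collect)
    also have "\<dots> = 4 * T * (6 * (3 * T\<^sup>2 - 2 * (T - J)) - (2 * T\<^sup>2 + 6 * T - 5))"
    proof (cases "J = T")
      case True
      show ?thesis unfolding True by (simp add: power2_eq_square algebra_simps)
    next
      case False
      with J have "J = T - 1" by simp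
      then show ?thesis by (simp only:) (simp add: power2_eq_square algebra_simps)
    qed
    finally have "6 * (\<Sum>i\<in>{0..<2 * t + 1}. real (card (spider_nb t j i)) * h i)
        = 4 * T * (6 * (3 * T\<^sup>2 - 2 * (T - J)) - (2 * T\<^sup>2 + 6 * T - 5))" .
    then have "(\<Sum>i\<in>{0..<2 * t + 1}. real (card (spider_nb t j i)) * h i) / (2 * real_of_int m)
        = (6 * (3 * T\<^sup>2 - 2 * (T - J)) - (2 * T\<^sup>2 + 6 * T - 5)) / 6"
      unfolding m using T by (simp add: field_simps)
    note stationary_mean = this
    show ?thesis unfolding stationary_mean T_def[symmetric] using hs by (simp add: field_simps)
  qed
  ultimately show ?thesis by (meson ennreal_leI order_trans)
qed

lemma T_bestmix_ge_wishbone: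
  assumes n: "card (verts G) = 2 * t + 1" and t: "2 \<le> t"
    and iso: "isomorphic G (wishbone (2 * t + 1))"
  shows "ennreal ((2 * (real t)\<^sup>2 + 6 * real t - 5) / 6) \<le> T_bestmix G"
proof (rule T_bestmix_ge)
  fix s assume s: "s \<in> verts G"
  from iso obtain f where f: "bij_betw f (verts G) (verts (wishbone (2 * t + 1)))"
    "\<And>u v. u \<in> verts G \<Longrightarrow> v \<in> verts G \<Longrightarrow> adj G u v \<longleftrightarrow> adj (wishbone (2 * t + 1)) (f u) (f v)"
    unfolding isomorphic_def by blast
  have wv: "verts (wishbone (2 * t + 1)) = {0..<2 * t + 1}" by (simp add: verts_wishbone)
  have range: "f x \<le> 2 * t" if "x \<in> verts G" for x
    using bij_betwE[OF f(1)] that unfolding wv by fastforce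
  have sw: "simple_graph (wishbone (2 * t + 1))" using t by (intro simple_wishbone) simp
  have nb: "f ` neighbors G x = spider_nb t t (f x)" if "x \<in> verts G" for x
    using isomorphic_neighbors[OF simple sw f that] neighbors_wishbone[OF t range[OF that]] by simp
  show "ennreal ((2 * (real t)\<^sup>2 + 6 * real t - 5) / 6) \<le> access_time G s"
  proof (cases "t \<le> f s")
    case True
    show ?thesis by (rule access_time_ge_spider[OF n t _ f(1)[unfolded wv] nb s True]) auto
  next
    case False
    define g where "g x = spider_flip t (f x)" for x
    have "bij_betw (spider_flip t) {0..<2 * t + 1} {0..<2 * t + 1}"
      by (rule bij_betw_byWitness[of _ "spider_flip t"]) (auto simp: spider_flip_def)
    from bij_betw_trans[OF f(1)[unfolded wv] this] have g: "bij_betw g (verts G) {0..<2 * t + 1}"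
      by (simp add: g_def[abs_def] comp_def)
    have nbg: "g ` neighbors G x = spider_nb t (t - 1) (g x)" if "x \<in> verts G" for x
    proof -
      have "g ` neighbors G x = spider_flip t ` f ` neighbors G x" by (simp add: g_def image_image)
      then show ?thesis unfolding nb[OF that] flip_spider_nb[OF t range[OF that]] by (simp add: g_def)
    qed
    have "t \<le> g s" "g s \<noteq> 2 * t" using False t by (auto simp: g_def spider_flip_def)
    then show ?thesis by (intro access_time_ge_spider[OF n t _ g nbg s]) auto
  qed
qed

section \<open>The path and the wishbone maximise\<close>

text \<open>Since \<open>excess\<close> is an integer with \<open>excess + card offshoots \<le> N\<close>, equality in the bound leaves no offshoots.\<close>

lemma T_bestmix_le_path:
  assumes n: "card (verts G) = 2 * t + 2"
  shows "T_bestmix G \<le> ennreal ((2 * (real t)\<^sup>2 + 8 * real t + 3) / 6)"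
    and "T_bestmix G = ennreal ((2 * (real t)\<^sup>2 + 8 * real t + 3) / 6)
      \<Longrightarrow> isomorphic G (path_graph (2 * t + 2))"
proof -
  define N where "N = m\<^sup>2 + 2 * (\<Sum>k\<in>{1..t}. profit m k)"
  define b where "b = (2 * (real t)\<^sup>2 + 8 * real t + 3) / 6"
  have m: "m = 2 * int t + 1" using n by simp
  have mr: "real_of_int m = 2 * real t + 1" using m by linarith
  have "3 * N = m * (2 * (int t)\<^sup>2 + 8 * int t + 3)"
    using sum_profit_closed[of m t] unfolding N_def m by (simp add: power2_eq_square algebra_simps)
  then have "3 * real_of_int N = real_of_int m * (2 * (real t)\<^sup>2 + 8 * real t + 3)"
    by (metis (mono_tags, lifting) of_int_add of_int_mult of_int_numeral of_int_of_nat_eq of_int_power)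
  then have N: "real_of_int N / (2 * real_of_int m) = b"
    using edge_number_pos by (simp add: b_def field_simps)
  have b: "0 < b" by (simp add: b_def add_nonneg_pos)
  obtain s u v v' where "balanced_root G s u v v'" using exists_balanced by blast
  then interpret balanced_root G s u v v' .
  have le: "excess + int (card offshoots) \<le> N" using excess_le_odd_edges[OF m] by (simp add: N_def)
  have T: "T_bestmix G \<le> ennreal (real_of_int excess / (2 * real_of_int m))"
    using T_bestmix_le[OF s] access_time_le_excess by (rule order_trans)
  show "T_bestmix G \<le> ennreal ((2 * (real t)\<^sup>2 + 8 * real t + 3) / 6)"
    using T
  proof (rule order_trans)
    show "ennreal (real_of_int excess / (2 * real_of_int m)) \<le> ennreal ((2 * (real t)\<^sup>2 + 8 * real t + 3) / 6)"
      unfolding b_def[symmetric] N[symmetric] using le edge_number_pos by (intro ennreal_leI divide_right_mono) auto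
  qed
  assume eq: "T_bestmix G = ennreal ((2 * (real t)\<^sup>2 + 8 * real t + 3) / 6)"
  have "N \<le> excess"
  proof (rule ccontr)
    assume "\<not> N \<le> excess"
    then have "real_of_int excess / (2 * real_of_int m) < b"
      unfolding N[symmetric] using edge_number_pos by (intro divide_strict_right_mono) auto
    then have "ennreal (real_of_int excess / (2 * real_of_int m)) < ennreal b"
      using b by (intro ennreal_lessI)
    with T eq show False by (simp add: b_def)
  qed
  with le have "card offshoots = 0" by linarith
  then have "offshoots = {}" by simp
  from isomorphic_path_if_no_offshoots[OF this] n show "isomorphic G (path_graph (2 * t + 2))" by simp
qed

lemma T_bestmix_le_wishbone:
  assumes n: "card (verts G) = 2 * t + 1" and t: "2 \<le> t"
  shows "T_bestmix G \<le> ennreal ((2 * (real t)\<^sup>2 + 6 * real t - 5) / 6)"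
    and "T_bestmix G = ennreal ((2 * (real t)\<^sup>2 + 6 * real t - 5) / 6)
      \<Longrightarrow> isomorphic G (wishbone (2 * t + 1))"
proof -
  define N where "N = m\<^sup>2 + 2 * (\<Sum>k\<in>{1..t}. profit m k) - 2 * m"
  define b where "b = (2 * (real t)\<^sup>2 + 6 * real t - 5) / 6"
  have m: "m = 2 * int t" using n by simp
  have "3 * N = m * (2 * (int t)\<^sup>2 + 6 * int t - 5)"
    using sum_profit_closed[of m t] unfolding N_def m by (simp add: power2_eq_square algebra_simps)
  then have "real_of_int (3 * N) = real_of_int (m * (2 * (int t)\<^sup>2 + 6 * int t - 5))" by (simp only:)
  then have N: "real_of_int N / (2 * real_of_int m) = b"
    using edge_number_pos by (simp add: b_def field_simps)
  have "2 \<le> real t" using t by simp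
  then have "0 < 2 * (real t)\<^sup>2 + 6 * real t - 5"
    using zero_le_power2[of "real t"] by linarith
  then have b: "0 < b" by (simp add: b_def)
  obtain s u v v' where "balanced_root G s u v v'" using exists_balanced by blast
  then interpret balanced_root G s u v v' .
  have le: "excess \<le> N" using excess_le_even_edges(1)[OF m t] by (simp add: N_def)
  have T: "T_bestmix G \<le> ennreal (real_of_int excess / (2 * real_of_int m))"
    using T_bestmix_le[OF s] access_time_le_excess by (rule order_trans)
  show "T_bestmix G \<le> ennreal ((2 * (real t)\<^sup>2 + 6 * real t - 5) / 6)"
    using T
  proof (rule order_trans)
    show "ennreal (real_of_int excess / (2 * real_of_int m)) \<le> ennreal ((2 * (real t)\<^sup>2 + 6 * real t - 5) / 6)"
      unfolding b_def[symmetric] N[symmetric] using le edge_number_pos by (intro ennreal_leI divide_right_mono) auto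
  qed
  assume eq: "T_bestmix G = ennreal ((2 * (real t)\<^sup>2 + 6 * real t - 5) / 6)"
  have "N \<le> excess"
  proof (rule ccontr)
    assume "\<not> N \<le> excess"
    then have "real_of_int excess / (2 * real_of_int m) < b"
      unfolding N[symmetric] using edge_number_pos by (intro divide_strict_right_mono) auto
    then have "ennreal (real_of_int excess / (2 * real_of_int m)) < ennreal b"
      using b by (intro ennreal_lessI)
    with T eq show False by (simp add: b_def)
  qed
  with le have "excess = N" by simp
  from excess_le_even_edges(2)[OF m t this[unfolded N_def]] isomorphic_wishbone_if_tight[OF n] t
  show "isomorphic G (wishbone (2 * t + 1))" by simp
qed

text \<open>For three vertices the path, the star and the wishbone coincide, and the two bounds of the theorem
agree; the degree sum \<open>4\<close> forces a vertex of degree \<open>2\<close>.\<close>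

lemma three_vertices:
  assumes n: "card (verts G) = 3"
  shows "T_bestmix G = ennreal (1 / 2)" "isomorphic G (wishbone 3)"
proof -
  have "\<exists>c\<in>verts G. 1 < deg G c"
  proof (rule ccontr)
    assume "\<not> ?thesis"
    then have "(\<Sum>c\<in>verts G. deg G c) \<le> (\<Sum>c\<in>verts G. 1)" by (intro sum_mono) (auto simp: not_less)
    then show False using sum_deg n by simp
  qed
  then obtain c where c: "c \<in> verts G" "1 < deg G c" by blast
  then have "int (deg G c) = m" using deg_le[OF c(1)] n by simp
  with c have *: "\<exists>c\<in>verts G. int (deg G c) = m" by blast
  then show "T_bestmix G = ennreal (1 / 2)" by (simp only: T_bestmix_eq_half_iff)
  have "isomorphic G (star_graph 3)" using * isomorphic_star_iff n by simp
  then obtain f where f: "bij_betw f (verts G) {0..<3}"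
    "\<And>u v. u \<in> verts G \<Longrightarrow> v \<in> verts G \<Longrightarrow> adj G u v \<longleftrightarrow> adj (star_graph 3) (f u) (f v)"
    unfolding isomorphic_def verts_star by blast
  (* the centre is 0 in the star and 1 in the wishbone *)
  define g where "g i = (if i = 0 then 1 else if i = 1 then 0 else i)" for i :: nat
  have "bij_betw g {0..<3} {0..<3}"
    by (rule bij_betw_byWitness[of _ g]) (auto simp: g_def)
  from bij_betw_trans[OF f(1) this] have gf: "bij_betw (g \<circ> f) (verts G) (verts (wishbone 3))"
    by (simp add: verts_wishbone)
  show "isomorphic G (wishbone 3)"
  proof (rule isomorphic_if_edge_preserving[OF tree_wishbone gf])
    fix x y assume "adj G x y"
    then have "adj (star_graph 3) (f x) (f y)" using f(2) adj_in_verts by blast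
    moreover have "adj (wishbone 3) (g i) (g j)" if "adj (star_graph 3) i j" for i j
    proof -
      have "(i, j) \<in> {(0, 1), (0, 2), (1, 0), (2, 0)}" using that unfolding adj_star by auto
      then show ?thesis by (auto simp: g_def adj_wishbone adj_path doubleton_eq_iff)
    qed
    ultimately show "adj (wishbone 3) ((g \<circ> f) x) ((g \<circ> f) y)" by simp
  qed simp
qed

end

theorem theorem1p2:
  fixes G :: "'a sgraph" and n :: nat
  assumes "tree G" and "card (verts G) = n" and "n \<ge> 3"
  shows
    "(ennreal (1 / 2) \<le> T_bestmix G \<and>
      T_bestmix G \<le> (if even n then ennreal (1 / 12 * ((real n)\<^sup>2 + 4 * real n - 6))
                     else ennreal (1 / 12 * ((real n)\<^sup>2 + 4 * real n - 15)))) \<and>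
     (tree (star_graph n) \<and> card (verts (star_graph n)) = n \<and>
      T_bestmix (star_graph n) = ennreal (1 / 2) \<and>
      (T_bestmix G = ennreal (1 / 2) \<longleftrightarrow> isomorphic G (star_graph n))) \<and>
     (even n \<longrightarrow>
        tree (path_graph n) \<and> card (verts (path_graph n)) = n \<and>
        T_bestmix (path_graph n) = ennreal (1 / 12 * ((real n)\<^sup>2 + 4 * real n - 6)) \<and>
        (T_bestmix G = ennreal (1 / 12 * ((real n)\<^sup>2 + 4 * real n - 6)) \<longleftrightarrow>
           isomorphic G (path_graph n))) \<and>
     (odd n \<longrightarrow>
        tree (wishbone n) \<and> card (verts (wishbone n)) = n \<and>
        T_bestmix (wishbone n) = ennreal (1 / 12 * ((real n)\<^sup>2 + 4 * real n - 15)) \<and>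
        (T_bestmix G = ennreal (1 / 12 * ((real n)\<^sup>2 + 4 * real n - 15)) \<longleftrightarrow>
           isomorphic G (wishbone n)))"
proof -
  interpret G: nontrivial_tree G using assms by unfold_locales auto
  have trees: "tree (star_graph n)" "tree (path_graph n)" "tree (wishbone n)"
    using assms(3) by (auto intro: tree_star tree_path tree_wishbone)
  have cards: "card (verts (star_graph n)) = n" "card (verts (path_graph n)) = n"
    "card (verts (wishbone n)) = n"
    using assms(3) by (simp_all add: verts_wishbone)
  interpret S: nontrivial_tree "star_graph n" using trees cards assms(3) by unfold_locales auto
  interpret P: nontrivial_tree "path_graph n" using trees cards assms(3) by unfold_locales auto
  interpret W: nontrivial_tree "wishbone n" using trees cards assms(3) by unfold_locales auto
  have lower: "ennreal (1 / 2) \<le> T_bestmix G"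
    by (intro G.T_bestmix_ge G.half_le_access_time(1))
  have star: "T_bestmix (star_graph n) = ennreal (1 / 2)"
    "T_bestmix G = ennreal (1 / 2) \<longleftrightarrow> isomorphic G (star_graph n)"
    using S.T_bestmix_eq_half_iff S.isomorphic_star_iff isomorphic_refl[of "star_graph n"]
      G.T_bestmix_eq_half_iff G.isomorphic_star_iff cards(1) assms(2) by simp_all
  have path: "T_bestmix G \<le> ennreal (1 / 12 * ((real n)\<^sup>2 + 4 * real n - 6)) \<and>
      T_bestmix (path_graph n) = ennreal (1 / 12 * ((real n)\<^sup>2 + 4 * real n - 6)) \<and>
      (T_bestmix G = ennreal (1 / 12 * ((real n)\<^sup>2 + 4 * real n - 6)) \<longleftrightarrow>
         isomorphic G (path_graph n))" if "even n"
  proof -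
    from that obtain k where "n = 2 * k" by blast
    moreover define t where "t = k - 1"
    ultimately have n: "n = 2 * t + 2" using assms(3) by simp
    have b: "1 / 12 * ((real n)\<^sup>2 + 4 * real n - 6) = (2 * (real t)\<^sup>2 + 8 * real t + 3) / 6"
      unfolding n by (simp add: power2_eq_square algebra_simps)
    have iso: "isomorphic (path_graph n) (path_graph (2 * t + 2))"
      unfolding n by (rule isomorphic_refl)
    show ?thesis
      unfolding b
      using G.T_bestmix_le_path[of t] G.T_bestmix_ge_path[of t] P.T_bestmix_le_path(1)[of t]
        P.T_bestmix_ge_path[of t] assms(2) cards(2) n iso
      by (metis order_antisym)
  qed
  have wish: "T_bestmix G \<le> ennreal (1 / 12 * ((real n)\<^sup>2 + 4 * real n - 15)) \<and>
      T_bestmix (wishbone n) = ennreal (1 / 12 * ((real n)\<^sup>2 + 4 * real n - 15)) \<and>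
      (T_bestmix G = ennreal (1 / 12 * ((real n)\<^sup>2 + 4 * real n - 15)) \<longleftrightarrow>
         isomorphic G (wishbone n))" if "odd n"
  proof (cases "n = 3")
    case True
    then have "1 / 12 * ((real n)\<^sup>2 + 4 * real n - 15) = 1 / 2" by (simp add: power2_eq_square)
    then show ?thesis
      using G.three_vertices W.three_vertices(1) assms(2) cards(3) True by simp
  next
    case False
    from that obtain t where n: "n = 2 * t + 1" by (rule oddE)
    have t: "2 \<le> t" using n False assms(3) by simp
    have b: "1 / 12 * ((real n)\<^sup>2 + 4 * real n - 15) = (2 * (real t)\<^sup>2 + 6 * real t - 5) / 6"
      unfolding n by (simp add: power2_eq_square algebra_simps)
    have iso: "isomorphic (wishbone n) (wishbone (2 * t + 1))"
      unfolding n by (rule isomorphic_refl)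
    show ?thesis
      unfolding b
      using G.T_bestmix_le_wishbone[of t] G.T_bestmix_ge_wishbone[of t]
        W.T_bestmix_le_wishbone(1)[of t] W.T_bestmix_ge_wishbone[of t] assms(2) cards(3) n t iso
      by (metis order_antisym)
  qed
  show ?thesis
    using lower star path wish trees cards by simp
qed

end
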